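(* The horizontal $g$-valued 2-form $\omega^{(2)}$ on $J^2\pi$ (defined in the context) is a differential invariant of the action of the pseudogroup $\Gamma$ of all point transformations on $\pi$; that is, it is invariant with respect to $\Gamma^{(2)}$: for every $f\in\Gamma$, every point $p$ in the domain of $f$ and every $\theta_2\in J^2_p\pi$, $$(f^{(2)})^*\Bigl(\omega^{(2)}\bigr|_{f^{(2)}(\theta_2)}\Bigr)=\omega^{(2)}\bigr|_{\theta_2}.$$
   Context: All manifolds and maps are smooth. $[h]^k_p$ denotes the $k$-jet of $h$ at $p$. **Bundle and lifts.** $\pi:E=\mathbb{R}^2\times\mathbb{R}^4\to\mathbb{R}^2$ is the product bundle, with base coordinates $(x^1,x^2)=(x,y)$ and fibre coordinates $u^0,u^1,u^2,u^3$. An ODE $y''=u^0(x,y)+u^1(x,y)y'+u^2(x,y)(y')^2+u^3(x,y)(y')^3$ is identified with the section $(x^1,x^2)\mapsto(x^1,x^2,u^0,\dots,u^3)$ of $\pi$. A point transformation is a diffeomorphism $f$ between open subsets of the base $\mathbb{R}^2$; $\Gamma$ is the pseudogroup of all of them. A point transformation $f$ takes each such ODE to an ODE of the same form, and this defines the lift $f^{(0)}$ of $f$ to $\pi$: with $g=(g^1,g^2)=f^{-1}$, $f^{(0)}$ sends $(p,u^0,\dots,u^3)$ to $(f(p),\tilde u^0,\dots,\tilde u^3)$, where $\tilde u^\alpha$ is the coefficient of $q^\alpha$ in the polynomial $J^{-1}\bigl(u^0a^3+u^1a^2b+u^2ab^2+u^3b^3-aB+bA\bigr)$, with $a=g^1_1+g^1_2q$,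 $b=g^2_1+g^2_2q$, $A=g^1_{11}+2g^1_{12}q+g^1_{22}q^2$, $B=g^2_{11}+2g^2_{12}q+g^2_{22}q^2$, $J=g^1_1g^2_2-g^1_2g^2_1$ (lower indices are partial derivatives of $g^i$ at $f(p)$). $J^k\pi$ is the bundle of $k$-jets of sections of $\pi$, $\pi_k:J^k\pi\to\mathbb{R}^2$ and $\pi_{k,r}:J^k\pi\to J^r\pi$ are the projections, and $J^k_p\pi=\pi_k^{-1}(p)$. The lift $f^{(k)}$ to $J^k\pi$ is $f^{(k)}([S]^k_p)=[f^{(0)}\circ S\circ f^{-1}]^k_{f(p)}$; $\Gamma^{(k)}$ is the pseudogroup generated by all $f^{(k)}$, $f\in\Gamma$. A vector field $X$ on the base with flow $f_t$ has lift $X^{(k)}$, the vector field on $J^k\pi$ with flow $f_t^{(k)}$; $X^{(k)}_{\theta_k}$ depends only on $[X]^{k+2}_p$. **Formal vector fields.** $W_p$ is the Lie algebra of $\infty$-jets at $p$ of vector fields on the base, $L^k_p=\{[X]^\infty_p: [X]^k_p=0\}$ for $k\ge0$, $V_p=W_p/L^0_p\cong T_p\mathbb{R}^2$. $W_p/L^k_p$ is identified with $k$-jets $[X]^k_p$. For $i>j\ge 0$, $\rho_{i,j}:W_p/L^i_p\to W_p/L^j_p$, $[X]^i_p\mapsto[X]^j_p$, and $\rho_i=\rho_{i,0}$. The bracket induces $[\cdot,\cdot]:W_p/L^k_p\times W_p/L^k_p\to W_p/L^{k-1}_p$. A 2-dimensional subspace $H\subset W_p/L^k_p$ is horizontal if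 $\rho_k(H)=V_p$. **The space $g$.** $g=g_p\subset L^1_p/L^2_p$ is the 2-dimensional space of 2-jets (with zero 1-jet) whose second derivatives $X^i_{jk}$ at $p$ satisfy $X^2_{11}=0$, $X^1_{11}-2X^2_{12}=0$, $2X^1_{12}-X^2_{22}=0$, $X^1_{22}=0$. **Isotropy spaces.** For $\theta_{k+1}=[S]^{k+1}_p$ and $\theta_k=\pi_{k+1,k}(\theta_{k+1})$, $\mathcal H_{\theta_{k+1}}\subset T_{\theta_k}J^k\pi$ is the tangent space at $\theta_k$ to the image of $j_kS:q\mapsto[S]^k_q$. Put $\mathcal A_{\theta_{k+1}}=\{[X]^{2+k}_p\in W_p/L^{2+k}_p : X^{(k)}_{\theta_k}\in\mathcal H_{\theta_{k+1}}\}$. If $[X]^{k+2}_p,[Y]^{k+2}_p\in\mathcal A_{\theta_{k+1}}$ ($k\ge1$), their bracket lies in $\mathcal A_{\theta_k}$. **The form $\omega^{(2)}$.** Let $H_p\subset W_p/L^1_p$ be the horizontal subspace of 1-jets of constant vector fields. Let $\theta_2\in J^2_p\pi$, $\theta_1=\pi_{2,1}(\theta_2)$. There is a unique horizontal subspace $H_{\theta_1}\subset\mathcal A_{\theta_1}$ with $\rho_{2,1}(H_{\theta_1})=H_p$ and $[(\rho_2|_{H_{\theta_1}})^{-1}(v),(\rho_2|_{H_{\theta_1}})^{-1}(w)]=0$ in $W_p/L^1_p$ for all $v,w\in V_p$. There is a unique horizontal subspace $H_{\theta_2}\subset\mathcal A_{\theta_2}$ with $\rho_{3,2}(H_{\theta_2})=H_{\theta_1}$.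 Define $\omega_{\theta_2}(v,w)=[(\rho_3|_{H_{\theta_2}})^{-1}(v),(\rho_3|_{H_{\theta_2}})^{-1}(w)]\in W_p/L^2_p$; it takes values in $g_p$, so $\omega_{\theta_2}\in g_p\otimes\wedge^2V_p^*$. The horizontal $g$-valued 2-form $\omega^{(2)}$ on $J^2\pi$ is $\omega^{(2)}|_{\theta_2}=\pi_2^*(\omega_{\theta_2})$. **Invariance.** A point transformation $f$ acts on values by $f_*:L^1_p/L^2_p\to L^1_{f(p)}/L^2_{f(p)}$, $[X]^2_p\mapsto[f_*X]^2_{f(p)}$, which maps $g_p$ onto $g_{f(p)}$; the displayed invariance means $\omega_{f^{(2)}(\theta_2)}(f_*v,f_*w)=f_*\bigl(\omega_{\theta_2}(v,w)\bigr)$ for all $v,w\in V_p\cong T_p\mathbb{R}^2$. *)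

theory Defs
  imports
    "HOL-Analysis.Analysis"
    "HOL-Library.Function_Algebras"
    "HOL-Computational_Algebra.Polynomial"
begin

text \<open>Pointwise real vector space structure on functions, so that \<open>subspace\<close> and \<open>dim\<close> apply
  to jets.\<close>

instantiation "fun" :: (type, real_vector) real_vector
begin

definition scaleR_fun :: "real \<Rightarrow> ('a \<Rightarrow> 'b) \<Rightarrow> 'a \<Rightarrow> 'b" where
  "scaleR_fun r f = (\<lambda>x. r *\<^sub>R f x)"

instance
  by standard (auto simp: scaleR_fun_def fun_eq_iff algebra_simps)

end


section \<open>Smooth maps, point transformations, jets\<close>

text \<open>Only meant for open sets.\<close>

primrec Ck_on :: "nat \<Rightarrow> 'a::euclidean_space set \<Rightarrow> ('a \<Rightarrow> 'b::real_normed_vector) \<Rightarrow> bool" where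
  "Ck_on 0 S h \<longleftrightarrow> continuous_on S h"
| "Ck_on (Suc k) S h \<longleftrightarrow>
     h differentiable_on S \<and> (\<forall>v. Ck_on k S (\<lambda>x. frechet_derivative h (at x) v))"

definition smooth_on :: "'a::euclidean_space set \<Rightarrow> ('a \<Rightarrow> 'b::real_normed_vector) \<Rightarrow> bool" where
  "smooth_on S h \<longleftrightarrow> (\<forall>k. Ck_on k S h)"

definition smooth_near :: "'a::euclidean_space \<Rightarrow> ('a \<Rightarrow> 'b::real_normed_vector) \<Rightarrow> bool" where
  "smooth_near p h \<longleftrightarrow> (\<exists>U. open U \<and> p \<in> U \<and> smooth_on U h)"

text \<open>A diffeomorphism from the open set \<open>U\<close> onto the open set \<open>f ` U\<close>. The values of \<open>f\<close> outside
  \<open>U\<close> are irrelevant, and the inverse of \<open>f\<close> is \<open>inv_into U f\<close>.\<close>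

definition point_transformation :: "(real^2) set \<Rightarrow> (real^2 \<Rightarrow> real^2) \<Rightarrow> bool" where
  "point_transformation U f \<longleftrightarrow>
     open U \<and> open (f ` U) \<and> inj_on f U \<and> smooth_on U f \<and> smooth_on (f ` U) (inv_into U f)"

definition partial :: "2 \<Rightarrow> (real^2 \<Rightarrow> 'b::real_normed_vector) \<Rightarrow> real^2 \<Rightarrow> 'b" where
  "partial i h p = frechet_derivative h (at p) (axis i 1)"

text \<open>A jet at a known point is given by its partial derivatives: \<open>(i, j)\<close> is mapped to the
  derivative taken \<open>i\<close> times in direction 1 and \<open>j\<close> times in direction 2, and to 0 if the order
  \<open>i + j\<close> exceeds the order of the jet. This encodes both the fibres of the jet bundles of
  \<open>\<pi>\<close> and the spaces \<open>W\<^sub>p / L\<^sup>k\<^sub>p\<close> of jets of vector fields.\<close>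

type_synonym 'b jet = "nat \<times> nat \<Rightarrow> 'b"

definition jet :: "nat \<Rightarrow> (real^2 \<Rightarrow> 'b::real_normed_vector) \<Rightarrow> real^2 \<Rightarrow> 'b jet" where
  "jet k h p = (\<lambda>(i, j). if i + j \<le> k then (partial 1 ^^ i) ((partial 2 ^^ j) h) p else 0)"

definition jet_trunc :: "nat \<Rightarrow> 'b::zero jet \<Rightarrow> 'b jet" where
  "jet_trunc k \<xi> = (\<lambda>(i, j). if i + j \<le> k then \<xi> (i, j) else 0)"

text \<open>A smooth germ with a prescribed jet; everything built from it below depends only on
  the jet.\<close>

definition jet_rep :: "nat \<Rightarrow> real^2 \<Rightarrow> 'b::real_normed_vector jet \<Rightarrow> real^2 \<Rightarrow> 'b" where
  "jet_rep k p \<xi> = (SOME h. smooth_near p h \<and> jet k h p = \<xi>)"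


section \<open>The bundle of ODEs, its jet bundles, and lifts of point transformations\<close>

text \<open>The fibre coordinates are \<open>(u\<^sup>0, u\<^sup>1, u\<^sup>2, u\<^sup>3)\<close>. A (local) section of \<open>\<pi>\<close> is represented by
  its fibre component, and a point of a jet bundle of \<open>\<pi>\<close> by its base point and its jet.\<close>

type_synonym fibre = "real \<times> real \<times> real \<times> real"
type_synonym jet_point = "(real^2) \<times> fibre jet"

definition jet_fibre :: "nat \<Rightarrow> real^2 \<Rightarrow> jet_point set" where
  "jet_fibre k p = {(p, jet k u p) | u. smooth_near p u}"

definition jet_proj :: "nat \<Rightarrow> jet_point \<Rightarrow> jet_point" where
  "jet_proj r \<theta> = (fst \<theta>, jet_trunc r (snd \<theta>))"

definition prolong :: "nat \<Rightarrow> (real^2 \<Rightarrow> fibre) \<Rightarrow> real^2 \<Rightarrow> jet_point" where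
  "prolong k u q = (q, jet k u q)"

text \<open>The transformed right-hand side of the ODE as a polynomial in the new first derivative;
  \<open>g\<close> is the inverse of the point transformation and \<open>q\<close> the image point.\<close>

definition ode_poly :: "(real^2 \<Rightarrow> real^2) \<Rightarrow> real^2 \<Rightarrow> fibre \<Rightarrow> real poly" where
  "ode_poly g q = (\<lambda>(u0, u1, u2, u3).
    let d = (\<lambda>i j. partial j g q $ i);
        dd = (\<lambda>i j k. partial j (partial k g) q $ i);
        a = [:d 1 1, d 1 2:];
        b = [:d 2 1, d 2 2:];
        A = [:dd 1 1 1, 2 * dd 1 1 2, dd 1 2 2:];
        B = [:dd 2 1 1, 2 * dd 2 1 2, dd 2 2 2:];
        J = d 1 1 * d 2 2 - d 1 2 * d 2 1
    in smult (inverse J)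
         (smult u0 (a^3) + smult u1 (a^2 * b) + smult u2 (a * b^2) + smult u3 (b^3) - a * B + b * A))"

definition lift0 ::
  "(real^2) set \<Rightarrow> (real^2 \<Rightarrow> real^2) \<Rightarrow> (real^2) \<times> fibre \<Rightarrow> (real^2) \<times> fibre" where
  "lift0 U f = (\<lambda>(p, u). let P = ode_poly (inv_into U f) (f p) u
     in (f p, coeff P 0, coeff P 1, coeff P 2, coeff P 3))"

text \<open>The fibre component of the section \<open>f\<^sup>(\<^sup>0\<^sup>) \<circ> S \<circ> f\<^sup>-\<^sup>1\<close>.\<close>

definition push_section ::
  "(real^2) set \<Rightarrow> (real^2 \<Rightarrow> real^2) \<Rightarrow> (real^2 \<Rightarrow> fibre) \<Rightarrow> real^2 \<Rightarrow> fibre" where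
  "push_section U f u q = snd (lift0 U f (inv_into U f q, u (inv_into U f q)))"

definition lift :: "nat \<Rightarrow> (real^2) set \<Rightarrow> (real^2 \<Rightarrow> real^2) \<Rightarrow> jet_point \<Rightarrow> jet_point" where
  "lift k U f \<theta> =
     prolong k (push_section U f (jet_rep k (fst \<theta>) (snd \<theta>))) (f (fst \<theta>))"


section \<open>Lifts of vector fields and isotropy spaces\<close>

text \<open>Tangent vectors of the jet bundles are given in the global coordinates, hence have the
  type of jet points. This says that the curve \<open>c\<close> has velocity \<open>v\<close> at time 0.\<close>

definition has_velocity :: "(real \<Rightarrow> jet_point) \<Rightarrow> jet_point \<Rightarrow> bool" where
  "has_velocity c v \<longleftrightarrow>
     ((\<lambda>t. fst (c t)) has_vector_derivative fst v) (at 0) \<and>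
     (\<forall>m. ((\<lambda>t. snd (c t) m) has_vector_derivative snd v m) (at 0))"

definition local_flow ::
  "(real^2 \<Rightarrow> real^2) \<Rightarrow> real \<Rightarrow> (real^2) set \<Rightarrow> (real \<Rightarrow> real^2 \<Rightarrow> real^2) \<Rightarrow> bool" where
  "local_flow X \<epsilon> U \<phi> \<longleftrightarrow>
     \<epsilon> > 0 \<and> open U \<and>
     smooth_on ({-\<epsilon><..<\<epsilon>} \<times> U) (\<lambda>(t, q). \<phi> t q) \<and>
     (\<forall>t\<in>{-\<epsilon><..<\<epsilon>}. point_transformation U (\<phi> t)) \<and>
     (\<forall>q\<in>U. \<phi> 0 q = q) \<and>
     (\<forall>t\<in>{-\<epsilon><..<\<epsilon>}. \<forall>q\<in>U. ((\<lambda>s. \<phi> s q) has_vector_derivative X (\<phi> t q)) (at t))"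

text \<open>\<open>has_lift k X \<theta> v\<close>: the lift of the vector field \<open>X\<close> to the \<open>k\<close>-jets has the value \<open>v\<close> at \<open>\<theta>\<close>.
  As local flows of smooth vector fields exist and have unique germs, it does not matter which one
  is used.\<close>

definition has_lift :: "nat \<Rightarrow> (real^2 \<Rightarrow> real^2) \<Rightarrow> jet_point \<Rightarrow> jet_point \<Rightarrow> bool" where
  "has_lift k X \<theta> v \<longleftrightarrow>
     (\<exists>\<epsilon> U \<phi>. fst \<theta> \<in> U \<and> local_flow X \<epsilon> U \<phi> \<and> has_velocity (\<lambda>t. lift k U (\<phi> t) \<theta>) v)"

text \<open>The subspace \<open>\<H>\<^bsub>\<theta>\<^esub>\<close> of the tangent space of the \<open>k\<close>-jets, for a \<open>(k + 1)\<close>-jet \<open>\<theta>\<close>: the velocities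
  at its base point of curves in the image of the \<open>k\<close>-th prolongation of a section with this jet.\<close>

definition jet_plane :: "nat \<Rightarrow> jet_point \<Rightarrow> jet_point set" where
  "jet_plane k \<theta> = {v. \<exists>u \<gamma>. smooth_near (fst \<theta>) u \<and> prolong (k + 1) u (fst \<theta>) = \<theta> \<and>
     \<gamma> 0 = fst \<theta> \<and> has_velocity (\<lambda>t. prolong k u (\<gamma> t)) v}"

text \<open>The space \<open>W\<^sub>p / L\<^sup>k\<^sub>p\<close>.\<close>

definition vf_jets :: "nat \<Rightarrow> real^2 \<Rightarrow> (real^2) jet set" where
  "vf_jets k p = {jet k X p | X. smooth_near p X}"

text \<open>\<open>isotropy k \<theta>\<close> is \<open>\<A>\<^bsub>\<theta>\<^esub> \<subseteq> W\<^sub>p / L\<^sup>k\<^sup>+\<^sup>2\<^sub>p\<close> for a \<open>(k + 1)\<close>-jet \<open>\<theta>\<close>.\<close>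

definition isotropy :: "nat \<Rightarrow> jet_point \<Rightarrow> (real^2) jet set" where
  "isotropy k \<theta> = {jet (k + 2) X (fst \<theta>) | X. smooth_near (fst \<theta>) X \<and>
     (\<exists>v \<in> jet_plane k \<theta>. has_lift k X (jet_proj k \<theta>) v)}"


section \<open>The form\<close>

definition lie_bracket :: "(real^2 \<Rightarrow> real^2) \<Rightarrow> (real^2 \<Rightarrow> real^2) \<Rightarrow> real^2 \<Rightarrow> real^2" where
  "lie_bracket X Y q =
     frechet_derivative Y (at q) (X q) - frechet_derivative X (at q) (Y q)"

text \<open>The bracket of two \<open>k\<close>-jets is a \<open>(k - 1)\<close>-jet.\<close>

definition jet_bracket ::
  "nat \<Rightarrow> real^2 \<Rightarrow> (real^2) jet \<Rightarrow> (real^2) jet \<Rightarrow> (real^2) jet" where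
  "jet_bracket k p \<xi> \<eta> = jet (k - 1) (lie_bracket (jet_rep k p \<xi>) (jet_rep k p \<eta>)) p"

text \<open>The projection \<open>\<rho>\<^sub>k\<close> onto \<open>V\<^sub>p = W\<^sub>p / L\<^sup>0\<^sub>p\<close>, identified with the tangent space
  \<open>real^2\<close> at \<open>p\<close>.\<close>

definition jet_value :: "(real^2) jet \<Rightarrow> real^2" where
  "jet_value \<xi> = \<xi> (0, 0)"

definition horizontal :: "nat \<Rightarrow> real^2 \<Rightarrow> (real^2) jet set \<Rightarrow> bool" where
  "horizontal k p H \<longleftrightarrow> H \<subseteq> vf_jets k p \<and> subspace H \<and> dim H = 2 \<and> jet_value ` H = UNIV"

definition horizontal_lift :: "(real^2) jet set \<Rightarrow> real^2 \<Rightarrow> (real^2) jet" where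
  "horizontal_lift H v = inv_into H jet_value v"

definition constant_jets :: "real^2 \<Rightarrow> (real^2) jet set" where
  "constant_jets p = {jet 1 (\<lambda>_. c) p | c. True}"

text \<open>The unique horizontal subspaces attached to a 1-jet and to a 2-jet of a section.\<close>

definition H1 :: "jet_point \<Rightarrow> (real^2) jet set" where
  "H1 \<theta> = (THE H. horizontal 2 (fst \<theta>) H \<and> H \<subseteq> isotropy 0 \<theta> \<and>
     jet_trunc 1 ` H = constant_jets (fst \<theta>) \<and>
     (\<forall>v w. jet_bracket 2 (fst \<theta>) (horizontal_lift H v) (horizontal_lift H w) = 0))"

definition H2 :: "jet_point \<Rightarrow> (real^2) jet set" where
  "H2 \<theta> = (THE H. horizontal 3 (fst \<theta>) H \<and> H \<subseteq> isotropy 1 \<theta> \<and>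
     jet_trunc 2 ` H = H1 (jet_proj 1 \<theta>))"

text \<open>The 2-form on \<open>V\<^sub>p\<close> attached to a 2-jet \<open>\<theta>\<close> over \<open>p\<close>. Its values are 2-jets of vector fields
  at \<open>p\<close>.\<close>

definition omega :: "jet_point \<Rightarrow> real^2 \<Rightarrow> real^2 \<Rightarrow> (real^2) jet" where
  "omega \<theta> v w =
     jet_bracket 3 (fst \<theta>) (horizontal_lift (H2 \<theta>) v) (horizontal_lift (H2 \<theta>) w)"

text \<open>The action of a point transformation on 2-jets of vector fields is \<open>push_jet 2\<close>. On the
  values of \<open>omega\<close>, whose 1-jets vanish, it depends only on the 2-jet of \<open>f\<close>.\<close>

definition push_field ::
  "(real^2) set \<Rightarrow> (real^2 \<Rightarrow> real^2) \<Rightarrow> (real^2 \<Rightarrow> real^2) \<Rightarrow> real^2 \<Rightarrow> real^2" where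
  "push_field U f X q =
     frechet_derivative f (at (inv_into U f q)) (X (inv_into U f q))"

definition push_jet ::
  "nat \<Rightarrow> (real^2) set \<Rightarrow> (real^2 \<Rightarrow> real^2) \<Rightarrow> real^2 \<Rightarrow> (real^2) jet \<Rightarrow> (real^2) jet" where
  "push_jet k U f p \<xi> = jet k (push_field U f (jet_rep k p \<xi>)) (f p)"

end

theory Submission
  imports Defs
begin

text \<open>
  Let \<open>u\<close> be a section and \<open>X\<close> a vector field on the base. Differentiating the action of the flow of
  \<open>X\<close> gives the defect field \<open>lie_defect X u\<close>, a first order expression in \<open>u\<close> and a second order
  one in \<open>X\<close>. A jet of \<open>X\<close> lies in an isotropy space exactly when this field vanishes at the base
  point to the required order (\<open>isotropy_defect\<close>, \<open>isotropyI\<close>). For 2-jets and 3-jets of \<open>X\<close> this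
  means the linear equations \<open>defect00\<close>, \<open>defect10\<close>, \<open>defect01\<close>. Solving them explicitly gives the
  horizontal subspaces (\<open>H1_eq\<close>, \<open>H2_eq\<close>), and the form turns out to be
  \<open>wedge v w\<close> times a 2-jet \<open>liouville_jet\<close> built from the two classical Liouville expressions
  in the 2-jet of \<open>u\<close> (\<open>omega_eq\<close>).

  The definition of the form starts from the constant vector fields, and a point transformation
  does not preserve these. The point of the proof is that the choice does not matter. Take any
  two fields \<open>X\<close>, \<open>Y\<close> with independent values, with 3-jets in the isotropy space, and with
  bracket vanishing to first order. Then the second order part of \<open>[X, Y]\<close> is the Liouville jet
  times the determinant of the two values, whatever the first derivatives of \<open>X\<close> and \<open>Y\<close> are
  (\<open>bracket_frame\<close>). In terms of connections: \<open>X\<close> and \<open>Y\<close> amount to a torsion-free connection at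
  the point, the isotropy equations make their second and third order parts its projective
  Schouten tensor and the derivative of it, and the bracket is the Cotton tensor. In
  dimension two the Cotton tensor depends on the projective structure alone.

  Invariance is then a matter of naturality. If \<open>X\<close>, \<open>Y\<close> represent the horizontal lifts at
  \<open>\<theta>\<close>, their push-forwards under \<open>f\<close> have defect fields that again vanish to first order with
  respect to the transformed section (\<open>lie_defect_natural\<close>), and their bracket is the push-forward of
  \<open>[X, Y]\<close>. By \<open>bracket_frame\<close> the 2-jet of this bracket is the Liouville jet at the image point
  times the Jacobian of \<open>f\<close>. This is the assertion.

  Two analytic facts are needed on the way. The lift of a vector field is defined by a flow, so its
  velocity has to be computed for an arbitrary local flow (\<open>lift_velocity\<close>); and the isotropy
  spaces have to be large enough, so every jet with non-zero value must come from a field which has a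
  flow. Such a field is constructed by straightening coordinates
  (\<open>vector_field_with_jet_and_flow\<close>).
\<close>

section \<open>Closure properties of smooth maps\<close>

abbreviation dirderiv :: "'a::real_normed_vector \<Rightarrow> ('a \<Rightarrow> 'b::real_normed_vector) \<Rightarrow> 'a \<Rightarrow> 'b" where
  "dirderiv v h \<equiv> (\<lambda>q. frechet_derivative h (at q) v)"

lemma frechet_derivative_cong_open:
  assumes "open S" "x \<in> S" "\<And>y. y \<in> S \<Longrightarrow> f y = g y"
  shows "frechet_derivative f (at x) = frechet_derivative g (at x)"
proof -
  have "(f has_derivative D) (at x) \<longleftrightarrow> (g has_derivative D) (at x)" for D
    using has_derivative_transform_within_open[of f D x UNIV S g]
      has_derivative_transform_within_open[of g D x UNIV S f] assms by auto
  then show ?thesis unfolding frechet_derivative_def by simp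
qed

lemma frechet_derivative_eqI:
  "(f has_derivative f') (at x) \<Longrightarrow> frechet_derivative f (at x) v = f' v"
  by (metis frechet_derivative_at)

lemma differentiable_at_if_Ck:
  assumes "open S" "x \<in> S" "Ck_on (Suc k) S f"
  shows "(f has_derivative (\<lambda>v. frechet_derivative f (at x) v)) (at x)"
  using assms by (simp add: differentiable_on_eq_differentiable_at frechet_derivative_works[symmetric])

lemma Ck_on_cong:
  assumes "open S" "\<And>x. x \<in> S \<Longrightarrow> f x = g x"
  shows "Ck_on k S f \<longleftrightarrow> Ck_on k S g"
  using assms
proof (induction k arbitrary: f g)
  case 0 then show ?case by (auto cong: continuous_on_cong)
next
  case (Suc k)
  have 1: "f differentiable_on S \<longleftrightarrow> g differentiable_on S"
    using Suc.prems(2) unfolding differentiable_on_def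
    by (metis differentiable_transform_within zero_less_one)
  have 2: "Ck_on k S (dirderiv v f) \<longleftrightarrow> Ck_on k S (dirderiv v g)" for v
    by (rule Suc.IH[OF Suc.prems(1)])
      (simp add: frechet_derivative_cong_open[OF Suc.prems(1) _ Suc.prems(2)])
  show ?case using 1 2 by simp
qed

lemma Ck_on_subset:
  assumes "Ck_on k S f" "T \<subseteq> S"
  shows "Ck_on k T f"
  using assms
  by (induction k arbitrary: f) (auto intro: continuous_on_subset differentiable_on_subset)

lemma Ck_on_SucD: "Ck_on (Suc k) S f \<Longrightarrow> Ck_on k S f"
  by (induction k arbitrary: f) (auto intro: differentiable_imp_continuous_on)

lemma Ck_on_const: "Ck_on k S (\<lambda>x. c)"
  by (induction k arbitrary: c) (auto simp: differentiable_on_def)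

text \<open>The induction steps below all compute a derivative explicitly and then apply the induction
  hypothesis to it; this rule packages that step.\<close>

lemma Ck_on_SucI:
  assumes "open S" "\<And>x. x \<in> S \<Longrightarrow> (f has_derivative f' x) (at x)"
    and "\<And>v. Ck_on k S (\<lambda>x. f' x v)"
  shows "Ck_on (Suc k) S f"
proof -
  have "Ck_on k S (dirderiv v f)" for v
    using assms(3)[of v] Ck_on_cong[OF assms(1), of "dirderiv v f" "\<lambda>x. f' x v" k]
      frechet_derivative_eqI[OF assms(2)] by auto
  moreover have "f differentiable_on S"
    using assms(1,2) by (auto simp: differentiable_on_eq_differentiable_at differentiable_def)
  ultimately show ?thesis by simp
qed

lemma Ck_on_linear:
  assumes "bounded_linear A" "open S"
  shows "Ck_on k S A"
proof (cases k)
  case 0 then show ?thesis using assms by (auto intro: linear_continuous_on)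
next
  case (Suc j)
  show ?thesis unfolding Suc
    by (rule Ck_on_SucI[where f'="\<lambda>x. A"])
      (auto intro: assms bounded_linear_imp_has_derivative Ck_on_const)
qed

lemma Ck_on_add:
  assumes "open S" "Ck_on k S f" "Ck_on k S g"
  shows "Ck_on k S (\<lambda>x. f x + g x)"
  using assms
proof (induction k arbitrary: f g)
  case 0 then show ?case by (auto intro: continuous_on_add)
next
  case (Suc k)
  show ?case
    by (rule Ck_on_SucI[where f'="\<lambda>x v. frechet_derivative f (at x) v + frechet_derivative g (at x) v"])
      (use Suc in \<open>auto intro!: has_derivative_add differentiable_at_if_Ck[of S _ k]\<close>)
qed

lemma Ck_on_bilinear:
  assumes "bounded_bilinear prd" "open S" "Ck_on k S f" "Ck_on k S g"
  shows "Ck_on k S (\<lambda>x. prd (f x) (g x))"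
  using assms(2-)
proof (induction k arbitrary: f g)
  case 0 then show ?case by (auto intro: bounded_bilinear.continuous_on[OF assms(1)])
next
  case (Suc k)
  have "Ck_on k S f" "Ck_on k S g" using Suc.prems Ck_on_SucD by blast+
  with Suc show ?case
    by (intro Ck_on_SucI[where f'="\<lambda>x v. prd (f x) (frechet_derivative g (at x) v)
        + prd (frechet_derivative f (at x) v) (g x)"])
      (auto intro!: bounded_bilinear.FDERIV[OF assms(1)] Ck_on_add differentiable_at_if_Ck[of S _ k])
qed

lemma Ck_on_linear_image:
  assumes "bounded_linear A" "open S" "Ck_on k S f"
  shows "Ck_on k S (\<lambda>x. A (f x))"
  using assms(2-)
proof (induction k arbitrary: f)
  case 0 then show ?case by (auto intro: bounded_linear.continuous_on[OF assms(1)])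
next
  case (Suc k)
  then show ?case
    by (intro Ck_on_SucI[where f'="\<lambda>x v. A (frechet_derivative f (at x) v)"])
      (auto intro!: bounded_linear.has_derivative[OF assms(1)] differentiable_at_if_Ck[of S _ k])
qed

lemma Ck_on_sum:
  assumes "open S" "\<And>i. i \<in> A \<Longrightarrow> Ck_on k S (f i)"
  shows "Ck_on k S (\<lambda>x. \<Sum>i\<in>A. f i x)"
  using assms(2)
proof (induction A rule: infinite_finite_induct)
  case (insert a A)
  then show ?case by (simp add: Ck_on_add[OF assms(1)])
qed (auto simp: Ck_on_const)

lemma frechet_derivative_sum_Basis:
  fixes f :: "'a::euclidean_space \<Rightarrow> 'b::real_normed_vector"
  assumes "f differentiable (at x)"
  shows "frechet_derivative f (at x) w = (\<Sum>b\<in>Basis. (w \<bullet> b) *\<^sub>R frechet_derivative f (at x) b)"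
proof -
  have lin: "linear (frechet_derivative f (at x))" using assms by (rule linear_frechet_derivative)
  have "frechet_derivative f (at x) w = frechet_derivative f (at x) (\<Sum>b\<in>Basis. (w \<bullet> b) *\<^sub>R b)"
    by (simp add: euclidean_representation)
  also have "\<dots> = (\<Sum>b\<in>Basis. (w \<bullet> b) *\<^sub>R frechet_derivative f (at x) b)"
    by (simp add: linear_sum[OF lin] linear_cmul[OF lin])
  finally show ?thesis .
qed

text \<open>The derivative of the composition in direction \<open>v\<close> has to be seen as a \<open>k\<close> times differentiable
  map again. Expanding the inner derivative in the standard basis turns it into a sum of products of
  directional derivatives, to which the induction hypothesis and bilinearity apply.\<close>

lemma Ck_on_compose:
  fixes f :: "'b::euclidean_space \<Rightarrow> 'c::real_normed_vector" and g :: "'a::euclidean_space \<Rightarrow> 'b"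
  assumes "open S" "open T" "Ck_on k T f" "Ck_on k S g" "\<And>x. x \<in> S \<Longrightarrow> g x \<in> T"
  shows "Ck_on k S (\<lambda>x. f (g x))"
  using assms(3,4)
proof (induction k arbitrary: f)
  case 0 then show ?case using assms(5)
    by (auto intro: continuous_on_compose2[of T f S g])
next
  case (Suc k)
  have g: "Ck_on k S g" using Suc.prems(2) by (rule Ck_on_SucD)
  have comp: "Ck_on k S (\<lambda>x. \<Sum>b\<in>Basis. (frechet_derivative g (at x) v \<bullet> b) *\<^sub>R
      frechet_derivative f (at (g x)) b)" for v
  proof (intro Ck_on_sum assms Ck_on_bilinear[OF bounded_bilinear_scaleR])
    fix b :: 'b
    show "Ck_on k S (\<lambda>x. frechet_derivative g (at x) v \<bullet> b)"
      using Suc.prems(2) by (intro Ck_on_linear_image[OF bounded_linear_inner_left] assms) auto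
    show "Ck_on k S (\<lambda>x. frechet_derivative f (at (g x)) b)"
      by (rule Suc.IH[OF _ g]) (use Suc.prems(1) in auto)
  qed
  have der: "((\<lambda>x. f (g x)) has_derivative (\<lambda>v. \<Sum>b\<in>Basis. (frechet_derivative g (at x) v \<bullet> b) *\<^sub>R
      frechet_derivative f (at (g x)) b)) (at x)" if "x \<in> S" for x
  proof -
    have gx: "(g has_derivative (\<lambda>v. frechet_derivative g (at x) v)) (at x)"
      using that Suc.prems(2) assms(1) by (rule differentiable_at_if_Ck[rotated])
    have fx: "(f has_derivative (\<lambda>v. frechet_derivative f (at (g x)) v)) (at (g x))"
      using that Suc.prems(1) assms(2,5) by (intro differentiable_at_if_Ck[of T]) auto
    have "((\<lambda>x. f (g x)) has_derivative (\<lambda>v. frechet_derivative f (at (g x)) (frechet_derivative g (at x) v))) (at x)"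
      using diff_chain_at[OF gx fx] by (simp add: o_def)
    moreover have "(\<lambda>v. frechet_derivative f (at (g x)) (frechet_derivative g (at x) v)) =
      (\<lambda>v. \<Sum>b\<in>Basis. (frechet_derivative g (at x) v \<bullet> b) *\<^sub>R frechet_derivative f (at (g x)) b)"
      using fx by (intro ext frechet_derivative_sum_Basis) (auto simp: differentiable_def)
    ultimately show ?thesis by (rule subst[rotated])
  qed
  show ?case by (rule Ck_on_SucI[OF assms(1) der comp])
qed

lemma Ck_on_inverse:
  "Ck_on k (- {0}) (inverse :: real \<Rightarrow> real)"
proof (induction k)
  case 0 show ?case by (auto intro!: continuous_intros)
next
  case (Suc k)
  have "Ck_on k (- {0}) (\<lambda>x::real. - (inverse x * v * inverse x))" for v
    using Ck_on_bilinear[OF bounded_bilinear_mult _ Ck_on_bilinear[OF bounded_bilinear_mult _ Suc Ck_on_const] Suc]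
    by (intro Ck_on_linear_image[OF bounded_linear_minus[OF bounded_linear_ident]]) auto
  then show ?case
    by (intro Ck_on_SucI[where f'="\<lambda>x v. - (inverse x * v * inverse x)"])
      (auto intro!: derivative_eq_intros)
qed

lemma smooth_on_subset: "smooth_on S f \<Longrightarrow> T \<subseteq> S \<Longrightarrow> smooth_on T f"
  unfolding smooth_on_def using Ck_on_subset by blast

lemma smooth_on_cong:
  "open S \<Longrightarrow> (\<And>x. x \<in> S \<Longrightarrow> f x = g x) \<Longrightarrow> smooth_on S f \<longleftrightarrow> smooth_on S g"
  unfolding smooth_on_def using Ck_on_cong by blast

lemma smooth_on_const: "smooth_on S (\<lambda>x. c)"
  by (simp add: smooth_on_def Ck_on_const)

lemma smooth_on_linear: "bounded_linear A \<Longrightarrow> open S \<Longrightarrow> smooth_on S A"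
  by (simp add: smooth_on_def Ck_on_linear)

lemma smooth_on_ident: "open S \<Longrightarrow> smooth_on S (\<lambda>x. x)"
  by (rule smooth_on_linear[OF bounded_linear_ident])

lemma smooth_on_add:
  "open S \<Longrightarrow> smooth_on S f \<Longrightarrow> smooth_on S g \<Longrightarrow> smooth_on S (\<lambda>x. f x + g x)"
  by (simp add: smooth_on_def Ck_on_add)

lemma smooth_on_bilinear:
  "bounded_bilinear prd \<Longrightarrow> open S \<Longrightarrow> smooth_on S f \<Longrightarrow> smooth_on S g \<Longrightarrow> smooth_on S (\<lambda>x. prd (f x) (g x))"
  by (simp add: smooth_on_def Ck_on_bilinear)

lemma smooth_on_linear_image:
  "bounded_linear A \<Longrightarrow> open S \<Longrightarrow> smooth_on S f \<Longrightarrow> smooth_on S (\<lambda>x. A (f x))"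
  by (simp add: smooth_on_def Ck_on_linear_image)

lemmas smooth_on_mult = smooth_on_bilinear[OF bounded_bilinear_mult]
lemmas smooth_on_scaleR = smooth_on_bilinear[OF bounded_bilinear_scaleR]
lemmas smooth_on_minus = smooth_on_linear_image[OF bounded_linear_minus[OF bounded_linear_ident]]
lemmas smooth_on_nth = smooth_on_linear_image[OF bounded_linear_vec_nth]
lemmas smooth_on_fst = smooth_on_linear_image[OF bounded_linear_fst]
lemmas smooth_on_snd = smooth_on_linear_image[OF bounded_linear_snd]

lemma smooth_on_diff:
  "open S \<Longrightarrow> smooth_on S f \<Longrightarrow> smooth_on S g \<Longrightarrow> smooth_on S (\<lambda>x. f x - g x)"
  using smooth_on_add[of S f "\<lambda>x. - g x"] smooth_on_minus[of S g] by simp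

lemma smooth_on_Pair:
  assumes "open S" "smooth_on S f" "smooth_on S g"
  shows "smooth_on S (\<lambda>x. (f x, g x))"
proof -
  have "bounded_linear (\<lambda>a. (a, 0))" "bounded_linear (\<lambda>b. (0, b))"
    by (rule bounded_linear_Pair[OF bounded_linear_ident bounded_linear_zero],
        rule bounded_linear_Pair[OF bounded_linear_zero bounded_linear_ident])
  then have "smooth_on S (\<lambda>x. (f x, 0) + (0, g x))"
    using smooth_on_add[OF assms(1) smooth_on_linear_image[OF _ assms(1,2)]
        smooth_on_linear_image[OF _ assms(1,3)]] by blast
  then show ?thesis by (simp only: add_Pair add_0_left add_0_right)
qed

lemma smooth_on_compose:
  "open S \<Longrightarrow> open T \<Longrightarrow> smooth_on T f \<Longrightarrow> smooth_on S g \<Longrightarrow> (\<And>x. x \<in> S \<Longrightarrow> g x \<in> T) \<Longrightarrow>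
    smooth_on S (\<lambda>x. f (g x))"
  unfolding smooth_on_def using Ck_on_compose[of S T _ f g] by blast

lemma smooth_on_inverse:
  fixes f :: "'a::euclidean_space \<Rightarrow> real"
  shows "open S \<Longrightarrow> smooth_on S f \<Longrightarrow> (\<And>x. x \<in> S \<Longrightarrow> f x \<noteq> 0) \<Longrightarrow> smooth_on S (\<lambda>x. inverse (f x))"
  by (rule smooth_on_compose[where T="- {0}"]) (auto simp: smooth_on_def Ck_on_inverse)

lemma smooth_on_divide:
  fixes f :: "'a::euclidean_space \<Rightarrow> real"
  shows "open S \<Longrightarrow> smooth_on S f \<Longrightarrow> smooth_on S g \<Longrightarrow> (\<And>x. x \<in> S \<Longrightarrow> g x \<noteq> 0) \<Longrightarrow>
    smooth_on S (\<lambda>x. f x / g x)"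
  by (simp add: divide_inverse smooth_on_mult smooth_on_inverse)

lemma smooth_on_sum:
  "open S \<Longrightarrow> (\<And>i. i \<in> A \<Longrightarrow> smooth_on S (f i)) \<Longrightarrow> smooth_on S (\<lambda>x. \<Sum>i\<in>A. f i x)"
  by (simp add: smooth_on_def Ck_on_sum)

lemma smooth_on_power:
  fixes f :: "'a::euclidean_space \<Rightarrow> real"
  shows "open S \<Longrightarrow> smooth_on S f \<Longrightarrow> smooth_on S (\<lambda>x. f x ^ n)"
  by (induction n) (auto simp: smooth_on_const smooth_on_mult)

lemma smooth_on_dirderiv: "smooth_on S f \<Longrightarrow> smooth_on S (dirderiv v f)"
  unfolding smooth_on_def using Ck_on.simps(2) by blast

lemma smooth_on_continuous_on: "smooth_on S f \<Longrightarrow> continuous_on S f"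
  unfolding smooth_on_def using Ck_on.simps(1) by blast

lemma smooth_on_has_derivative:
  "smooth_on S f \<Longrightarrow> open S \<Longrightarrow> x \<in> S \<Longrightarrow> (f has_derivative frechet_derivative f (at x)) (at x)"
  unfolding smooth_on_def using differentiable_at_if_Ck[of S x _ f] by metis

lemma smooth_on_differentiable:
  "smooth_on S f \<Longrightarrow> open S \<Longrightarrow> x \<in> S \<Longrightarrow> f differentiable (at x)"
  using smooth_on_has_derivative differentiable_def by blast

lemma smooth_on_linear_derivative:
  "smooth_on S f \<Longrightarrow> open S \<Longrightarrow> x \<in> S \<Longrightarrow> linear (frechet_derivative f (at x))"
  using smooth_on_differentiable linear_frechet_derivative by blast

lemma smooth_onI_derivative:
  assumes "open S" "\<And>x. x \<in> S \<Longrightarrow> (f has_derivative f' x) (at x)"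
    and "\<And>v. smooth_on S (\<lambda>x. f' x v)"
  shows "smooth_on S f"
  unfolding smooth_on_def
proof
  fix k
  show "Ck_on k S f"
    using Ck_on_SucI[OF assms(1,2)] Ck_on_SucD assms(3) smooth_on_def by blast
qed

lemma smooth_on_derivative_along:
  fixes f :: "'a::euclidean_space \<Rightarrow> 'b::real_normed_vector"
  assumes "open S" "smooth_on S f" "smooth_on S Z"
  shows "smooth_on S (\<lambda>x. frechet_derivative f (at x) (Z x))"
proof -
  have "Ck_on k S (\<lambda>x. \<Sum>b\<in>Basis. (Z x \<bullet> b) *\<^sub>R frechet_derivative f (at x) b)" for k
    using assms smooth_on_dirderiv[OF assms(2)] unfolding smooth_on_def
    by (intro Ck_on_sum Ck_on_bilinear[OF bounded_bilinear_scaleR] Ck_on_linear_image[OF bounded_linear_inner_left]) auto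
  then have "smooth_on S (\<lambda>x. \<Sum>b\<in>Basis. (Z x \<bullet> b) *\<^sub>R frechet_derivative f (at x) b)"
    by (simp add: smooth_on_def)
  moreover have "frechet_derivative f (at x) (Z x) = (\<Sum>b\<in>Basis. (Z x \<bullet> b) *\<^sub>R frechet_derivative f (at x) b)"
    if "x \<in> S" for x
    using frechet_derivative_sum_Basis smooth_on_differentiable[OF assms(2,1) that] .
  ultimately show ?thesis
    by (rule iffD2[OF smooth_on_cong[OF assms(1)], rotated])
qed

section \<open>Symmetry of second derivatives\<close>

lemma has_real_derivative_along_line:
  fixes f :: "'a::real_normed_vector \<Rightarrow> real"
  assumes "(f has_derivative f') (at (x + a *\<^sub>R v))"
  shows "((\<lambda>t. f (x + t *\<^sub>R v)) has_real_derivative f' v) (at a)"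
proof -
  have "((\<lambda>t. x + t *\<^sub>R v) has_derivative (\<lambda>t. t *\<^sub>R v)) (at a)"
    by (auto intro!: derivative_eq_intros)
  from diff_chain_at[OF this assms] have "((\<lambda>t. f (x + t *\<^sub>R v)) has_derivative (\<lambda>t. f' (t *\<^sub>R v))) (at a)"
    by (simp add: o_def)
  moreover have "(\<lambda>t. f' (t *\<^sub>R v)) = (*) (f' v)"
    using linear_cmul[OF has_derivative_linear[OF assms]] by (auto simp: fun_eq_iff)
  ultimately show ?thesis by (simp add: has_field_derivative_def)
qed

text \<open>Two applications of the mean value theorem, first in direction \<open>v\<close>, then in direction \<open>w\<close>. The left
  side is symmetric in \<open>v\<close> and \<open>w\<close>, which yields the symmetry of second derivatives in the limit.\<close>

lemma second_difference_mean_value: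
  fixes f :: "'a::euclidean_space \<Rightarrow> real"
  assumes S: "open S" and f: "smooth_on S f" and s: "s > 0"
    and in_S: "\<And>a b. a \<in> {0..s} \<Longrightarrow> b \<in> {0..s} \<Longrightarrow> x + a *\<^sub>R v + b *\<^sub>R w \<in> S"
  shows "\<exists>a\<in>{0..s}. \<exists>b\<in>{0..s}. f (x + s *\<^sub>R v + s *\<^sub>R w) - f (x + s *\<^sub>R v) - f (x + s *\<^sub>R w) + f x
    = s * s * dirderiv w (dirderiv v f) (x + a *\<^sub>R v + b *\<^sub>R w)"
proof -
  let ?h = "\<lambda>a. f ((x + s *\<^sub>R w) + a *\<^sub>R v) - f (x + a *\<^sub>R v)"
  let ?g = "dirderiv v f"
  have "(?h has_real_derivative ?g ((x + s *\<^sub>R w) + a *\<^sub>R v) - ?g (x + a *\<^sub>R v)) (at a)"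
    if "0 \<le> a" "a \<le> s" for a
    using in_S[of a s] in_S[of a 0] that s
    by (intro derivative_intros has_real_derivative_along_line smooth_on_has_derivative[OF f S])
      (auto simp: algebra_simps)
  from MVT2[OF s this] obtain a where a: "0 < a" "a < s"
    "?h s - ?h 0 = (s - 0) * (?g ((x + s *\<^sub>R w) + a *\<^sub>R v) - ?g (x + a *\<^sub>R v))" by auto
  have "((\<lambda>b. ?g ((x + a *\<^sub>R v) + b *\<^sub>R w)) has_real_derivative dirderiv w ?g (x + a *\<^sub>R v + b *\<^sub>R w)) (at b)"
    if "0 \<le> b" "b \<le> s" for b
    using in_S[of a b] that s a
    by (intro has_real_derivative_along_line smooth_on_has_derivative[OF smooth_on_dirderiv[OF f] S]) auto
  from MVT2[OF s this] obtain b where b: "0 < b" "b < s"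
    "?g (x + a *\<^sub>R v + s *\<^sub>R w) - ?g (x + a *\<^sub>R v + 0 *\<^sub>R w) = (s - 0) * dirderiv w ?g (x + a *\<^sub>R v + b *\<^sub>R w)"
    by auto
  have e: "x + a *\<^sub>R v + s *\<^sub>R w = (x + s *\<^sub>R w) + a *\<^sub>R v" by simp
  have "f (x + s *\<^sub>R v + s *\<^sub>R w) - f (x + s *\<^sub>R v) - f (x + s *\<^sub>R w) + f x = ?h s - ?h 0"
    by (simp add: algebra_simps)
  also have "\<dots> = s * (s * dirderiv w ?g (x + a *\<^sub>R v + b *\<^sub>R w))"
    using a(3) b(3) unfolding e by simp
  finally have "f (x + s *\<^sub>R v + s *\<^sub>R w) - f (x + s *\<^sub>R v) - f (x + s *\<^sub>R w) + f x
    = s * s * dirderiv w ?g (x + a *\<^sub>R v + b *\<^sub>R w)" by (simp only: mult.assoc)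
  then show ?thesis
    using a(1,2) b(1,2) by (intro bexI[of _ a] bexI[of _ b]) auto
qed

lemma dirderiv_commute_real:
  fixes f :: "'a::euclidean_space \<Rightarrow> real"
  assumes S: "open S" and f: "smooth_on S f" and x: "x \<in> S"
  shows "dirderiv w (dirderiv v f) x = dirderiv v (dirderiv w f) x"
proof (rule ccontr)
  let ?A = "dirderiv w (dirderiv v f)" and ?B = "dirderiv v (dirderiv w f)"
  assume "?A x \<noteq> ?B x"
  define e where "e = dist (?A x) (?B x) / 2"
  have e: "e > 0" using \<open>?A x \<noteq> ?B x\<close> by (simp add: e_def)
  have cont: "isCont ?A x" "isCont ?B x"
    using S x smooth_on_continuous_on[OF smooth_on_dirderiv[OF smooth_on_dirderiv[OF f]]]
      continuous_on_eq_continuous_at by blast+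
  obtain d1 where d1: "d1 > 0" "\<And>y. dist y x < d1 \<Longrightarrow> dist (?A y) (?A x) < e"
    using cont(1) e unfolding continuous_at_eps_delta by blast
  obtain d2 where d2: "d2 > 0" "\<And>y. dist y x < d2 \<Longrightarrow> dist (?B y) (?B x) < e"
    using cont(2) e unfolding continuous_at_eps_delta by blast
  obtain d3 where d3: "d3 > 0" "ball x d3 \<subseteq> S" using S x open_contains_ball by blast
  define d where "d = min d1 (min d2 d3)"
  define s where "s = d / (2 * (1 + norm v + norm w))"
  have d: "d > 0" using d1 d2 d3 by (simp add: d_def)
  have n: "1 + norm v + norm w > 0"
    by (simp add: add_pos_nonneg)
  have s: "s > 0" using d n by (simp add: s_def)
  have near: "dist (x + a *\<^sub>R v' + b *\<^sub>R w') x < d"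
    if "a \<in> {0..s}" "b \<in> {0..s}" "norm v' + norm w' = norm v + norm w" for a b v' w'
  proof -
    have "dist (x + a *\<^sub>R v' + b *\<^sub>R w') x = norm (a *\<^sub>R v' + b *\<^sub>R w')"
      by (simp add: dist_norm)
    also have "\<dots> \<le> a * norm v' + b * norm w'"
      using that by (intro norm_triangle_le) simp
    also have "\<dots> \<le> s * norm v' + s * norm w'"
      using that by (intro add_mono mult_right_mono) auto
    also have "\<dots> = s * (norm v + norm w)" using that by (simp add: distrib_left[symmetric])
    also have "\<dots> \<le> s * (1 + norm v + norm w)" using s by simp
    also have "\<dots> = d / 2"
    proof -
      have e: "c \<noteq> 0 \<Longrightarrow> d / (2 * c) * c = d / 2" for c by simp
      show ?thesis unfolding s_def by (rule e) (use n in linarith)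
    qed
    also have "\<dots> < d" using d by simp
    finally show ?thesis .
  qed
  have ballS: "y \<in> S" if "dist y x < d" for y
    using that d3 by (auto simp: d_def dist_commute)
  have inS: "x + a *\<^sub>R v + b *\<^sub>R w \<in> S" "x + a *\<^sub>R w + b *\<^sub>R v \<in> S"
    if "a \<in> {0..s}" "b \<in> {0..s}" for a b
    using near[OF that, of v w] near[OF that, of w v] ballS by auto
  obtain a b where ab: "a \<in> {0..s}" "b \<in> {0..s}"
    "f (x + s *\<^sub>R v + s *\<^sub>R w) - f (x + s *\<^sub>R v) - f (x + s *\<^sub>R w) + f x = s * s * ?A (x + a *\<^sub>R v + b *\<^sub>R w)"
    using second_difference_mean_value[OF S f s inS(1)] by blast
  obtain a' b' where ab': "a' \<in> {0..s}" "b' \<in> {0..s}"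
    "f (x + s *\<^sub>R w + s *\<^sub>R v) - f (x + s *\<^sub>R w) - f (x + s *\<^sub>R v) + f x = s * s * ?B (x + a' *\<^sub>R w + b' *\<^sub>R v)"
    using second_difference_mean_value[OF S f s inS(2)] by blast
  have "s * s * ?A (x + a *\<^sub>R v + b *\<^sub>R w) = s * s * ?B (x + a' *\<^sub>R w + b' *\<^sub>R v)"
    using ab(3) ab'(3) by (simp add: algebra_simps)
  then have eq: "?A (x + a *\<^sub>R v + b *\<^sub>R w) = ?B (x + a' *\<^sub>R w + b' *\<^sub>R v)"
    using s by simp
  have "dist (?A (x + a *\<^sub>R v + b *\<^sub>R w)) (?A x) < e" "dist (?B (x + a' *\<^sub>R w + b' *\<^sub>R v)) (?B x) < e"
    using d1(2) d2(2) near[OF ab(1,2), of v w] near[OF ab'(1,2), of w v] by (auto simp: d_def)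
  then have "dist (?A x) (?B x) < 2 * e"
    unfolding eq dist_real_def by linarith
  then show False by (simp add: e_def)
qed

lemma dirderiv_linear_image:
  assumes "bounded_linear A" "f differentiable (at x)"
  shows "dirderiv v (\<lambda>x. A (f x)) x = A (dirderiv v f x)"
  by (rule frechet_derivative_eqI, rule bounded_linear.has_derivative[OF assms(1)])
    (use assms(2) frechet_derivative_works in blast)

lemma dirderiv_compose:
  assumes "f differentiable (at (g x))" "g differentiable (at x)"
  shows "dirderiv v (\<lambda>x. f (g x)) x = frechet_derivative f (at (g x)) (dirderiv v g x)"
  using frechet_derivative_eqI[OF diff_chain_at[OF assms(2,1)[unfolded frechet_derivative_works]], of v]
  by (simp add: o_def)

lemma dirderiv_commute:
  fixes f :: "'a::euclidean_space \<Rightarrow> 'b::euclidean_space"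
  assumes S: "open S" and f: "smooth_on S f" and x: "x \<in> S"
  shows "dirderiv w (dirderiv v f) x = dirderiv v (dirderiv w f) x"
proof (rule euclidean_eqI)
  fix b :: 'b
  have *: "dirderiv w (dirderiv v (\<lambda>x. f x \<bullet> b)) x = dirderiv w (dirderiv v f) x \<bullet> b" for v w
  proof -
    have "dirderiv w (dirderiv v (\<lambda>x. f x \<bullet> b)) x = dirderiv w (\<lambda>x. dirderiv v f x \<bullet> b) x"
      by (intro fun_cong[OF frechet_derivative_cong_open[OF S x]]
          dirderiv_linear_image[OF bounded_linear_inner_left] smooth_on_differentiable[OF f S])
    also have "\<dots> = dirderiv w (dirderiv v f) x \<bullet> b"
      by (intro dirderiv_linear_image[OF bounded_linear_inner_left]
          smooth_on_differentiable[OF smooth_on_dirderiv[OF f] S x])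
    finally show ?thesis .
  qed
  show "dirderiv w (dirderiv v f) x \<bullet> b = dirderiv v (dirderiv w f) x \<bullet> b"
    using dirderiv_commute_real[where f="\<lambda>x. f x \<bullet> b" and w=w and v=v,
        OF S smooth_on_linear_image[OF bounded_linear_inner_left S f] x]
    unfolding * .
qed

section \<open>Vanishing to finite order\<close>

text \<open>Vanishing at \<open>p\<close> together with all derivatives of order at most \<open>k\<close>.\<close>

primrec flat :: "nat \<Rightarrow> 'a::euclidean_space \<Rightarrow> ('a \<Rightarrow> 'b::real_normed_vector) \<Rightarrow> bool" where
  "flat 0 p h \<longleftrightarrow> h p = 0"
| "flat (Suc k) p h \<longleftrightarrow> h p = 0 \<and> (\<forall>v. flat k p (dirderiv v h))"

lemma flat_cong:
  assumes "open S" "p \<in> S" "\<And>x. x \<in> S \<Longrightarrow> f x = g x"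
  shows "flat k p f \<longleftrightarrow> flat k p g"
  using assms(3)
proof (induction k arbitrary: f g)
  case 0 then show ?case using assms by simp
next
  case (Suc k)
  have "flat k p (dirderiv v f) \<longleftrightarrow> flat k p (dirderiv v g)" for v
    by (rule Suc.IH) (simp add: frechet_derivative_cong_open[OF assms(1) _ Suc.prems])
  then show ?case using Suc.prems[OF assms(2)] by simp
qed

lemma flat_SucD: "flat (Suc k) p h \<Longrightarrow> flat k p h"
  by (induction k arbitrary: h) auto

lemma flat_zero: "flat k p (\<lambda>x. 0)"
  by (induction k) auto

lemma flat_add:
  assumes "open S" "p \<in> S" "smooth_on S f" "smooth_on S g" "flat k p f" "flat k p g"
  shows "flat k p (\<lambda>x. f x + g x)"
  using assms(3-)
proof (induction k arbitrary: f g)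
  case (Suc k)
  have "flat k p (dirderiv v (\<lambda>x. f x + g x)) \<longleftrightarrow> flat k p (\<lambda>x. dirderiv v f x + dirderiv v g x)" for v
    by (rule flat_cong[OF assms(1,2)])
      (intro frechet_derivative_eqI has_derivative_add smooth_on_has_derivative[OF _ assms(1)] Suc.prems)
  moreover have "flat k p (\<lambda>x. dirderiv v f x + dirderiv v g x)" for v
    using Suc.prems by (intro Suc.IH) (auto intro: smooth_on_dirderiv)
  ultimately show ?case using Suc.prems by simp
qed simp

lemma flat_sum:
  assumes "open S" "p \<in> S" "\<And>i. i \<in> A \<Longrightarrow> smooth_on S (f i)" "\<And>i. i \<in> A \<Longrightarrow> flat k p (f i)"
  shows "flat k p (\<lambda>x. \<Sum>i\<in>A. f i x)"
  using assms(3,4)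
proof (induction A rule: infinite_finite_induct)
  case (insert a A)
  have "smooth_on S (\<lambda>x. \<Sum>i\<in>A. f i x)"
    using insert.prems by (intro smooth_on_sum[OF assms(1)]) auto
  then show ?case using insert by (simp add: flat_add[OF assms(1,2)])
qed (auto simp: flat_zero)

text \<open>Vanishing of order \<open>k\<close> is an ideal-like property: the Leibniz rule produces a term with
  the factor \<open>f\<close>, flat to order \<open>k + 1\<close>, and one with a derivative of \<open>f\<close>.\<close>

lemma flat_bilinear:
  assumes "bounded_bilinear prd" "open S" "p \<in> S" "smooth_on S f" "smooth_on S g" "flat k p f"
  shows "flat k p (\<lambda>x. prd (f x) (g x))"
  using assms(4-)
proof (induction k arbitrary: f g)
  case 0 then show ?case by (simp add: bounded_bilinear.zero_left[OF assms(1)])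
next
  case (Suc k)
  have "flat k p (dirderiv v (\<lambda>x. prd (f x) (g x))) \<longleftrightarrow>
    flat k p (\<lambda>x. prd (f x) (dirderiv v g x) + prd (dirderiv v f x) (g x))" for v
    by (rule flat_cong[OF assms(2,3)])
      (intro frechet_derivative_eqI bounded_bilinear.FDERIV[OF assms(1)] smooth_on_has_derivative[OF _ assms(2)] Suc.prems)
  moreover have "flat k p (\<lambda>x. prd (f x) (dirderiv v g x) + prd (dirderiv v f x) (g x))" for v
    using Suc flat_SucD[OF Suc.prems(3)]
    by (intro flat_add[OF assms(2,3)] smooth_on_bilinear[OF assms(1,2)] smooth_on_dirderiv) (auto intro: smooth_on_dirderiv)
  ultimately show ?case using Suc.prems(3) by (simp add: bounded_bilinear.zero_left[OF assms(1)])
qed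

lemma flat_compose:
  fixes f :: "'b::euclidean_space \<Rightarrow> 'c::real_normed_vector" and g :: "'a::euclidean_space \<Rightarrow> 'b"
  assumes "open S" "p \<in> S" "open T" "smooth_on T f" "smooth_on S g" "\<And>x. x \<in> S \<Longrightarrow> g x \<in> T"
    and "flat k (g p) f"
  shows "flat k p (\<lambda>x. f (g x))"
  using assms(4,7)
proof (induction k arbitrary: f)
  case (Suc k)
  have "flat k p (\<lambda>x. \<Sum>b\<in>Basis. (dirderiv v g x \<bullet> b) *\<^sub>R dirderiv b f (g x))" for v
  proof (intro flat_sum[OF assms(1,2)])
    fix b :: 'b
    have sm: "smooth_on S (\<lambda>x. dirderiv b f (g x))" "smooth_on S (\<lambda>x. dirderiv v g x \<bullet> b)"
      using Suc.prems assms
      by (auto intro: smooth_on_compose[where T=T] smooth_on_dirderiv smooth_on_linear_image[OF bounded_linear_inner_left])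
    then show "smooth_on S (\<lambda>x. (dirderiv v g x \<bullet> b) *\<^sub>R dirderiv b f (g x))"
      by (intro smooth_on_scaleR assms)
    have "flat k p (\<lambda>x. dirderiv b f (g x))"
      using Suc by (auto intro: smooth_on_dirderiv)
    from flat_bilinear[OF bounded_bilinear.flip[OF bounded_bilinear_scaleR] assms(1,2) sm this]
    show "flat k p (\<lambda>x. (dirderiv v g x \<bullet> b) *\<^sub>R dirderiv b f (g x))" .
  qed
  moreover have "dirderiv v (\<lambda>x. f (g x)) x = (\<Sum>b\<in>Basis. (dirderiv v g x \<bullet> b) *\<^sub>R dirderiv b f (g x))"
    if "x \<in> S" for x v
  proof -
    have d: "g differentiable at x" "f differentiable at (g x)"
      using smooth_on_differentiable assms that Suc.prems by blast+
    show ?thesis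
      unfolding dirderiv_compose[OF d(2,1)] by (rule frechet_derivative_sum_Basis[OF d(2)])
  qed
  ultimately have "flat k p (dirderiv v (\<lambda>x. f (g x)))" for v
    using flat_cong[OF assms(1,2), of "dirderiv v (\<lambda>x. f (g x))"
        "\<lambda>x. \<Sum>b\<in>Basis. (dirderiv v g x \<bullet> b) *\<^sub>R dirderiv b f (g x)" k] by blast
  then show ?case
    using Suc.prems by simp
qed simp

text \<open>Used with \<open>k = 3\<close> to see that an error term carrying the fourth power of a function that vanishes
  at \<open>p\<close> does not affect 3-jets.\<close>

lemma flat_affine_power:
  fixes \<tau> :: "'a::euclidean_space \<Rightarrow> real" and G :: "'a \<Rightarrow> 'b::real_normed_vector"
  assumes "open S" "p \<in> S" "\<And>x. (\<tau> has_derivative \<tau>') (at x)" "\<tau> p = 0" "smooth_on S G"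
  shows "flat k p (\<lambda>x. (\<tau> x ^ Suc k) *\<^sub>R G x)"
  using assms(5)
proof (induction k arbitrary: G)
  case 0 then show ?case by (simp add: assms(4))
next
  case (Suc k)
  have \<tau>: "smooth_on S \<tau>"
    by (rule smooth_onI_derivative[OF assms(1) assms(3)]) (rule smooth_on_const)
  have "dirderiv v (\<lambda>x. (\<tau> x ^ Suc (Suc k)) *\<^sub>R G x) x =
      (\<tau> x ^ Suc k) *\<^sub>R ((real (Suc (Suc k)) * \<tau>' v) *\<^sub>R G x + \<tau> x *\<^sub>R dirderiv v G x)" if "x \<in> S" for x v
  proof -
    have pow: "((\<lambda>x. \<tau> x ^ Suc (Suc k)) has_derivative (\<lambda>v. real (Suc (Suc k)) * \<tau>' v * \<tau> x ^ Suc k)) (at x)"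
      using has_derivative_power[OF assms(3), of "Suc (Suc k)"] by (simp only: diff_Suc_1)
    show ?thesis
      unfolding frechet_derivative_eqI[OF has_derivative_scaleR[OF pow smooth_on_has_derivative[OF Suc.prems assms(1) that]]]
      by (simp add: algebra_simps del: of_nat_Suc)
  qed
  then have "flat k p (dirderiv v (\<lambda>x. (\<tau> x ^ Suc (Suc k)) *\<^sub>R G x)) \<longleftrightarrow>
      flat k p (\<lambda>x. (\<tau> x ^ Suc k) *\<^sub>R ((real (Suc (Suc k)) * \<tau>' v) *\<^sub>R G x + \<tau> x *\<^sub>R dirderiv v G x))" for v
    by (rule flat_cong[OF assms(1,2)])
  moreover have "flat k p (\<lambda>x. (\<tau> x ^ Suc k) *\<^sub>R ((real (Suc (Suc k)) * \<tau>' v) *\<^sub>R G x + \<tau> x *\<^sub>R dirderiv v G x))" for v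
    using Suc.prems \<tau>
    by (intro Suc.IH smooth_on_add smooth_on_scaleR smooth_on_const smooth_on_dirderiv assms(1))
  ultimately show ?case by (simp add: assms(4))
qed

section \<open>Partial derivatives and jets\<close>

lemma partial_eq_dirderiv: "partial i h = dirderiv (axis i 1) h"
  by (simp add: partial_def fun_eq_iff)

lemma smooth_on_partial: "smooth_on S h \<Longrightarrow> smooth_on S (partial i h)"
  unfolding partial_eq_dirderiv by (rule smooth_on_dirderiv)

lemma smooth_on_funpow_partial: "smooth_on S h \<Longrightarrow> smooth_on S ((partial i ^^ n) h)"
  by (induction n) (auto intro: smooth_on_partial)

lemma partial_cong_open:
  assumes "open S" "\<And>x. x \<in> S \<Longrightarrow> f x = g x" "x \<in> S"
  shows "partial i f x = partial i g x"
  unfolding partial_def using frechet_derivative_cong_open[OF assms(1,3,2)] by simp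

lemma funpow_partial_cong_open:
  assumes "open S" "\<And>x. x \<in> S \<Longrightarrow> f x = g x" "x \<in> S"
  shows "(partial i ^^ n) f x = (partial i ^^ n) g x"
  using assms(3) by (induction n arbitrary: x) (auto intro: assms(2) partial_cong_open[OF assms(1)])

lemma partial_commute:
  fixes h :: "real^2 \<Rightarrow> 'b::euclidean_space"
  assumes "open S" "smooth_on S h" "x \<in> S"
  shows "partial i (partial j h) x = partial j (partial i h) x"
  unfolding partial_eq_dirderiv by (rule dirderiv_commute[OF assms])

lemma funpow_partial_commute:
  fixes h :: "real^2 \<Rightarrow> 'b::euclidean_space"
  assumes "open S" "smooth_on S h" "x \<in> S"
  shows "(partial j ^^ n) (partial i h) x = partial i ((partial j ^^ n) h) x"
  using assms(3)
proof (induction n arbitrary: x)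
  case (Suc n)
  have "(partial j ^^ Suc n) (partial i h) x = partial j (partial i ((partial j ^^ n) h)) x"
    using partial_cong_open[OF assms(1) Suc.IH Suc.prems] by simp
  also have "\<dots> = partial i ((partial j ^^ Suc n) h) x"
    using partial_commute[OF assms(1) smooth_on_funpow_partial[OF assms(2)] Suc.prems] by simp
  finally show ?case .
qed simp

lemma dirderiv_eq_partials:
  fixes h :: "real^2 \<Rightarrow> 'b::real_normed_vector"
  assumes "h differentiable (at x)"
  shows "dirderiv v h x = v $ 1 *\<^sub>R partial 1 h x + v $ 2 *\<^sub>R partial 2 h x"
proof -
  have "v = v $ 1 *\<^sub>R axis 1 1 + v $ 2 *\<^sub>R axis 2 1"
    by (simp add: vec_eq_iff forall_2 axis_def)
  then have "dirderiv v h x = dirderiv (v $ 1 *\<^sub>R axis 1 1 + v $ 2 *\<^sub>R axis 2 1) h x" by simp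
  also have "\<dots> = v $ 1 *\<^sub>R partial 1 h x + v $ 2 *\<^sub>R partial 2 h x"
    using linear_frechet_derivative[OF assms] by (simp add: linear_add linear_cmul partial_def)
  finally show ?thesis .
qed

lemma jet_cong_open:
  assumes "open S" "p \<in> S" "\<And>x. x \<in> S \<Longrightarrow> f x = g x"
  shows "jet k f p = jet k g p"
proof -
  have "(partial 1 ^^ i) ((partial 2 ^^ j) f) p = (partial 1 ^^ i) ((partial 2 ^^ j) g) p" for i j
    by (intro funpow_partial_cong_open[OF assms(1) _ assms(2)] funpow_partial_cong_open[OF assms(1) assms(3)])
  then show ?thesis by (simp add: jet_def fun_eq_iff)
qed

lemma partial_add:
  assumes "open S" "smooth_on S f" "smooth_on S g" "x \<in> S"
  shows "partial i (\<lambda>x. f x + g x) x = partial i f x + partial i g x"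
  unfolding partial_def
  by (intro frechet_derivative_eqI has_derivative_add smooth_on_has_derivative[OF _ assms(1)] assms)

lemma partial_linear_image:
  assumes "bounded_linear A" "open S" "smooth_on S f" "x \<in> S"
  shows "partial i (\<lambda>x. A (f x)) x = A (partial i f x)"
  unfolding partial_def
  by (intro dirderiv_linear_image assms(1) smooth_on_differentiable[OF assms(3,2,4)])

lemma funpow_partial_add:
  assumes "open S" "smooth_on S f" "smooth_on S g" "x \<in> S"
  shows "(partial i ^^ n) (\<lambda>x. f x + g x) x = (partial i ^^ n) f x + (partial i ^^ n) g x"
  using assms(4)
proof (induction n arbitrary: x)
  case (Suc n)
  have "(partial i ^^ Suc n) (\<lambda>x. f x + g x) x = partial i (\<lambda>x. (partial i ^^ n) f x + (partial i ^^ n) g x) x"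
    using partial_cong_open[OF assms(1) Suc.IH Suc.prems] by simp
  then show ?case
    using partial_add[OF assms(1) smooth_on_funpow_partial[OF assms(2)] smooth_on_funpow_partial[OF assms(3)] Suc.prems]
    by simp
qed simp

lemma funpow_partial_linear_image:
  assumes "bounded_linear A" "open S" "smooth_on S f" "x \<in> S"
  shows "(partial i ^^ n) (\<lambda>x. A (f x)) x = A ((partial i ^^ n) f x)"
  using assms(4)
proof (induction n arbitrary: x)
  case (Suc n)
  have "(partial i ^^ Suc n) (\<lambda>x. A (f x)) x = partial i (\<lambda>x. A ((partial i ^^ n) f x)) x"
    using partial_cong_open[OF assms(2) Suc.IH Suc.prems] by simp
  then show ?case
    using partial_linear_image[OF assms(1,2) smooth_on_funpow_partial[OF assms(3)] Suc.prems] by simp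
qed simp

lemma jet_add:
  assumes "open S" "p \<in> S" "smooth_on S f" "smooth_on S g"
  shows "jet k (\<lambda>x. f x + g x) p = jet k f p + jet k g p"
proof -
  have "(partial 1 ^^ i) ((partial 2 ^^ j) (\<lambda>x. f x + g x)) p =
    (partial 1 ^^ i) ((partial 2 ^^ j) f) p + (partial 1 ^^ i) ((partial 2 ^^ j) g) p" for i j
    using funpow_partial_cong_open[OF assms(1) funpow_partial_add[OF assms(1,3,4)] assms(2)]
      funpow_partial_add[OF assms(1) smooth_on_funpow_partial[OF assms(3)] smooth_on_funpow_partial[OF assms(4)] assms(2)]
    by simp
  then show ?thesis by (simp add: jet_def fun_eq_iff)
qed

lemma jet_scaleR:
  assumes "open S" "p \<in> S" "smooth_on S f"
  shows "jet k (\<lambda>x. c *\<^sub>R f x) p = c *\<^sub>R jet k f p"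
proof -
  note A = bounded_linear_scaleR_right[of c]
  have "(partial 1 ^^ i) ((partial 2 ^^ j) (\<lambda>x. c *\<^sub>R f x)) p = c *\<^sub>R (partial 1 ^^ i) ((partial 2 ^^ j) f) p" for i j
    using funpow_partial_cong_open[OF assms(1) funpow_partial_linear_image[OF A assms(1,3)] assms(2)]
      funpow_partial_linear_image[OF A assms(1) smooth_on_funpow_partial[OF assms(3)] assms(2)]
    by simp
  then show ?thesis by (simp add: jet_def fun_eq_iff scaleR_fun_def)
qed

lemma jet_zero: "jet k (\<lambda>x. 0::'a::real_normed_vector) p = 0"
proof -
  have "partial i (\<lambda>x. 0::'a) = (\<lambda>x. 0)" for i
    by (simp add: partial_def fun_eq_iff)
  then have "(partial i ^^ n) (\<lambda>x. 0::'a) = (\<lambda>x. 0)" for i n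
    by (induction n) simp_all
  then show ?thesis unfolding jet_def by (intro ext) (simp split: prod.split)
qed

lemma jet_diff:
  assumes "open S" "p \<in> S" "smooth_on S f" "smooth_on S g"
  shows "jet k (\<lambda>x. f x - g x) p = jet k f p - jet k g p"
  using jet_add[OF assms(1-3) smooth_on_linear_image[OF bounded_linear_scaleR_right[of "-1"] assms(1,4)], of k]
    jet_scaleR[OF assms(1,2,4), of k "-1"] by simp

text \<open>Passes between the coordinate description of jets, in which the derivatives are taken in a fixed
  order, and the coordinate-free one, which behaves well under products and compositions. Symmetry
  of second derivatives makes the order irrelevant.\<close>

lemma jet_eq_0_iff_flat:
  fixes h :: "real^2 \<Rightarrow> 'b::euclidean_space"
  assumes "open S" "p \<in> S" "smooth_on S h"
  shows "jet k h p = 0 \<longleftrightarrow> flat k p h"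
  using assms(3)
proof (induction k arbitrary: h)
  case 0 then show ?case by (auto simp: jet_def fun_eq_iff)
next
  case (Suc k)
  have split: "jet (Suc k) h p = 0 \<longleftrightarrow> h p = 0 \<and> jet k (partial 1 h) p = 0 \<and> jet k (partial 2 h) p = 0"
    (is "?L \<longleftrightarrow> ?R")
  proof
    assume ?L
    then have L: "i + j \<le> Suc k \<Longrightarrow> (partial 1 ^^ i) ((partial 2 ^^ j) h) p = 0" for i j
      by (auto simp: jet_def fun_eq_iff split: if_splits)
    have "(partial 1 ^^ i) ((partial 2 ^^ j) (partial 1 h)) p = 0" if "i + j \<le> k" for i j
    proof -
      have "(partial 1 ^^ i) ((partial 2 ^^ j) (partial 1 h)) p = (partial 1 ^^ i) (partial 1 ((partial 2 ^^ j) h)) p"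
        by (rule funpow_partial_cong_open[OF assms(1) funpow_partial_commute[OF assms(1) Suc.prems] assms(2)])
      also have "\<dots> = (partial 1 ^^ Suc i) ((partial 2 ^^ j) h) p" by (simp add: funpow_swap1)
      also have "\<dots> = 0" using L[of "Suc i" j] that by simp
      finally show ?thesis .
    qed
    moreover have "(partial 1 ^^ i) ((partial 2 ^^ j) (partial 2 h)) p = 0" if "i + j \<le> k" for i j
      using L[of i "Suc j"] that by (simp add: funpow_swap1)
    ultimately show ?R using L[of 0 0] by (auto simp: jet_def fun_eq_iff)
  next
    assume R: ?R
    then have R: "h p = 0" "i + j \<le> k \<Longrightarrow> (partial 1 ^^ i) ((partial 2 ^^ j) (partial 1 h)) p = 0"
      "i + j \<le> k \<Longrightarrow> (partial 1 ^^ i) ((partial 2 ^^ j) (partial 2 h)) p = 0" for i j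
      by (auto simp: jet_def fun_eq_iff split: if_splits)
    have "(partial 1 ^^ i) ((partial 2 ^^ j) h) p = 0" if "i + j \<le> Suc k" for i j
    proof (cases j)
      case (Suc j')
      then show ?thesis using R(3)[of i j'] that by (simp add: funpow_swap1)
    next
      case 0
      show ?thesis
      proof (cases i)
        case (Suc i')
        then show ?thesis using R(2)[of i' 0] 0 that by (simp add: funpow_swap1)
      qed (use 0 R in simp)
    qed
    then show ?L by (auto simp: jet_def fun_eq_iff)
  qed
  have dd: "dirderiv v h x = v $ 1 *\<^sub>R partial 1 h x + v $ 2 *\<^sub>R partial 2 h x" if "x \<in> S" for v :: "real^2" and x
    by (intro dirderiv_eq_partials smooth_on_differentiable[OF Suc.prems assms(1) that])
  have "(\<forall>v::real^2. flat k p (dirderiv v h)) \<longleftrightarrow> flat k p (partial 1 h) \<and> flat k p (partial 2 h)"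
  proof safe
    fix v :: "real^2" assume *: "flat k p (partial 1 h)" "flat k p (partial 2 h)"
    have "flat k p (\<lambda>x. v $ 1 *\<^sub>R partial 1 h x + v $ 2 *\<^sub>R partial 2 h x)"
      by (intro flat_add[OF assms(1,2)] smooth_on_scaleR smooth_on_const smooth_on_partial Suc.prems assms
          flat_bilinear[OF bounded_bilinear.flip[OF bounded_bilinear_scaleR] assms(1,2)] *)
    then show "flat k p (dirderiv v h)"
      using flat_cong[OF assms(1,2), of "dirderiv v h" _ k, OF dd] by simp
  qed (auto simp: partial_eq_dirderiv)
  then show ?case
    unfolding split Suc.IH[OF smooth_on_partial[OF Suc.prems]] flat.simps by simp
qed

lemma jet_eq_iff_flat_diff:
  fixes f g :: "real^2 \<Rightarrow> 'b::euclidean_space"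
  assumes "open S" "p \<in> S" "smooth_on S f" "smooth_on S g"
  shows "jet k f p = jet k g p \<longleftrightarrow> flat k p (\<lambda>x. f x - g x)"
  using jet_eq_0_iff_flat[OF assms(1,2) smooth_on_diff[OF assms(1,3,4)], of k] jet_diff[OF assms, of k] by simp

lemma jet_trunc_jet: "k \<le> l \<Longrightarrow> jet_trunc k (jet l h p) = jet k h p"
  by (auto simp: jet_trunc_def jet_def fun_eq_iff)

lemma jet_mono_eq: "jet l f p = jet l g p \<Longrightarrow> k \<le> l \<Longrightarrow> jet k f p = jet k g p"
  by (metis jet_trunc_jet)

lemma jet_rep:
  assumes "smooth_near p h"
  shows "smooth_near p (jet_rep k p (jet k h p)) \<and> jet k (jet_rep k p (jet k h p)) p = jet k h p"
  unfolding jet_rep_def by (rule someI[of _ h]) (use assms in simp)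

lemma smooth_near_common:
  assumes "smooth_near p f" "smooth_near p g"
  obtains S where "open S" "p \<in> S" "smooth_on S f" "smooth_on S g"
proof -
  from assms obtain A B where "open A" "p \<in> A" "smooth_on A f" "open B" "p \<in> B" "smooth_on B g"
    unfolding smooth_near_def by blast
  then show ?thesis
    using that[of "A \<inter> B"] by (simp add: open_Int smooth_on_subset[of A f] smooth_on_subset[of B g])
qed

section \<open>The linearised action on jets and Liouville's tensor\<close>

definition coef0 :: "fibre \<Rightarrow> real" where "coef0 u = fst u"
definition coef1 :: "fibre \<Rightarrow> real" where "coef1 u = fst (snd u)"
definition coef2 :: "fibre \<Rightarrow> real" where "coef2 u = fst (snd (snd u))"
definition coef3 :: "fibre \<Rightarrow> real" where "coef3 u = snd (snd (snd u))"

lemmas coef_defs = coef0_def coef1_def coef2_def coef3_def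

lemma fibre_eq_iff:
  "u = v \<longleftrightarrow> coef0 u = coef0 v \<and> coef1 u = coef1 v \<and> coef2 u = coef2 v \<and> coef3 u = coef3 v"
  by (auto simp: coef_defs prod_eq_iff)

lemma coef_simps [simp]:
  "coef0 (a, b, c, d) = a" "coef1 (a, b, c, d) = b" "coef2 (a, b, c, d) = c" "coef3 (a, b, c, d) = d"
  "coef0 (u + v) = coef0 u + coef0 v" "coef1 (u + v) = coef1 u + coef1 v"
  "coef2 (u + v) = coef2 u + coef2 v" "coef3 (u + v) = coef3 u + coef3 v"
  "coef0 (u - v) = coef0 u - coef0 v" "coef1 (u - v) = coef1 u - coef1 v"
  "coef2 (u - v) = coef2 u - coef2 v" "coef3 (u - v) = coef3 u - coef3 v"
  "coef0 (- u) = - coef0 u" "coef1 (- u) = - coef1 u" "coef2 (- u) = - coef2 u" "coef3 (- u) = - coef3 u"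
  "coef0 (r *\<^sub>R u) = r * coef0 u" "coef1 (r *\<^sub>R u) = r * coef1 u"
  "coef2 (r *\<^sub>R u) = r * coef2 u" "coef3 (r *\<^sub>R u) = r * coef3 u"
  "coef0 0 = 0" "coef1 0 = 0" "coef2 0 = 0" "coef3 0 = 0"
  by (auto simp: coef_defs)

text \<open>The infinitesimal action of a field on right-hand sides, split by the order of the derivatives of the field:
  the part with its first derivatives \<open>a\<close>, \<open>b\<close>, bilinear together with the coefficients, and
  below the part with its second derivatives. The kernel of the latter is the space \<open>g\<close>.\<close>

definition first_order_part :: "real^2 \<Rightarrow> real^2 \<Rightarrow> fibre \<Rightarrow> fibre" where
  "first_order_part a b u =
    (coef0 u * (b$2 - 2 * a$1) - coef1 u * a$2,
     - (coef1 u * a$1) - 3 * coef0 u * b$1 - 2 * coef2 u * a$2,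
     - (coef2 u * b$2) - 2 * coef1 u * b$1 - 3 * coef3 u * a$2,
     coef3 u * (a$1 - 2 * b$2) - coef2 u * b$1)"

definition second_order_part :: "real^2 \<Rightarrow> real^2 \<Rightarrow> real^2 \<Rightarrow> fibre" where
  "second_order_part a b c = (a$2, 2 * b$2 - a$1, c$2 - 2 * b$1, - c$1)"

text \<open>The three jet components, of orders \<open>(0,0)\<close>, \<open>(1,0)\<close> and \<open>(0,1)\<close>, of minus the Lie derivative of a
  section with jet \<open>\<upsilon>\<close> along a field with jet \<open>\<xi>\<close>.\<close>

definition defect00 :: "fibre jet \<Rightarrow> (real^2) jet \<Rightarrow> fibre" where
  "defect00 \<upsilon> \<xi> = first_order_part (\<xi> (1,0)) (\<xi> (0,1)) (\<upsilon> (0,0))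
     + second_order_part (\<xi> (2,0)) (\<xi> (1,1)) (\<xi> (0,2))
     - (\<xi> (0,0) $ 1 *\<^sub>R \<upsilon> (1,0) + \<xi> (0,0) $ 2 *\<^sub>R \<upsilon> (0,1))"

definition defect10 :: "fibre jet \<Rightarrow> (real^2) jet \<Rightarrow> fibre" where
  "defect10 \<upsilon> \<xi> = first_order_part (\<xi> (2,0)) (\<xi> (1,1)) (\<upsilon> (0,0))
     + first_order_part (\<xi> (1,0)) (\<xi> (0,1)) (\<upsilon> (1,0))
     + second_order_part (\<xi> (3,0)) (\<xi> (2,1)) (\<xi> (1,2))
     - (\<xi> (1,0) $ 1 *\<^sub>R \<upsilon> (1,0) + \<xi> (1,0) $ 2 *\<^sub>R \<upsilon> (0,1))
     - (\<xi> (0,0) $ 1 *\<^sub>R \<upsilon> (2,0) + \<xi> (0,0) $ 2 *\<^sub>R \<upsilon> (1,1))"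

definition defect01 :: "fibre jet \<Rightarrow> (real^2) jet \<Rightarrow> fibre" where
  "defect01 \<upsilon> \<xi> = first_order_part (\<xi> (1,1)) (\<xi> (0,2)) (\<upsilon> (0,0))
     + first_order_part (\<xi> (1,0)) (\<xi> (0,1)) (\<upsilon> (0,1))
     + second_order_part (\<xi> (2,1)) (\<xi> (1,2)) (\<xi> (0,3))
     - (\<xi> (0,1) $ 1 *\<^sub>R \<upsilon> (1,0) + \<xi> (0,1) $ 2 *\<^sub>R \<upsilon> (0,1))
     - (\<xi> (0,0) $ 1 *\<^sub>R \<upsilon> (1,1) + \<xi> (0,0) $ 2 *\<^sub>R \<upsilon> (0,2))"

lemmas defect_defs = defect00_def defect10_def defect01_def first_order_part_def second_order_part_def

lemma defect_linear:
  "defect00 \<upsilon> (\<lambda>m. a *\<^sub>R \<xi> m + b *\<^sub>R \<eta> m) = a *\<^sub>R defect00 \<upsilon> \<xi> + b *\<^sub>R defect00 \<upsilon> \<eta>"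
  "defect10 \<upsilon> (\<lambda>m. a *\<^sub>R \<xi> m + b *\<^sub>R \<eta> m) = a *\<^sub>R defect10 \<upsilon> \<xi> + b *\<^sub>R defect10 \<upsilon> \<eta>"
  "defect01 \<upsilon> (\<lambda>m. a *\<^sub>R \<xi> m + b *\<^sub>R \<eta> m) = a *\<^sub>R defect01 \<upsilon> \<xi> + b *\<^sub>R defect01 \<upsilon> \<eta>"
  by (simp_all add: fibre_eq_iff defect_defs algebra_simps)

text \<open>By Leibniz' rule, the jet of the derivative of a map with jet \<open>\<eta>\<close> along a field with jet \<open>\<xi>\<close>.\<close>

definition advect :: "(real^2) jet \<Rightarrow> 'b::real_vector jet \<Rightarrow> 'b jet" where
  "advect \<xi> \<eta> = (\<lambda>(i, j). \<Sum>a\<le>i. \<Sum>b\<le>j. of_nat ((i choose a) * (j choose b)) *\<^sub>R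
     (\<xi> (a, b) $ 1 *\<^sub>R \<eta> (Suc (i - a), j - b) + \<xi> (a, b) $ 2 *\<^sub>R \<eta> (i - a, Suc (j - b))))"

definition bracket :: "(real^2) jet \<Rightarrow> (real^2) jet \<Rightarrow> (real^2) jet" where
  "bracket \<xi> \<eta> m = advect \<xi> \<eta> m - advect \<eta> \<xi> m"

lemma advect_explicit:
  "advect \<xi> \<eta> (0,0) = \<xi> (0,0) $ 1 *\<^sub>R \<eta> (1,0) + \<xi> (0,0) $ 2 *\<^sub>R \<eta> (0,1)"
  "advect \<xi> \<eta> (1,0) = \<xi> (0,0) $ 1 *\<^sub>R \<eta> (2,0) + \<xi> (0,0) $ 2 *\<^sub>R \<eta> (1,1)
     + \<xi> (1,0) $ 1 *\<^sub>R \<eta> (1,0) + \<xi> (1,0) $ 2 *\<^sub>R \<eta> (0,1)"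
  "advect \<xi> \<eta> (0,1) = \<xi> (0,0) $ 1 *\<^sub>R \<eta> (1,1) + \<xi> (0,0) $ 2 *\<^sub>R \<eta> (0,2)
     + \<xi> (0,1) $ 1 *\<^sub>R \<eta> (1,0) + \<xi> (0,1) $ 2 *\<^sub>R \<eta> (0,1)"
  "advect \<xi> \<eta> (2,0) = \<xi> (0,0) $ 1 *\<^sub>R \<eta> (3,0) + \<xi> (0,0) $ 2 *\<^sub>R \<eta> (2,1)
     + 2 *\<^sub>R (\<xi> (1,0) $ 1 *\<^sub>R \<eta> (2,0) + \<xi> (1,0) $ 2 *\<^sub>R \<eta> (1,1))
     + \<xi> (2,0) $ 1 *\<^sub>R \<eta> (1,0) + \<xi> (2,0) $ 2 *\<^sub>R \<eta> (0,1)"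
  "advect \<xi> \<eta> (1,1) = \<xi> (0,0) $ 1 *\<^sub>R \<eta> (2,1) + \<xi> (0,0) $ 2 *\<^sub>R \<eta> (1,2)
     + \<xi> (1,0) $ 1 *\<^sub>R \<eta> (1,1) + \<xi> (1,0) $ 2 *\<^sub>R \<eta> (0,2)
     + \<xi> (0,1) $ 1 *\<^sub>R \<eta> (2,0) + \<xi> (0,1) $ 2 *\<^sub>R \<eta> (1,1)
     + \<xi> (1,1) $ 1 *\<^sub>R \<eta> (1,0) + \<xi> (1,1) $ 2 *\<^sub>R \<eta> (0,1)"
  "advect \<xi> \<eta> (0,2) = \<xi> (0,0) $ 1 *\<^sub>R \<eta> (1,2) + \<xi> (0,0) $ 2 *\<^sub>R \<eta> (0,3)
     + 2 *\<^sub>R (\<xi> (0,1) $ 1 *\<^sub>R \<eta> (1,1) + \<xi> (0,1) $ 2 *\<^sub>R \<eta> (0,2))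
     + \<xi> (0,2) $ 1 *\<^sub>R \<eta> (1,0) + \<xi> (0,2) $ 2 *\<^sub>R \<eta> (0,1)"
  by (simp_all add: advect_def numeral_2_eq_2 numeral_3_eq_3 algebra_simps)

text \<open>The bracket is bilinear and alternating, so a change of frame multiplies it by the determinant.\<close>

lemma bracket_combination:
  "bracket (\<lambda>m. a *\<^sub>R \<xi> m + b *\<^sub>R \<eta> m) (\<lambda>m. c *\<^sub>R \<xi> m + d *\<^sub>R \<eta> m) (i, j) = (a * d - b * c) *\<^sub>R bracket \<xi> \<eta> (i, j)"
proof -
  have adv: "advect (\<lambda>m. a *\<^sub>R \<xi> m + b *\<^sub>R \<eta> m) (\<lambda>m. c *\<^sub>R \<xi>' m + d *\<^sub>R \<eta>' m) (i, j) =
    (a * c) *\<^sub>R advect \<xi> \<xi>' (i, j) + (a * d) *\<^sub>R advect \<xi> \<eta>' (i, j)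
    + (b * c) *\<^sub>R advect \<eta> \<xi>' (i, j) + (b * d) *\<^sub>R advect \<eta> \<eta>' (i, j)" for a b c d \<xi> \<eta> and \<xi>' \<eta>' :: "(real^2) jet"
    by (simp add: advect_def scaleR_sum_right sum.distrib[symmetric] algebra_simps)
  show ?thesis unfolding bracket_def adv by (simp add: algebra_simps)
qed

text \<open>The expressions found by Liouville (and Tresse), whose vanishing characterises the equations that a point
  transformation takes, locally, to \<open>y'' = 0\<close>.\<close>

definition liouville1 :: "fibre jet \<Rightarrow> real" where
  "liouville1 \<upsilon> = coef3 (\<upsilon> (2,0)) + (coef1 (\<upsilon> (0,2)) - 2 * coef2 (\<upsilon> (1,1))) / 3
     + coef1 (\<upsilon> (0,0)) * coef3 (\<upsilon> (1,0)) - coef0 (\<upsilon> (0,0)) * coef3 (\<upsilon> (0,1))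
     - 2 * coef3 (\<upsilon> (0,0)) * coef0 (\<upsilon> (0,1)) + coef3 (\<upsilon> (0,0)) * coef1 (\<upsilon> (1,0))
     + coef2 (\<upsilon> (0,0)) * (coef1 (\<upsilon> (0,1)) - 2 * coef2 (\<upsilon> (1,0))) / 3"

definition liouville2 :: "fibre jet \<Rightarrow> real" where
  "liouville2 \<upsilon> = coef0 (\<upsilon> (0,2)) + (coef2 (\<upsilon> (2,0)) - 2 * coef1 (\<upsilon> (1,1))) / 3
     - coef0 (\<upsilon> (0,0)) * coef2 (\<upsilon> (0,1)) + coef1 (\<upsilon> (0,0)) * (2 * coef1 (\<upsilon> (0,1)) - coef2 (\<upsilon> (1,0))) / 3
     + 2 * coef0 (\<upsilon> (0,0)) * coef3 (\<upsilon> (1,0)) - coef2 (\<upsilon> (0,0)) * coef0 (\<upsilon> (0,1))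
     + coef3 (\<upsilon> (0,0)) * coef0 (\<upsilon> (1,0))"

definition liouville_jet :: "fibre jet \<Rightarrow> (real^2) jet" where
  "liouville_jet \<upsilon> = (\<lambda>m.
     if m = (2,0) then vector [2 * liouville2 \<upsilon>, 0]
     else if m = (1,1) then vector [liouville1 \<upsilon>, liouville2 \<upsilon>]
     else if m = (0,2) then vector [0, 2 * liouville1 \<upsilon>] else 0)"

lemma vec2_eq_iff: "(v::real^2) = w \<longleftrightarrow> v$1 = w$1 \<and> v$2 = w$2"
  by (simp add: vec_eq_iff forall_2)

lemma axis_components [simp]:
  "(axis 1 x :: real^2) $ 1 = x" "(axis 1 x :: real^2) $ 2 = 0" "(axis 2 x :: real^2) $ 1 = 0" "(axis 2 x :: real^2) $ 2 = x"
  by (simp_all add: axis_def)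

section \<open>Independence of the bracket from first derivatives\<close>

text \<open>The computational heart. Write \<open>\<xi>\<close>, \<open>\<eta>\<close> for the jets of two fields with values \<open>e\<^sub>1\<close>, \<open>e\<^sub>2\<close>. The
  bracket condition of order zero identifies \<open>\<eta>\<close>'s derivative along \<open>e\<^sub>1\<close> with \<open>\<xi>\<close>'s along \<open>e\<^sub>2\<close>, which
  leaves six free first derivatives. The twelve equations of second order then determine all second
  derivatives, the sixteen equations of third order all third derivatives, and after
  substitution the six free parameters cancel from the second order part of the bracket. The solution
  is unique since the symbol \<open>second_order_part\<close> has a two-dimensional kernel \<open>g\<close>, on which the bracket
  condition of order one is non-degenerate, and the first prolongation of this kernel is zero.\<close>

lemma bracket_standard_frame:
  assumes v: "\<xi> (0,0) = axis 1 1" "\<eta> (0,0) = axis 2 1"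
    and \<xi>: "defect00 \<upsilon> \<xi> = 0" "defect10 \<upsilon> \<xi> = 0" "defect01 \<upsilon> \<xi> = 0"
    and \<eta>: "defect00 \<upsilon> \<eta> = 0" "defect10 \<upsilon> \<eta> = 0" "defect01 \<upsilon> \<eta> = 0"
    and br: "bracket \<xi> \<eta> (0,0) = 0" "bracket \<xi> \<eta> (1,0) = 0" "bracket \<xi> \<eta> (0,1) = 0"
    and ij: "i + j \<le> 2"
  shows "bracket \<xi> \<eta> (i, j) = liouville_jet \<upsilon> (i, j)"
proof -
  note [simp del] = One_nat_def
  have tors: "\<eta> (1,0) = \<xi> (0,1)"
    using br(1) by (simp add: bracket_def advect_explicit v)
  \<comment> \<open>Real names for all components; the letters \<open>p\<close>, \<open>q\<close> belong to \<open>\<xi>\<close> and \<open>r\<close>, \<open>s\<close> to \<open>\<eta>\<close>.\<close>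
  let ?u0 = "coef0 (\<upsilon> (0,0))" let ?u0x = "coef0 (\<upsilon> (1,0))"
  let ?u0y = "coef0 (\<upsilon> (0,1))" let ?u0xx = "coef0 (\<upsilon> (2,0))"
  let ?u0xy = "coef0 (\<upsilon> (1,1))" let ?u0yy = "coef0 (\<upsilon> (0,2))"
  let ?u1 = "coef1 (\<upsilon> (0,0))" let ?u1x = "coef1 (\<upsilon> (1,0))"
  let ?u1y = "coef1 (\<upsilon> (0,1))" let ?u1xx = "coef1 (\<upsilon> (2,0))"
  let ?u1xy = "coef1 (\<upsilon> (1,1))" let ?u1yy = "coef1 (\<upsilon> (0,2))"
  let ?u2 = "coef2 (\<upsilon> (0,0))" let ?u2x = "coef2 (\<upsilon> (1,0))"
  let ?u2y = "coef2 (\<upsilon> (0,1))" let ?u2xx = "coef2 (\<upsilon> (2,0))"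
  let ?u2xy = "coef2 (\<upsilon> (1,1))" let ?u2yy = "coef2 (\<upsilon> (0,2))"
  let ?u3 = "coef3 (\<upsilon> (0,0))" let ?u3x = "coef3 (\<upsilon> (1,0))"
  let ?u3y = "coef3 (\<upsilon> (0,1))" let ?u3xx = "coef3 (\<upsilon> (2,0))"
  let ?u3xy = "coef3 (\<upsilon> (1,1))" let ?u3yy = "coef3 (\<upsilon> (0,2))"
  let ?a1 = "\<xi> (1,0) $ 1" let ?a2 = "\<xi> (1,0) $ 2"
  let ?b1 = "\<xi> (0,1) $ 1" let ?b2 = "\<xi> (0,1) $ 2"
  let ?c1 = "\<eta> (0,1) $ 1" let ?c2 = "\<eta> (0,1) $ 2"
  let ?p20 = "\<xi> (2,0) $ 1" let ?p11 = "\<xi> (1,1) $ 1"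
  let ?p02 = "\<xi> (0,2) $ 1" let ?p30 = "\<xi> (3,0) $ 1"
  let ?p21 = "\<xi> (2,1) $ 1" let ?p12 = "\<xi> (1,2) $ 1"
  let ?p03 = "\<xi> (0,3) $ 1" let ?q20 = "\<xi> (2,0) $ 2"
  let ?q11 = "\<xi> (1,1) $ 2" let ?q02 = "\<xi> (0,2) $ 2"
  let ?q30 = "\<xi> (3,0) $ 2" let ?q21 = "\<xi> (2,1) $ 2"
  let ?q12 = "\<xi> (1,2) $ 2" let ?q03 = "\<xi> (0,3) $ 2"
  let ?r20 = "\<eta> (2,0) $ 1" let ?r11 = "\<eta> (1,1) $ 1"
  let ?r02 = "\<eta> (0,2) $ 1" let ?r30 = "\<eta> (3,0) $ 1"
  let ?r21 = "\<eta> (2,1) $ 1" let ?r12 = "\<eta> (1,2) $ 1"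
  let ?r03 = "\<eta> (0,3) $ 1" let ?s20 = "\<eta> (2,0) $ 2"
  let ?s11 = "\<eta> (1,1) $ 2" let ?s02 = "\<eta> (0,2) $ 2"
  let ?s30 = "\<eta> (3,0) $ 2" let ?s21 = "\<eta> (2,1) $ 2"
  let ?s12 = "\<eta> (1,2) $ 2" let ?s03 = "\<eta> (0,3) $ 2"
  define k0 where "k0 = ?u0x - (?u0*(?b2 - 2*?a1) - ?u1*?a2)"
  define l0 where "l0 = ?u0y - (?u0*(?c2 - 2*?b1) - ?u1*?b2)"
  define k1 where "k1 = ?u1x - (- (?u1*?a1) - 3*?u0*?b1 - 2*?u2*?a2)"
  define l1 where "l1 = ?u1y - (- (?u1*?b1) - 3*?u0*?c1 - 2*?u2*?b2)"
  define k2 where "k2 = ?u2x - (- (?u2*?b2) - 2*?u1*?b1 - 3*?u3*?a2)"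
  define l2 where "l2 = ?u2y - (- (?u2*?c2) - 2*?u1*?c1 - 3*?u3*?b2)"
  define k3 where "k3 = ?u3x - (?u3*(?a1 - 2*?b2) - ?u2*?b1)"
  define l3 where "l3 = ?u3y - (?u3*(?b1 - 2*?c2) - ?u2*?c1)"
  define m1 where "m1 = (?b1*?a1 + ?b2*?b1) - (?a1*?b1 + ?a2*?c1)"
  define n1 where "n1 = (?c1*?a1 + ?c2*?b1) - (?b1*?b1 + ?b2*?c1)"
  define m2 where "m2 = (?b1*?a2 + ?b2*?b2) - (?a1*?b2 + ?a2*?c2)"
  define n2 where "n2 = (?c1*?a2 + ?c2*?b2) - (?b1*?b2 + ?b2*?c2)"
  have X0: "?q20 = k0" "2*?q11 - ?p20 = k1" "?q02 - 2*?p11 = k2" "?p02 = - k3"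
    using \<xi>(1) unfolding fibre_eq_iff defect_defs by (simp_all add: v k0_def k1_def k2_def k3_def algebra_simps)
  have Y0: "?s20 = l0" "2*?s11 - ?r20 = l1" "?s02 - 2*?r11 = l2" "?r02 = - l3"
    using \<eta>(1) unfolding fibre_eq_iff defect_defs by (simp_all add: v tors l0_def l1_def l2_def l3_def algebra_simps)
  have B1: "?r20 - ?p11 = m1" "?s20 - ?q11 = m2" "?r11 - ?p02 = n1" "?s11 - ?q02 = n2"
    using br(2,3) unfolding vec2_eq_iff bracket_def advect_explicit
    by (simp_all add: v tors m1_def m2_def n1_def n2_def algebra_simps)
  \<comment> \<open>Eliminating all second derivatives except \<open>?p11\<close> leaves \<open>4 * ?p11 = ?p11 + ...\<close>.\<close>
  have "3*?p11 = m1 + l1 - 2*n2 - 2*k2" using X0(3) Y0(2) B1(1,4) by linarith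
  then have second: "?p11 = (m1 + l1 - 2*n2 - 2*k2)/3"
      "?q11 = l0 - m2"
      "?p20 = 2*l0 - 2*m2 - k1"
      "?q20 = k0"
      "?p02 = - k3"
      "?q02 = k2 + 2*(m1 + l1 - 2*n2 - 2*k2)/3"
      "?r20 = m1 + (m1 + l1 - 2*n2 - 2*k2)/3"
      "?s20 = l0"
      "?r11 = n1 - k3"
      "?s11 = n2 + k2 + 2*(m1 + l1 - 2*n2 - 2*k2)/3"
      "?r02 = - l3"
      "?s02 = l2 + 2*n1 - 2*k3"
    using X0 Y0 B1 by (simp_all add: field_simps)
  define XK0 where "XK0 = ?a1*?u0x + ?a2*?u0y + ?u0xx - (?u0*(?q11 - 2*?p20) - ?u1*?q20)
    - (?u0x*(?b2 - 2*?a1) - ?u1x*?a2)"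
  define XL0 where "XL0 = ?b1*?u0x + ?b2*?u0y + ?u0xy - (?u0*(?q02 - 2*?p11) - ?u1*?q11)
    - (?u0y*(?b2 - 2*?a1) - ?u1y*?a2)"
  define XK1 where "XK1 = ?a1*?u1x + ?a2*?u1y + ?u1xx - (- (?u1*?p20) - 3*?u0*?p11 - 2*?u2*?q20)
    - (- (?u1x*?a1) - 3*?u0x*?b1 - 2*?u2x*?a2)"
  define XL1 where "XL1 = ?b1*?u1x + ?b2*?u1y + ?u1xy - (- (?u1*?p11) - 3*?u0*?p02 - 2*?u2*?q11)
    - (- (?u1y*?a1) - 3*?u0y*?b1 - 2*?u2y*?a2)"
  define XK2 where "XK2 = ?a1*?u2x + ?a2*?u2y + ?u2xx - (- (?u2*?q11) - 2*?u1*?p11 - 3*?u3*?q20)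
    - (- (?u2x*?b2) - 2*?u1x*?b1 - 3*?u3x*?a2)"
  define XL2 where "XL2 = ?b1*?u2x + ?b2*?u2y + ?u2xy - (- (?u2*?q02) - 2*?u1*?p02 - 3*?u3*?q11)
    - (- (?u2y*?b2) - 2*?u1y*?b1 - 3*?u3y*?a2)"
  define XK3 where "XK3 = ?a1*?u3x + ?a2*?u3y + ?u3xx - (?u3*(?p20 - 2*?q11) - ?u2*?p11)
    - (?u3x*(?a1 - 2*?b2) - ?u2x*?b1)"
  define XL3 where "XL3 = ?b1*?u3x + ?b2*?u3y + ?u3xy - (?u3*(?p11 - 2*?q02) - ?u2*?p02)
    - (?u3y*(?a1 - 2*?b2) - ?u2y*?b1)"
  have X1: "?q30 = XK0" "2*?q21 - ?p30 = XK1" "?q12 - 2*?p21 = XK2" "- ?p12 = XK3"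
    using \<xi>(2) unfolding fibre_eq_iff defect_defs by (simp_all add: v tors XK0_def XK1_def XK2_def XK3_def algebra_simps)
  have X2: "?q21 = XL0" "2*?q12 - ?p21 = XL1" "?q03 - 2*?p12 = XL2" "- ?p03 = XL3"
    using \<xi>(3) unfolding fibre_eq_iff defect_defs by (simp_all add: v tors XL0_def XL1_def XL2_def XL3_def algebra_simps)
  \<comment> \<open>The same elimination, one order higher.\<close>
  have "3*?p21 = XL1 - 2*XK2" using X1 X2 by linarith
  then have thirdX: "?p12 = - XK3"
      "?q30 = XK0"
      "?q21 = XL0"
      "?p03 = - XL3"
      "?p21 = (XL1 - 2*XK2)/3"
      "?q12 = (2*XL1 - XK2)/3"
      "?p30 = 2*XL0 - XK1"
      "?q03 = XL2 - 2*XK3"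
    using X1 X2 by (simp_all add: field_simps)
  define YK0 where "YK0 = ?b1*?u0x + ?b2*?u0y + ?u0xy - (?u0*(?s11 - 2*?r20) - ?u1*?s20)
    - (?u0x*(?c2 - 2*?b1) - ?u1x*?b2)"
  define YL0 where "YL0 = ?c1*?u0x + ?c2*?u0y + ?u0yy - (?u0*(?s02 - 2*?r11) - ?u1*?s11)
    - (?u0y*(?c2 - 2*?b1) - ?u1y*?b2)"
  define YK1 where "YK1 = ?b1*?u1x + ?b2*?u1y + ?u1xy - (- (?u1*?r20) - 3*?u0*?r11 - 2*?u2*?s20)
    - (- (?u1x*?b1) - 3*?u0x*?c1 - 2*?u2x*?b2)"
  define YL1 where "YL1 = ?c1*?u1x + ?c2*?u1y + ?u1yy - (- (?u1*?r11) - 3*?u0*?r02 - 2*?u2*?s11)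
    - (- (?u1y*?b1) - 3*?u0y*?c1 - 2*?u2y*?b2)"
  define YK2 where "YK2 = ?b1*?u2x + ?b2*?u2y + ?u2xy - (- (?u2*?s11) - 2*?u1*?r11 - 3*?u3*?s20)
    - (- (?u2x*?c2) - 2*?u1x*?c1 - 3*?u3x*?b2)"
  define YL2 where "YL2 = ?c1*?u2x + ?c2*?u2y + ?u2yy - (- (?u2*?s02) - 2*?u1*?r02 - 3*?u3*?s11)
    - (- (?u2y*?c2) - 2*?u1y*?c1 - 3*?u3y*?b2)"
  define YK3 where "YK3 = ?b1*?u3x + ?b2*?u3y + ?u3xy - (?u3*(?r20 - 2*?s11) - ?u2*?r11)
    - (?u3x*(?b1 - 2*?c2) - ?u2x*?c1)"
  define YL3 where "YL3 = ?c1*?u3x + ?c2*?u3y + ?u3yy - (?u3*(?r11 - 2*?s02) - ?u2*?r02)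
    - (?u3y*(?b1 - 2*?c2) - ?u2y*?c1)"
  have Y1: "?s30 = YK0" "2*?s21 - ?r30 = YK1" "?s12 - 2*?r21 = YK2" "- ?r12 = YK3"
    using \<eta>(2) unfolding fibre_eq_iff defect_defs by (simp_all add: v tors YK0_def YK1_def YK2_def YK3_def algebra_simps)
  have Y2: "?s21 = YL0" "2*?s12 - ?r21 = YL1" "?s03 - 2*?r12 = YL2" "- ?r03 = YL3"
    using \<eta>(3) unfolding fibre_eq_iff defect_defs by (simp_all add: v tors YL0_def YL1_def YL2_def YL3_def algebra_simps)
  have "3*?r21 = YL1 - 2*YK2" using Y1 Y2 by linarith
  then have thirdY: "?r12 = - YK3"
      "?s30 = YK0"
      "?s21 = YL0"
      "?r03 = - YL3"
      "?r21 = (YL1 - 2*YK2)/3"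
      "?s12 = (2*YL1 - YK2)/3"
      "?r30 = 2*YL0 - YK1"
      "?s03 = YL2 - 2*YK3"
    using Y1 Y2 by (simp_all add: field_simps)
  have B20_1: "bracket \<xi> \<eta> (2,0) $ 1 = liouville_jet \<upsilon> (2,0) $ 1"
    unfolding bracket_def advect_explicit
    apply (simp only: v tors axis_components vector_minus_component vector_add_component vector_scaleR_component)
    unfolding thirdX thirdY unfolding XK0_def XK1_def XK2_def XK3_def XL0_def XL1_def XL2_def XL3_def YK0_def YK1_def YK2_def YK3_def YL0_def YL1_def YL2_def YL3_def unfolding second unfolding k0_def k1_def k2_def k3_def l0_def l1_def l2_def l3_def m1_def m2_def n1_def n2_def
    by (simp add: liouville_jet_def liouville1_def liouville2_def field_simps)
  have B20_2: "bracket \<xi> \<eta> (2,0) $ 2 = liouville_jet \<upsilon> (2,0) $ 2"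
    unfolding bracket_def advect_explicit
    apply (simp only: v tors axis_components vector_minus_component vector_add_component vector_scaleR_component)
    unfolding thirdX thirdY unfolding XK0_def XK1_def XK2_def XK3_def XL0_def XL1_def XL2_def XL3_def YK0_def YK1_def YK2_def YK3_def YL0_def YL1_def YL2_def YL3_def unfolding second unfolding k0_def k1_def k2_def k3_def l0_def l1_def l2_def l3_def m1_def m2_def n1_def n2_def
    by (simp add: liouville_jet_def liouville1_def liouville2_def field_simps)
  have B11_1: "bracket \<xi> \<eta> (1,1) $ 1 = liouville_jet \<upsilon> (1,1) $ 1"
    unfolding bracket_def advect_explicit
    apply (simp only: v tors axis_components vector_minus_component vector_add_component vector_scaleR_component)
    unfolding thirdX thirdY unfolding XK0_def XK1_def XK2_def XK3_def XL0_def XL1_def XL2_def XL3_def YK0_def YK1_def YK2_def YK3_def YL0_def YL1_def YL2_def YL3_def unfolding second unfolding k0_def k1_def k2_def k3_def l0_def l1_def l2_def l3_def m1_def m2_def n1_def n2_def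
    by (simp add: liouville_jet_def liouville1_def liouville2_def field_simps)
  have B11_2: "bracket \<xi> \<eta> (1,1) $ 2 = liouville_jet \<upsilon> (1,1) $ 2"
    unfolding bracket_def advect_explicit
    apply (simp only: v tors axis_components vector_minus_component vector_add_component vector_scaleR_component)
    unfolding thirdX thirdY unfolding XK0_def XK1_def XK2_def XK3_def XL0_def XL1_def XL2_def XL3_def YK0_def YK1_def YK2_def YK3_def YL0_def YL1_def YL2_def YL3_def unfolding second unfolding k0_def k1_def k2_def k3_def l0_def l1_def l2_def l3_def m1_def m2_def n1_def n2_def
    by (simp add: liouville_jet_def liouville1_def liouville2_def field_simps)
  have B02_1: "bracket \<xi> \<eta> (0,2) $ 1 = liouville_jet \<upsilon> (0,2) $ 1"
    unfolding bracket_def advect_explicit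
    apply (simp only: v tors axis_components vector_minus_component vector_add_component vector_scaleR_component)
    unfolding thirdX thirdY unfolding XK0_def XK1_def XK2_def XK3_def XL0_def XL1_def XL2_def XL3_def YK0_def YK1_def YK2_def YK3_def YL0_def YL1_def YL2_def YL3_def unfolding second unfolding k0_def k1_def k2_def k3_def l0_def l1_def l2_def l3_def m1_def m2_def n1_def n2_def
    by (simp add: liouville_jet_def liouville1_def liouville2_def field_simps)
  have B02_2: "bracket \<xi> \<eta> (0,2) $ 2 = liouville_jet \<upsilon> (0,2) $ 2"
    unfolding bracket_def advect_explicit
    apply (simp only: v tors axis_components vector_minus_component vector_add_component vector_scaleR_component)
    unfolding thirdX thirdY unfolding XK0_def XK1_def XK2_def XK3_def XL0_def XL1_def XL2_def XL3_def YK0_def YK1_def YK2_def YK3_def YL0_def YL1_def YL2_def YL3_def unfolding second unfolding k0_def k1_def k2_def k3_def l0_def l1_def l2_def l3_def m1_def m2_def n1_def n2_def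
    by (simp add: liouville_jet_def liouville1_def liouville2_def field_simps)
  have "i = 0 \<and> j = 0 \<or> i = 1 \<and> j = 0 \<or> i = 0 \<and> j = 1 \<or> i = 2 \<and> j = 0 \<or> i = 1 \<and> j = 1 \<or> i = 0 \<and> j = 2"
    using ij by linarith
  then show ?thesis
    using B20_1 B20_2 B11_1 B11_2 B02_1 B02_2 br by (auto simp: vec2_eq_iff liouville_jet_def)
qed

abbreviation wedge :: "real^2 \<Rightarrow> real^2 \<Rightarrow> real" where
  "wedge v w \<equiv> v $ 1 * w $ 2 - v $ 2 * w $ 1"

text \<open>Reduction to the standard frame by inverting the matrix of the two values. Independence cannot be
  dropped: two fields vanishing at the point can have commuting linear parts while
  their bracket has a non-zero quadratic part.\<close>

lemma bracket_frame:
  assumes indep: "wedge (\<xi> (0,0)) (\<eta> (0,0)) \<noteq> 0"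
    and \<xi>: "defect00 \<upsilon> \<xi> = 0" "defect10 \<upsilon> \<xi> = 0" "defect01 \<upsilon> \<xi> = 0"
    and \<eta>: "defect00 \<upsilon> \<eta> = 0" "defect10 \<upsilon> \<eta> = 0" "defect01 \<upsilon> \<eta> = 0"
    and br: "bracket \<xi> \<eta> (0,0) = 0" "bracket \<xi> \<eta> (1,0) = 0" "bracket \<xi> \<eta> (0,1) = 0"
    and ij: "i + j \<le> 2"
  shows "bracket \<xi> \<eta> (i, j) = wedge (\<xi> (0,0)) (\<eta> (0,0)) *\<^sub>R liouville_jet \<upsilon> (i, j)"
proof -
  define d where "d = wedge (\<xi> (0,0)) (\<eta> (0,0))"
  define a b c e where abce: "a = \<eta> (0,0) $ 2 / d" "b = - \<xi> (0,0) $ 2 / d" "c = - \<eta> (0,0) $ 1 / d" "e = \<xi> (0,0) $ 1 / d"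
  have d: "d \<noteq> 0" using indep by (simp add: d_def)
  have dd: "\<xi> (0,0) $ 1 * \<eta> (0,0) $ 2 - \<xi> (0,0) $ 2 * \<eta> (0,0) $ 1 = d" by (simp add: d_def)
  have det: "a * e - b * c = 1 / d"
  proof -
    have "a * e - b * c = (\<xi> (0,0) $ 1 * \<eta> (0,0) $ 2 - \<xi> (0,0) $ 2 * \<eta> (0,0) $ 1) / (d * d)"
      using d by (simp add: abce field_simps)
    then show ?thesis unfolding dd using d by simp
  qed
  have fr: "(\<lambda>m. a *\<^sub>R \<xi> m + b *\<^sub>R \<eta> m) (0,0) = axis 1 1" "(\<lambda>m. c *\<^sub>R \<xi> m + e *\<^sub>R \<eta> m) (0,0) = axis 2 1"
    using d dd by (auto simp: vec2_eq_iff abce field_simps)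
  have "bracket (\<lambda>m. a *\<^sub>R \<xi> m + b *\<^sub>R \<eta> m) (\<lambda>m. c *\<^sub>R \<xi> m + e *\<^sub>R \<eta> m) (i, j) = liouville_jet \<upsilon> (i, j)"
    by (rule bracket_standard_frame[where \<xi>="\<lambda>m. a *\<^sub>R \<xi> m + b *\<^sub>R \<eta> m" and \<eta>="\<lambda>m. c *\<^sub>R \<xi> m + e *\<^sub>R \<eta> m", OF fr]) (simp_all only: defect_linear bracket_combination \<xi> \<eta> br scaleR_zero_right add_0 ij)
  then have "(1 / d) *\<^sub>R bracket \<xi> \<eta> (i, j) = liouville_jet \<upsilon> (i, j)"
    unfolding bracket_combination det .
  then have "d *\<^sub>R (1 / d) *\<^sub>R bracket \<xi> \<eta> (i, j) = d *\<^sub>R liouville_jet \<upsilon> (i, j)" by simp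
  then show ?thesis using d by (simp add: d_def)
qed

section \<open>Solutions with vanishing first derivatives\<close>

text \<open>The only solution of the isotropy equations with vanishing first derivatives whose brackets vanish to first
  order, as a function of its value \<open>v\<close>; \<open>lift3\<close> is its only extension to third order.\<close>

definition lift2 :: "fibre jet \<Rightarrow> real^2 \<Rightarrow> (real^2) jet" where
  "lift2 \<upsilon> v = (\<lambda>m.
     if m = (0,0) then v
     else if m = (2,0) then vector
       [v$1 * (2 * coef0 (\<upsilon> (0,1)) - coef1 (\<upsilon> (1,0))) + v$2 * (coef1 (\<upsilon> (0,1)) - 2 * coef2 (\<upsilon> (1,0))) / 3,
        v$1 * coef0 (\<upsilon> (1,0)) + v$2 * coef0 (\<upsilon> (0,1))]
     else if m = (1,1) then vector
       [v$1 * (coef1 (\<upsilon> (0,1)) - 2 * coef2 (\<upsilon> (1,0))) / 3 - v$2 * coef3 (\<upsilon> (1,0)),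
        v$1 * coef0 (\<upsilon> (0,1)) + v$2 * (2 * coef1 (\<upsilon> (0,1)) - coef2 (\<upsilon> (1,0))) / 3]
     else if m = (0,2) then vector
       [- v$1 * coef3 (\<upsilon> (1,0)) - v$2 * coef3 (\<upsilon> (0,1)),
        v$1 * (2 * coef1 (\<upsilon> (0,1)) - coef2 (\<upsilon> (1,0))) / 3 + v$2 * (coef2 (\<upsilon> (0,1)) - 2 * coef3 (\<upsilon> (1,0)))]
     else 0)"

definition lift3 :: "fibre jet \<Rightarrow> real^2 \<Rightarrow> (real^2) jet" where
  "lift3 \<upsilon> v = (let \<xi> = lift2 \<upsilon> v;
       K = v$1 *\<^sub>R \<upsilon> (2,0) + v$2 *\<^sub>R \<upsilon> (1,1) - first_order_part (\<xi> (2,0)) (\<xi> (1,1)) (\<upsilon> (0,0));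
       L = v$1 *\<^sub>R \<upsilon> (1,1) + v$2 *\<^sub>R \<upsilon> (0,2) - first_order_part (\<xi> (1,1)) (\<xi> (0,2)) (\<upsilon> (0,0))
     in (\<lambda>m.
       if m = (3,0) then vector [2 * coef0 L - coef1 K, coef0 K]
       else if m = (2,1) then vector [(coef1 L - 2 * coef2 K) / 3, coef0 L]
       else if m = (1,2) then vector [- coef3 K, (2 * coef1 L - coef2 K) / 3]
       else if m = (0,3) then vector [- coef3 L, coef2 L - 2 * coef3 K]
       else \<xi> m))"

lemma lift3_eq_lift2: "i + j \<le> 2 \<Longrightarrow> lift3 \<upsilon> v (i, j) = lift2 \<upsilon> v (i, j)"
  by (auto simp: lift3_def Let_def)

lemma lift2_support: "\<not> i + j \<le> 2 \<Longrightarrow> lift2 \<upsilon> v (i, j) = 0"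
  by (auto simp: lift2_def)

lemma lift3_support: "\<not> i + j \<le> 3 \<Longrightarrow> lift3 \<upsilon> v (i, j) = 0"
  by (auto simp: lift3_def lift2_def Let_def)

lemma lift2_add: "lift2 \<upsilon> (v + w) = lift2 \<upsilon> v + lift2 \<upsilon> w"
  by (auto simp: fun_eq_iff lift2_def vec2_eq_iff algebra_simps add_divide_distrib diff_divide_distrib)

lemma lift2_scaleR: "lift2 \<upsilon> (c *\<^sub>R v) = c *\<^sub>R lift2 \<upsilon> v"
  by (auto simp: fun_eq_iff scaleR_fun_def lift2_def vec2_eq_iff algebra_simps)

lemma lift3_add: "lift3 \<upsilon> (v + w) = lift3 \<upsilon> v + lift3 \<upsilon> w"
  by (simp only: fun_eq_iff lift3_def Let_def lift2_add first_order_part_def plus_fun_apply)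
    (auto simp: vec2_eq_iff algebra_simps add_divide_distrib diff_divide_distrib)

lemma lift3_scaleR: "lift3 \<upsilon> (c *\<^sub>R v) = c *\<^sub>R lift3 \<upsilon> v"
  by (simp only: fun_eq_iff lift3_def Let_def lift2_scaleR first_order_part_def scaleR_fun_def)
    (auto simp: vec2_eq_iff algebra_simps)

lemma lift2_cong:
  assumes "\<upsilon> (1,0) = \<upsilon>' (1,0)" "\<upsilon> (0,1) = \<upsilon>' (0,1)"
  shows "lift2 \<upsilon> v = lift2 \<upsilon>' v"
  using assms by (simp add: lift2_def fun_eq_iff)

lemma defect00_lift2: "defect00 \<upsilon> (lift2 \<upsilon> v) = 0"
  by (simp add: fibre_eq_iff defect_defs lift2_def algebra_simps add_divide_distrib diff_divide_distrib)

lemma defect_cong2: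
  assumes "\<And>i j. i + j \<le> 2 \<Longrightarrow> \<xi> (i, j) = \<eta> (i, j)"
  shows "defect00 \<upsilon> \<xi> = defect00 \<upsilon> \<eta>"
  using assms by (simp add: defect00_def)

lemma defect_lift3:
  "defect00 \<upsilon> (lift3 \<upsilon> v) = 0" "defect10 \<upsilon> (lift3 \<upsilon> v) = 0" "defect01 \<upsilon> (lift3 \<upsilon> v) = 0"
proof -
  show "defect00 \<upsilon> (lift3 \<upsilon> v) = 0"
    using defect_cong2[of "lift3 \<upsilon> v" "lift2 \<upsilon> v" \<upsilon>] lift3_eq_lift2 defect00_lift2 by metis
  have z: "lift2 \<upsilon> v (1,0) = 0" "lift2 \<upsilon> v (0,1) = 0" "lift2 \<upsilon> v (0,0) = v"
    by (simp_all add: lift2_def)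
  have "first_order_part 0 0 u = 0" for u by (simp add: first_order_part_def fibre_eq_iff)
  note z = z this
  show "defect10 \<upsilon> (lift3 \<upsilon> v) = 0"
    unfolding defect10_def by (simp add: lift3_def Let_def z del: One_nat_def)
      (simp add: fibre_eq_iff second_order_part_def field_simps)
  show "defect01 \<upsilon> (lift3 \<upsilon> v) = 0"
    unfolding defect01_def by (simp add: lift3_def Let_def z del: One_nat_def)
      (simp add: fibre_eq_iff second_order_part_def field_simps)
qed

lemma bracket_lift2: 
  assumes "i + j \<le> 1"
  shows "bracket (lift2 \<upsilon> v) (lift2 \<upsilon> w) (i, j) = 0"
proof -
  have "i = 0 \<and> j = 0 \<or> i = 1 \<and> j = 0 \<or> i = 0 \<and> j = 1" using assms by linarith
  then show ?thesis
    unfolding bracket_def vec2_eq_iff by (elim disjE conjE; hypsubst; unfold advect_explicit)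
      (simp_all add: lift2_def algebra_simps)
qed

text \<open>The first derivatives vanish here, so the equations are linear with constant coefficients. The
  bracket condition expresses both \<open>\<eta>\<^sup>1\<^sub>1\<^sub>1\<close> and \<open>\<eta>\<^sup>2\<^sub>1\<^sub>2\<close> by \<open>\<xi>\<close>, and the symbol equations turn this
  into an equation for \<open>\<xi>\<^sup>1\<^sub>1\<^sub>2\<close> alone, whose coefficient is 3.\<close>

lemma lift2_unique:
  assumes v: "\<xi> (0,0) = axis 1 1" "\<eta> (0,0) = axis 2 1"
    and z: "\<xi> (1,0) = 0" "\<xi> (0,1) = 0" "\<eta> (1,0) = 0" "\<eta> (0,1) = 0"
    and d: "defect00 \<upsilon> \<xi> = 0" "defect00 \<upsilon> \<eta> = 0"
    and br: "bracket \<xi> \<eta> (1,0) = 0" "bracket \<xi> \<eta> (0,1) = 0"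
    and ij: "i + j \<le> 2"
  shows "\<xi> (i, j) = lift2 \<upsilon> (axis 1 1) (i, j)" "\<eta> (i, j) = lift2 \<upsilon> (axis 2 1) (i, j)"
proof -
  note [simp del] = One_nat_def
  have c: "i = 0 \<and> j = 0 \<or> i = 1 \<and> j = 0 \<or> i = 0 \<and> j = 1 \<or> i = 2 \<and> j = 0 \<or> i = 1 \<and> j = 1 \<or> i = 0 \<and> j = 2"
    using ij by linarith
  have X0: "\<xi> (2,0) $ 2 = coef0 (\<upsilon> (1,0))" "2 * \<xi> (1,1) $ 2 - \<xi> (2,0) $ 1 = coef1 (\<upsilon> (1,0))"
    "\<xi> (0,2) $ 2 - 2 * \<xi> (1,1) $ 1 = coef2 (\<upsilon> (1,0))" "\<xi> (0,2) $ 1 = - coef3 (\<upsilon> (1,0))"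
    using d(1) unfolding fibre_eq_iff defect_defs by (simp_all add: v z algebra_simps)
  have Y0: "\<eta> (2,0) $ 2 = coef0 (\<upsilon> (0,1))" "2 * \<eta> (1,1) $ 2 - \<eta> (2,0) $ 1 = coef1 (\<upsilon> (0,1))"
    "\<eta> (0,2) $ 2 - 2 * \<eta> (1,1) $ 1 = coef2 (\<upsilon> (0,1))" "\<eta> (0,2) $ 1 = - coef3 (\<upsilon> (0,1))"
    using d(2) unfolding fibre_eq_iff defect_defs by (simp_all add: v z algebra_simps)
  have B: "\<eta> (2,0) $ 1 = \<xi> (1,1) $ 1" "\<eta> (2,0) $ 2 = \<xi> (1,1) $ 2" "\<eta> (1,1) $ 1 = \<xi> (0,2) $ 1" "\<eta> (1,1) $ 2 = \<xi> (0,2) $ 2"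
    using br unfolding vec2_eq_iff bracket_def advect_explicit by (simp_all add: v z)
  have "3 * \<xi> (1,1) $ 1 = coef1 (\<upsilon> (0,1)) - 2 * coef2 (\<upsilon> (1,0))"
    using X0 Y0 B by linarith
  then show "\<xi> (i, j) = lift2 \<upsilon> (axis 1 1) (i, j)" "\<eta> (i, j) = lift2 \<upsilon> (axis 2 1) (i, j)"
    using c X0 Y0 B v z by (auto simp: lift2_def vec2_eq_iff field_simps)
qed

text \<open>The two systems of third order involve the third derivatives only through the symbol,
  and third derivatives killed by both prolonged symbol equations are zero.\<close>

lemma lift3_unique:
  assumes d: "defect10 \<upsilon> \<xi> = 0" "defect01 \<upsilon> \<xi> = 0"
    and low: "\<And>i j. i + j \<le> 2 \<Longrightarrow> \<xi> (i, j) = lift2 \<upsilon> v (i, j)"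
    and ij: "i + j \<le> 3"
  shows "\<xi> (i, j) = lift3 \<upsilon> v (i, j)"
proof (cases "i + j \<le> 2")
  case True then show ?thesis using low lift3_eq_lift2 by simp
next
  case False
  have "second_order_part (\<xi> (3,0)) (\<xi> (2,1)) (\<xi> (1,2)) = second_order_part (lift3 \<upsilon> v (3,0)) (lift3 \<upsilon> v (2,1)) (lift3 \<upsilon> v (1,2))"
    using trans[OF d(1) defect_lift3(2)[of \<upsilon> v, symmetric]] unfolding defect10_def by (simp add: low lift3_eq_lift2)
  moreover have "second_order_part (\<xi> (2,1)) (\<xi> (1,2)) (\<xi> (0,3)) = second_order_part (lift3 \<upsilon> v (2,1)) (lift3 \<upsilon> v (1,2)) (lift3 \<upsilon> v (0,3))"
    using trans[OF d(2) defect_lift3(3)[of \<upsilon> v, symmetric]] unfolding defect01_def by (simp add: low lift3_eq_lift2)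
  moreover have "i = 3 \<and> j = 0 \<or> i = 2 \<and> j = 1 \<or> i = 1 \<and> j = 2 \<or> i = 0 \<and> j = 3"
    using ij False by linarith
  ultimately show ?thesis
    by (auto simp: second_order_part_def vec2_eq_iff del: One_nat_def)
qed

section \<open>Point transformations and their action on sections\<close>

lemma has_vector_derivative_vec2_iff:
  fixes f :: "real \<Rightarrow> real^2"
  shows "(f has_vector_derivative f') (at t) \<longleftrightarrow>
    ((\<lambda>t. f t $ 1) has_real_derivative f' $ 1) (at t) \<and> ((\<lambda>t. f t $ 2) has_real_derivative f' $ 2) (at t)"
proof safe
  assume f: "(f has_vector_derivative f') (at t)"
  show "((\<lambda>t. f t $ 1) has_real_derivative f' $ 1) (at t)" "((\<lambda>t. f t $ 2) has_real_derivative f' $ 2) (at t)"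
    using bounded_linear.has_vector_derivative[OF bounded_linear_vec_nth f]
    by (auto simp: has_real_derivative_iff_has_vector_derivative)
next
  assume f: "((\<lambda>t. f t $ 1) has_real_derivative f' $ 1) (at t)" "((\<lambda>t. f t $ 2) has_real_derivative f' $ 2) (at t)"
  have "((\<lambda>t. f t $ 1 *\<^sub>R axis 1 1 + f t $ 2 *\<^sub>R axis 2 1) has_vector_derivative
      (f' $ 1 *\<^sub>R axis 1 1 + f' $ 2 *\<^sub>R axis 2 1 :: real^2)) (at t)"
    using f unfolding has_real_derivative_iff_has_vector_derivative
    by (auto intro!: derivative_eq_intros simp: has_real_derivative_iff_has_vector_derivative)
  moreover have "v $ 1 *\<^sub>R axis 1 1 + v $ 2 *\<^sub>R axis 2 1 = v" for v :: "real^2"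
    by (simp add: vec2_eq_iff)
  ultimately show "(f has_vector_derivative f') (at t)" by (simp only:)
qed

text \<open>The coefficients of \<open>ode_poly\<close> multiplied out, as a function of the first derivatives \<open>a\<close>, \<open>b\<close> and the
  second derivatives \<open>c\<close>, \<open>d\<close>, \<open>e\<close> of the inverse map.\<close>

definition transform_coeffs ::
  "real^2 \<Rightarrow> real^2 \<Rightarrow> real^2 \<Rightarrow> real^2 \<Rightarrow> real^2 \<Rightarrow> fibre \<Rightarrow> fibre" where
  "transform_coeffs a b c d e u = inverse (wedge a b) *\<^sub>R
    (coef0 u * a$1^3 + coef1 u * a$1^2 * a$2 + coef2 u * a$1 * a$2^2 + coef3 u * a$2^3
       - a$1 * c$2 + a$2 * c$1,
     3 * coef0 u * a$1^2 * b$1 + coef1 u * (2 * a$1 * b$1 * a$2 + a$1^2 * b$2)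
       + coef2 u * (b$1 * a$2^2 + 2 * a$1 * a$2 * b$2) + 3 * coef3 u * a$2^2 * b$2
       - (2 * a$1 * d$2 + b$1 * c$2) + (2 * a$2 * d$1 + b$2 * c$1),
     3 * coef0 u * a$1 * b$1^2 + coef1 u * (b$1^2 * a$2 + 2 * a$1 * b$1 * b$2)
       + coef2 u * (2 * b$1 * a$2 * b$2 + a$1 * b$2^2) + 3 * coef3 u * a$2 * b$2^2
       - (a$1 * e$2 + 2 * b$1 * d$2) + (a$2 * e$1 + 2 * b$2 * d$1),
     coef0 u * b$1^3 + coef1 u * b$1^2 * b$2 + coef2 u * b$1 * b$2^2 + coef3 u * b$2^3
       - b$1 * e$2 + b$2 * e$1)"

lemma coeff_ode_poly:
  "(coeff (ode_poly g z u) 0, coeff (ode_poly g z u) 1, coeff (ode_poly g z u) 2, coeff (ode_poly g z u) 3) =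
    transform_coeffs (partial 1 g z) (partial 2 g z) (partial 1 (partial 1 g) z)
      (partial 1 (partial 2 g) z) (partial 2 (partial 2 g) z) u"
proof -
  obtain u0 u1 u2 u3 where u: "u = (u0, u1, u2, u3)" by (cases u) auto
  show ?thesis
    unfolding u ode_poly_def transform_coeffs_def
    by (simp add: Let_def numeral_2_eq_2 numeral_3_eq_3 algebra_simps)
qed

lemma push_section_image:
  assumes "point_transformation U f" "q \<in> U"
  shows "push_section U f u (f q) =
    (let g = inv_into U f; z = f q in
     transform_coeffs (partial 1 g z) (partial 2 g z) (partial 1 (partial 1 g) z)
      (partial 1 (partial 2 g) z) (partial 2 (partial 2 g) z) (u q))"
proof -
  have "inv_into U f (f q) = q"
    using assms by (simp add: point_transformation_def inv_into_f_f)
  then show ?thesis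
    by (simp add: push_section_def lift0_def Let_def coeff_ode_poly[symmetric])
qed

lemma
  assumes "point_transformation U f"
  shows pt_open: "open U" and pt_open_image: "open (f ` U)"
    and pt_inv: "\<And>q. q \<in> U \<Longrightarrow> inv_into U f (f q) = q"
    and pt_smooth: "smooth_on U f" and pt_smooth_inv: "smooth_on (f ` U) (inv_into U f)"
  using assms by (auto simp: point_transformation_def inv_into_f_f)

lemma pt_derivative_inverse:
  assumes f: "point_transformation U f" and q: "q \<in> U"
  shows "frechet_derivative (inv_into U f) (at (f q)) (frechet_derivative f (at q) v) = v"
    and "frechet_derivative f (at q) (frechet_derivative (inv_into U f) (at (f q)) v) = v"
proof -
  let ?g = "inv_into U f"
  have fq: "f q \<in> f ` U" using q by simp
  have df: "f differentiable at q"
    by (rule smooth_on_differentiable[OF pt_smooth[OF f] pt_open[OF f] q])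
  have dg: "?g differentiable at (f q)"
    by (rule smooth_on_differentiable[OF pt_smooth_inv[OF f] pt_open_image[OF f] fq])
  have "dirderiv v (\<lambda>x. ?g (f x)) q = frechet_derivative ?g (at (f q)) (dirderiv v f q)"
    by (rule dirderiv_compose[OF dg df])
  moreover have "dirderiv v (\<lambda>x. ?g (f x)) q = dirderiv v (\<lambda>x. x) q"
    using frechet_derivative_cong_open[OF pt_open[OF f] q, of "\<lambda>x. ?g (f x)" "\<lambda>x. x"] pt_inv[OF f] by simp
  ultimately show "frechet_derivative ?g (at (f q)) (frechet_derivative f (at q) v) = v" by simp
  have df': "f differentiable at (?g (f q))" using df pt_inv[OF f q] by simp
  have "dirderiv v (\<lambda>z. f (?g z)) (f q) = frechet_derivative f (at (?g (f q))) (dirderiv v ?g (f q))"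
    by (rule dirderiv_compose[OF df' dg])
  moreover have "dirderiv v (\<lambda>z. f (?g z)) (f q) = dirderiv v (\<lambda>x. x) (f q)"
    using frechet_derivative_cong_open[OF pt_open_image[OF f] fq, of "\<lambda>z. f (?g z)" "\<lambda>x. x"]
    by (simp add: f_inv_into_f)
  ultimately show "frechet_derivative f (at q) (frechet_derivative ?g (at (f q)) v) = v"
    using pt_inv[OF f q] by simp
qed

text \<open>Derivatives of a function \<open>h\<close> on the image are read off at \<open>f q\<close> from the pulled back function
  \<open>F\<close>; so derivatives at points that move with a flow become derivatives at a fixed point.\<close>

lemma pt_chain_partials:
  assumes f: "point_transformation U f" and q: "q \<in> U" and V: "open V" "q \<in> V" "V \<subseteq> U"
    and F: "F differentiable at q" and h: "\<And>x. x \<in> V \<Longrightarrow> h (f x) = F x"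
  shows "partial j h (f q) = partial j (inv_into U f) (f q) $ 1 *\<^sub>R partial 1 F q
    + partial j (inv_into U f) (f q) $ 2 *\<^sub>R partial 2 F q"
proof -
  let ?g = "inv_into U f"
  have fq: "f q \<in> f ` U" using q by simp
  have dg: "?g differentiable at (f q)"
    by (rule smooth_on_differentiable[OF pt_smooth_inv[OF f] pt_open_image[OF f] fq])
  have "?g -` V \<inter> f ` U = f ` V"
    using V pt_inv[OF f] by force
  moreover have "open (?g -` V \<inter> f ` U)"
    using continuous_on_open_vimage[OF pt_open_image[OF f]] smooth_on_continuous_on[OF pt_smooth_inv[OF f]] V(1)
    by blast
  ultimately have fV: "open (f ` V)" by simp
  have "partial j h (f q) = partial j (\<lambda>z. F (?g z)) (f q)"
    by (rule partial_cong_open[OF fV]) (use V h pt_inv[OF f] in auto)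
  also have "\<dots> = frechet_derivative F (at q) (partial j ?g (f q))"
    unfolding partial_def using dirderiv_compose[of F ?g "f q"] F dg pt_inv[OF f q] by simp
  also have "\<dots> = partial j ?g (f q) $ 1 *\<^sub>R partial 1 F q + partial j ?g (f q) $ 2 *\<^sub>R partial 2 F q"
    by (rule dirderiv_eq_partials[OF F])
  finally show ?thesis .
qed

lemma pt_inverse_partials:
  assumes f: "point_transformation U f" and q: "q \<in> U"
  defines "J \<equiv> wedge (partial 1 f q) (partial 2 f q)"
  shows "J \<noteq> 0"
    and "partial 1 (inv_into U f) (f q) = inverse J *\<^sub>R vector [partial 2 f q $ 2, - partial 1 f q $ 2]"
    and "partial 2 (inv_into U f) (f q) = inverse J *\<^sub>R vector [- partial 2 f q $ 1, partial 1 f q $ 1]"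
proof -
  let ?g = "inv_into U f"
  let ?a = "partial 1 f q" and ?b = "partial 2 f q" and ?c = "partial 1 ?g (f q)" and ?d = "partial 2 ?g (f q)"
  have df: "f differentiable at q"
    by (rule smooth_on_differentiable[OF pt_smooth[OF f] pt_open[OF f] q])
  have "?c $ 1 *\<^sub>R ?a + ?c $ 2 *\<^sub>R ?b = axis 1 1" "?d $ 1 *\<^sub>R ?a + ?d $ 2 *\<^sub>R ?b = axis 2 1"
    using pt_derivative_inverse(2)[OF f q, of "axis 1 1"] pt_derivative_inverse(2)[OF f q, of "axis 2 1"]
      dirderiv_eq_partials[OF df, of ?c] dirderiv_eq_partials[OF df, of ?d]
    unfolding partial_def[of _ ?g] by simp_all
  then have e: "?c $ 1 * ?a $ 1 + ?c $ 2 * ?b $ 1 = 1" "?c $ 1 * ?a $ 2 + ?c $ 2 * ?b $ 2 = 0"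
    "?d $ 1 * ?a $ 1 + ?d $ 2 * ?b $ 1 = 0" "?d $ 1 * ?a $ 2 + ?d $ 2 * ?b $ 2 = 1"
    by (simp_all add: vec2_eq_iff)
  have "wedge ?c ?d * J = (?c $ 1 * ?a $ 1 + ?c $ 2 * ?b $ 1) * (?d $ 1 * ?a $ 2 + ?d $ 2 * ?b $ 2)
      - (?c $ 1 * ?a $ 2 + ?c $ 2 * ?b $ 2) * (?d $ 1 * ?a $ 1 + ?d $ 2 * ?b $ 1)"
    unfolding J_def by algebra
  then show J: "J \<noteq> 0" unfolding e by auto
  have "?c $ 1 * J = ?b $ 2" "?c $ 2 * J = - ?a $ 2" "?d $ 1 * J = - ?b $ 1" "?d $ 2 * J = ?a $ 1"
    using e unfolding J_def by algebra+
  then show "?c = inverse J *\<^sub>R vector [?b $ 2, - ?a $ 2]" "?d = inverse J *\<^sub>R vector [- ?b $ 1, ?a $ 1]"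
    using J by (auto simp: vec2_eq_iff field_simps)
qed

lemma transform_coeffs_identity: "transform_coeffs (axis 1 1) (axis 2 1) 0 0 0 u = u"
  by (simp add: transform_coeffs_def fibre_eq_iff)

lemma smooth_on_vector2:
  fixes f g :: "'a::euclidean_space \<Rightarrow> real"
  assumes "open S" "smooth_on S f" "smooth_on S g"
  shows "smooth_on S (\<lambda>x. vector [f x, g x] :: real^2)"
proof -
  have "(\<lambda>x. vector [f x, g x] :: real^2) = (\<lambda>x. f x *\<^sub>R axis 1 1 + g x *\<^sub>R axis 2 1)"
    by (simp add: fun_eq_iff vec2_eq_iff)
  then show ?thesis
    by (simp add: smooth_on_add smooth_on_scaleR smooth_on_const assms)
qed

lemma smooth_on_coef:
  assumes "open S" "smooth_on S u"
  shows "smooth_on S (\<lambda>x. coef0 (u x))" "smooth_on S (\<lambda>x. coef1 (u x))"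
    "smooth_on S (\<lambda>x. coef2 (u x))" "smooth_on S (\<lambda>x. coef3 (u x))"
  unfolding coef_defs by (intro smooth_on_fst smooth_on_snd assms)+

lemma smooth_on_transform_coeffs:
  assumes S: "open S" and sm: "smooth_on S a" "smooth_on S b" "smooth_on S c" "smooth_on S d" "smooth_on S e" "smooth_on S u"
    and nz: "\<And>x. x \<in> S \<Longrightarrow> wedge (a x) (b x) \<noteq> 0"
  shows "smooth_on S (\<lambda>x. transform_coeffs (a x) (b x) (c x) (d x) (e x) (u x))"
  unfolding transform_coeffs_def
  by (intro smooth_on_scaleR smooth_on_Pair smooth_on_inverse smooth_on_diff smooth_on_add smooth_on_mult
      smooth_on_power smooth_on_nth smooth_on_coef smooth_on_const sm S nz)

text \<open>The infinitesimal action: the inverse of the time \<open>t\<close> map has 2-jet \<open>id - t X\<close> up to first order in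
  \<open>t\<close>, which accounts for the signs. Second derivatives enter linearly because they vanish for the
  identity.\<close>

lemma transform_coeffs_derivative:
  fixes a b c d e :: "real \<Rightarrow> real^2"
  assumes "(a has_vector_derivative - A) (at 0)" "(b has_vector_derivative - B) (at 0)"
    "(c has_vector_derivative - C) (at 0)" "(d has_vector_derivative - D) (at 0)"
    "(e has_vector_derivative - E) (at 0)"
    and "a 0 = axis 1 1" "b 0 = axis 2 1" "c 0 = 0" "d 0 = 0" "e 0 = 0"
  shows "((\<lambda>t. transform_coeffs (a t) (b t) (c t) (d t) (e t) u) has_vector_derivative
    first_order_part A B u + second_order_part C D E) (at 0)"
proof -
  have der: "((\<lambda>t. a t $ 1) has_real_derivative - A $ 1) (at 0)" "((\<lambda>t. a t $ 2) has_real_derivative - A $ 2) (at 0)"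
    "((\<lambda>t. b t $ 1) has_real_derivative - B $ 1) (at 0)" "((\<lambda>t. b t $ 2) has_real_derivative - B $ 2) (at 0)"
    "((\<lambda>t. c t $ 1) has_real_derivative - C $ 1) (at 0)" "((\<lambda>t. c t $ 2) has_real_derivative - C $ 2) (at 0)"
    "((\<lambda>t. d t $ 1) has_real_derivative - D $ 1) (at 0)" "((\<lambda>t. d t $ 2) has_real_derivative - D $ 2) (at 0)"
    "((\<lambda>t. e t $ 1) has_real_derivative - E $ 1) (at 0)" "((\<lambda>t. e t $ 2) has_real_derivative - E $ 2) (at 0)"
    using assms(1-5)[unfolded has_vector_derivative_vec2_iff] by auto
  have nz: "wedge (a 0) (b 0) \<noteq> 0" using assms by simp
  have "((\<lambda>t. coef0 (transform_coeffs (a t) (b t) (c t) (d t) (e t) u)) has_real_derivative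
      coef0 (first_order_part A B u + second_order_part C D E)) (at 0)"
    unfolding transform_coeffs_def coef_simps
    by (auto intro!: derivative_eq_intros der nz simp: assms first_order_part_def second_order_part_def algebra_simps)
  moreover have "((\<lambda>t. coef1 (transform_coeffs (a t) (b t) (c t) (d t) (e t) u)) has_real_derivative
      coef1 (first_order_part A B u + second_order_part C D E)) (at 0)"
    unfolding transform_coeffs_def coef_simps
    by (auto intro!: derivative_eq_intros der nz simp: assms first_order_part_def second_order_part_def algebra_simps)
  moreover have "((\<lambda>t. coef2 (transform_coeffs (a t) (b t) (c t) (d t) (e t) u)) has_real_derivative
      coef2 (first_order_part A B u + second_order_part C D E)) (at 0)"
    unfolding transform_coeffs_def coef_simps
    by (auto intro!: derivative_eq_intros der nz simp: assms first_order_part_def second_order_part_def algebra_simps)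
  moreover have "((\<lambda>t. coef3 (transform_coeffs (a t) (b t) (c t) (d t) (e t) u)) has_real_derivative
      coef3 (first_order_part A B u + second_order_part C D E)) (at 0)"
    unfolding transform_coeffs_def coef_simps
    by (auto intro!: derivative_eq_intros der nz simp: assms first_order_part_def second_order_part_def algebra_simps)
  ultimately have "((\<lambda>t. let w = transform_coeffs (a t) (b t) (c t) (d t) (e t) u in (coef0 w, coef1 w, coef2 w, coef3 w))
     has_vector_derivative (let w = first_order_part A B u + second_order_part C D E in (coef0 w, coef1 w, coef2 w, coef3 w))) (at 0)"
    unfolding has_real_derivative_iff_has_vector_derivative Let_def
    by (intro has_vector_derivative_Pair)
  then show ?thesis by (simp add: Let_def coef_defs)
qed

section \<open>Velocities of lifted flows\<close>

abbreviation jointly_smooth ::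
  "real set \<Rightarrow> (real^2) set \<Rightarrow> (real \<Rightarrow> real^2 \<Rightarrow> 'b::real_normed_vector) \<Rightarrow> bool" where
  "jointly_smooth I V F \<equiv> smooth_on (I \<times> V) (\<lambda>x. F (fst x) (snd x))"

lemma jointly_smooth_slice:
  assumes "open I" "open V" "jointly_smooth I V F" "t \<in> I"
  shows "smooth_on V (F t)"
proof -
  have "smooth_on V (\<lambda>q. (\<lambda>x. F (fst x) (snd x)) (t, q))"
    by (rule smooth_on_compose[where T="I \<times> V"])
      (use assms in \<open>auto intro!: open_Times smooth_on_Pair smooth_on_const smooth_on_ident\<close>)
  then show ?thesis by simp
qed

lemma slice_partial:
  assumes "open I" "open V" "jointly_smooth I V F" "t \<in> I" "q \<in> V"
  shows "dirderiv (0, axis i 1) (\<lambda>x. F (fst x) (snd x)) (t, q) = partial i (F t) q"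
proof -
  have F: "(\<lambda>x. F (fst x) (snd x)) differentiable at (t, q)"
    using assms by (intro smooth_on_differentiable[OF assms(3)]) (auto intro: open_Times)
  have P: "((\<lambda>q. (t, q)) has_derivative (\<lambda>v. (0, v))) (at q)"
    by (auto intro!: derivative_eq_intros)
  have "partial i (F t) q = dirderiv (axis i 1) (\<lambda>q. (\<lambda>x. F (fst x) (snd x)) (t, q)) q"
    by (simp add: partial_def)
  also have "\<dots> = frechet_derivative (\<lambda>x. F (fst x) (snd x)) (at (t, q)) (dirderiv (axis i 1) (\<lambda>q. (t, q)) q)"
    by (rule dirderiv_compose[where g="\<lambda>q. (t, q)" and f="\<lambda>x. F (fst x) (snd x)", OF F]) (use P differentiable_def in blast)
  also have "dirderiv (axis i 1) (\<lambda>q. (t, q)) q = (0, axis i 1)"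
    by (rule frechet_derivative_eqI[OF P])
  finally show ?thesis by simp
qed

lemma jointly_smooth_partial:
  assumes "open I" "open V" "jointly_smooth I V F"
  shows "jointly_smooth I V (\<lambda>t. partial i (F t))"
proof -
  have "smooth_on (I \<times> V) (dirderiv (0, axis i 1) (\<lambda>x. F (fst x) (snd x)))"
    using assms(3) by (rule smooth_on_dirderiv)
  moreover have "dirderiv (0, axis i 1) (\<lambda>x. F (fst x) (snd x)) x = partial i (F (fst x)) (snd x)"
    if "x \<in> I \<times> V" for x
    using slice_partial[OF assms, of "fst x" "snd x"] that by auto
  ultimately show ?thesis
    by (rule iffD1[OF smooth_on_cong[OF open_Times[OF assms(1,2)]], rotated])
qed

lemma slice_time_derivative:
  assumes "open I" "open V" "jointly_smooth I V F" "t \<in> I" "q \<in> V"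
  shows "((\<lambda>s. F s q) has_vector_derivative dirderiv (1, 0) (\<lambda>x. F (fst x) (snd x)) (t, q)) (at t)"
proof -
  let ?G = "\<lambda>x. F (fst x) (snd x)"
  have G: "(?G has_derivative frechet_derivative ?G (at (t, q))) (at (t, q))"
    using assms by (intro smooth_on_has_derivative[OF assms(3)]) (auto intro: open_Times)
  have P: "((\<lambda>s. (s, q)) has_derivative (\<lambda>h. (h, 0))) (at t)"
    by (auto intro!: derivative_eq_intros)
  have "((\<lambda>s. F s q) has_derivative (\<lambda>h. frechet_derivative ?G (at (t, q)) (h, 0))) (at t)"
    using diff_chain_at[OF P G] by (simp add: o_def)
  moreover have "(\<lambda>h. frechet_derivative ?G (at (t, q)) (h, 0)) = (\<lambda>h. h *\<^sub>R frechet_derivative ?G (at (t, q)) (1, 0))"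
  proof
    fix h show "frechet_derivative ?G (at (t, q)) (h, 0) = h *\<^sub>R frechet_derivative ?G (at (t, q)) (1, 0)"
      using linear_cmul[OF has_derivative_linear[OF G], of h "(1, 0)"] by simp
  qed
  ultimately show ?thesis unfolding has_vector_derivative_def by (rule subst[rotated])
qed

text \<open>Interchanges the time derivative with a space derivative. Everything about flows below reduces to
  this, since the quantities involved are obtained from the flow map by space derivatives and algebra.\<close>

lemma time_derivative_of_partial:
  fixes F :: "real \<Rightarrow> real^2 \<Rightarrow> 'b::euclidean_space"
  assumes I: "open I" "open V" and F: "jointly_smooth I V F" and t: "t \<in> I" "q \<in> V"
    and h: "\<And>x. x \<in> V \<Longrightarrow> ((\<lambda>s. F s x) has_vector_derivative h x) (at t)"
  shows "((\<lambda>s. partial i (F s) q) has_vector_derivative partial i h q) (at t)"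
proof -
  let ?G = "\<lambda>x. F (fst x) (snd x)"
  have S: "open (I \<times> V)" "(t, q) \<in> I \<times> V" using assms by (auto intro: open_Times)
  have h_eq: "h x = dirderiv (1, 0) ?G (t, x)" if "x \<in> V" for x
    using vector_derivative_unique_at[OF h[OF that] slice_time_derivative[OF I F t(1) that]] .
  have sm: "jointly_smooth I V (\<lambda>s x. dirderiv (1, 0) ?G (s, x))"
    using smooth_on_dirderiv[OF F, of "(1, 0)"] by simp
  have "partial i h q = partial i (\<lambda>x. dirderiv (1, 0) ?G (t, x)) q"
    by (rule partial_cong_open[OF I(2) _ t(2)]) (rule h_eq)
  also have "\<dots> = dirderiv (0, axis i 1) (dirderiv (1, 0) ?G) (t, q)"
    using slice_partial[OF I sm t, of i] by simp
  also have "\<dots> = dirderiv (1, 0) (dirderiv (0, axis i 1) ?G) (t, q)"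
    by (rule dirderiv_commute[OF S(1) F S(2)])
  also have "\<dots> = dirderiv (1, 0) (\<lambda>x. partial i (F (fst x)) (snd x)) (t, q)"
    by (rule fun_cong[OF frechet_derivative_cong_open[OF S]]) (use slice_partial[OF I F] in auto)
  finally show ?thesis
    using slice_time_derivative[OF I jointly_smooth_partial[OF I F] t, of i] by simp
qed

definition lie_action :: "(real^2 \<Rightarrow> real^2) \<Rightarrow> (real^2 \<Rightarrow> fibre) \<Rightarrow> real^2 \<Rightarrow> fibre" where
  "lie_action X u q = first_order_part (partial 1 X q) (partial 2 X q) (u q)
     + second_order_part (partial 1 (partial 1 X) q) (partial 1 (partial 2 X) q) (partial 2 (partial 2 X) q)"

lemma
  assumes "local_flow X \<epsilon> U \<phi>"
  defines "I \<equiv> {-\<epsilon><..<\<epsilon>}"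
  shows flow_zero: "0 \<in> I" and flow_open: "open U" and flow_joint: "jointly_smooth I U \<phi>"
    and flow_pt: "\<And>t. t \<in> I \<Longrightarrow> point_transformation U (\<phi> t)"
    and flow_id: "\<And>q. q \<in> U \<Longrightarrow> \<phi> 0 q = q"
    and flow_velocity: "\<And>q. q \<in> U \<Longrightarrow> ((\<lambda>t. \<phi> t q) has_vector_derivative X q) (at 0)"
proof -
  have L: "\<epsilon> > 0" "open U" "smooth_on (I \<times> U) (\<lambda>(t, q). \<phi> t q)"
    "\<forall>t\<in>I. point_transformation U (\<phi> t)" "\<forall>q\<in>U. \<phi> 0 q = q"
    "\<forall>t\<in>I. \<forall>q\<in>U. ((\<lambda>s. \<phi> s q) has_vector_derivative X (\<phi> t q)) (at t)"
    using assms(1) unfolding local_flow_def I_def by blast+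
  show "0 \<in> I" "open U" "\<And>t. t \<in> I \<Longrightarrow> point_transformation U (\<phi> t)" "\<And>q. q \<in> U \<Longrightarrow> \<phi> 0 q = q"
    using L by (auto simp: I_def)
  then show "((\<lambda>t. \<phi> t q) has_vector_derivative X q) (at 0)" if "q \<in> U" for q
    using L(6) that by metis
  have "(\<lambda>(t, q). \<phi> t q) = (\<lambda>x. \<phi> (fst x) (snd x))" by auto
  then show "jointly_smooth I U \<phi>" using L(3) by simp
qed

lemma flow_smooth_field:
  assumes flow: "local_flow X \<epsilon> U \<phi>"
  shows "smooth_on U X"
proof -
  define I where "I = {-\<epsilon><..<\<epsilon>}"
  note flow' = flow_zero[OF flow] flow_open[OF flow] flow_joint[OF flow] flow_velocity[OF flow]
  note flow' = flow'[folded I_def]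
  have I: "open I" by (simp add: I_def)
  have "smooth_on U (\<lambda>x. dirderiv (1, 0) (\<lambda>x. \<phi> (fst x) (snd x)) (0, x))"
    using jointly_smooth_slice[OF I flow'(2), of "\<lambda>t x. dirderiv (1, 0) (\<lambda>x. \<phi> (fst x) (snd x)) (t, x)", OF _ flow'(1)]
      smooth_on_dirderiv[OF flow'(3), of "(1, 0)"] by simp
  moreover have "X x = dirderiv (1, 0) (\<lambda>x. \<phi> (fst x) (snd x)) (0, x)" if "x \<in> U" for x
    using vector_derivative_unique_at[OF flow'(4)[OF that] slice_time_derivative[OF I flow'(2,3,1) that]] .
  ultimately show ?thesis by (rule iffD2[OF smooth_on_cong[OF flow'(2)], rotated])
qed

text \<open>By Cramer's rule the first derivatives of the inverse maps at the moving point \<open>\<phi> t q\<close> are rational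
  in those of \<open>\<phi> t\<close> at the fixed point \<open>q\<close>, hence jointly smooth in time and space.\<close>

lemma flow_inverse_partials:
  assumes flow: "local_flow X \<epsilon> U \<phi>"
  defines "I \<equiv> {-\<epsilon><..<\<epsilon>}"
  obtains G where "\<And>j. jointly_smooth I U (G j)"
    and "\<And>t q j. t \<in> I \<Longrightarrow> q \<in> U \<Longrightarrow> partial j (inv_into U (\<phi> t)) (\<phi> t q) = G j t q"
    and "\<And>q j. q \<in> U \<Longrightarrow> G j 0 q = axis j 1"
    and "\<And>q j. q \<in> U \<Longrightarrow> ((\<lambda>t. G j t q) has_vector_derivative - partial j X q) (at 0)"
proof -
  note flow' = flow_zero[OF flow] flow_open[OF flow] flow_joint[OF flow] flow_pt[OF flow] flow_id[OF flow] flow_velocity[OF flow]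
  note flow' = flow'[folded I_def]
  have I: "open I" by (simp add: I_def)
  define M where "M j t q = partial j (\<phi> t) q" for j t q
  define J where "J t q = wedge (M 1 t q) (M 2 t q)" for t q
  define G :: "2 \<Rightarrow> real \<Rightarrow> real^2 \<Rightarrow> real^2" where
    "G j t q = inverse (J t q) *\<^sub>R (if j = 1 then vector [M 2 t q $ 2, - M 1 t q $ 2] else vector [- M 2 t q $ 1, M 1 t q $ 1])" for j t q
  have M_smooth: "jointly_smooth I U (M j)" for j
    unfolding M_def by (rule jointly_smooth_partial[OF I flow'(2,3)])
  have S: "open (I \<times> U)" by (intro open_Times I flow')
  have J_nz: "J t q \<noteq> 0" if "t \<in> I" "q \<in> U" for t q
    using pt_inverse_partials(1)[OF flow'(4)[OF that(1)] that(2)] by (simp add: J_def M_def)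
  have j12: "j = 1 \<or> j = 2" for j :: 2 using exhaust_2 by blast
  have G_smooth: "jointly_smooth I U (G j)" for j
    using j12[of j] J_nz
    by (auto simp: G_def J_def intro!: smooth_on_scaleR smooth_on_inverse smooth_on_vector2 smooth_on_diff
        smooth_on_mult smooth_on_nth smooth_on_minus S M_smooth)
  have G_eq: "partial j (inv_into U (\<phi> t)) (\<phi> t q) = G j t q" if "t \<in> I" "q \<in> U" for t q j
    using pt_inverse_partials(2,3)[OF flow'(4)[OF that(1)] that(2)] j12[of j] by (auto simp: G_def J_def M_def)
  have M0: "M j 0 q = axis j 1" if "q \<in> U" for j q
  proof -
    have "M j 0 q = partial j (\<lambda>q. q) q"
      unfolding M_def by (rule partial_cong_open[OF flow'(2) flow'(5) that])
    then show ?thesis by (simp add: partial_def)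
  qed
  have M': "((\<lambda>t. M j t q) has_vector_derivative partial j X q) (at 0)" if "q \<in> U" for j q
    unfolding M_def by (rule time_derivative_of_partial[OF I flow'(2,3,1) that flow'(6)])
  have G0: "G j 0 q = axis j 1" if "q \<in> U" for j q
    using M0[OF that] j12[of j] by (auto simp: G_def J_def vec2_eq_iff)
  have G': "((\<lambda>t. G j t q) has_vector_derivative - partial j X q) (at 0)" if "q \<in> U" for j q
  proof -
    note m = M'[OF that, of 1, unfolded has_vector_derivative_vec2_iff] M'[OF that, of 2, unfolded has_vector_derivative_vec2_iff]
    have nz: "wedge (M 1 0 q) (M 2 0 q) \<noteq> 0" by (simp add: M0[OF that])
    from j12[of j] show ?thesis
    proof
      assume j: "j = 1"
      show ?thesis unfolding has_vector_derivative_vec2_iff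
        by (auto simp: G_def J_def j intro!: derivative_eq_intros m[THEN conjunct1] m[THEN conjunct2] nz)
          (auto simp: M0[OF that])
    next
      assume j: "j = 2"
      show ?thesis unfolding has_vector_derivative_vec2_iff
        by (auto simp: G_def J_def j intro!: derivative_eq_intros m[THEN conjunct1] m[THEN conjunct2] nz)
          (auto simp: M0[OF that])
    qed
  qed
  from that[OF G_smooth G_eq G0 G'] show thesis .
qed

lemma has_vector_derivative_scaleR':
  assumes "(f has_real_derivative f') (at t)" "(g has_vector_derivative g') (at t)"
  shows "((\<lambda>t. f t *\<^sub>R g t) has_vector_derivative f' *\<^sub>R g t + f t *\<^sub>R g') (at t)"
  using has_vector_derivative_scaleR[OF assms] by (simp add: add.commute)

lemma time_derivative_pullback:
  fixes F :: "real \<Rightarrow> real^2 \<Rightarrow> 'b::euclidean_space"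
  assumes I: "open I" "open V" and F: "jointly_smooth I V F" and t: "0 \<in> I" "q \<in> V"
    and h: "\<And>x. x \<in> V \<Longrightarrow> ((\<lambda>s. F s x) has_vector_derivative h x) (at 0)"
    and g: "(g has_vector_derivative g') (at 0)" "g 0 = axis j (1::real)"
  shows "((\<lambda>s. g s $ 1 *\<^sub>R partial 1 (F s) q + g s $ 2 *\<^sub>R partial 2 (F s) q) has_vector_derivative
     partial j h q + g' $ 1 *\<^sub>R partial 1 (F 0) q + g' $ 2 *\<^sub>R partial 2 (F 0) q) (at 0)"
proof -
  note gd = g(1)[unfolded has_vector_derivative_vec2_iff]
  have "((\<lambda>s. g s $ 1 *\<^sub>R partial 1 (F s) q + g s $ 2 *\<^sub>R partial 2 (F s) q) has_vector_derivative
     (g' $ 1 *\<^sub>R partial 1 (F 0) q + g 0 $ 1 *\<^sub>R partial 1 h q) + (g' $ 2 *\<^sub>R partial 2 (F 0) q + g 0 $ 2 *\<^sub>R partial 2 h q)) (at 0)"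
    using gd time_derivative_of_partial[OF I F t h, of 1] time_derivative_of_partial[OF I F t h, of 2]
    by (intro has_vector_derivative_add has_vector_derivative_scaleR') auto
  moreover have "j = 1 \<or> j = 2" using exhaust_2 by blast
  ultimately show ?thesis by (auto simp: g(2) algebra_simps)
qed

text \<open>The transformed section, evaluated at the moving point, is an explicit function of the first and second
  derivatives of the inverse map, of which the second are again obtained by pulling back the first.\<close>

lemma flow_action_on_section:
  assumes flow: "local_flow X \<epsilon> U \<phi>" and V: "open V" "V \<subseteq> U" "smooth_on V u"
  defines "I \<equiv> {-\<epsilon><..<\<epsilon>}"
  obtains H where "jointly_smooth I V H"
    and "\<And>t q. t \<in> I \<Longrightarrow> q \<in> V \<Longrightarrow> push_section U (\<phi> t) u (\<phi> t q) = H t q"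
    and "\<And>q. q \<in> V \<Longrightarrow> H 0 q = u q"
    and "\<And>q. q \<in> V \<Longrightarrow> ((\<lambda>t. H t q) has_vector_derivative lie_action X u q) (at 0)"
proof -
  note flow' = flow_zero[OF flow] flow_open[OF flow] flow_joint[OF flow] flow_pt[OF flow] flow_id[OF flow] flow_velocity[OF flow]
  note flow' = flow'[folded I_def]
  have I: "open I" by (simp add: I_def)
  obtain G where G: "\<And>j. jointly_smooth I U (G j)"
    "\<And>t q j. t \<in> I \<Longrightarrow> q \<in> U \<Longrightarrow> partial j (inv_into U (\<phi> t)) (\<phi> t q) = G j t q"
    "\<And>q j. q \<in> U \<Longrightarrow> G j 0 q = axis j 1"
    "\<And>q j. q \<in> U \<Longrightarrow> ((\<lambda>t. G j t q) has_vector_derivative - partial j X q) (at 0)"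
    apply (rule flow_inverse_partials[OF flow, folded I_def])
    subgoal premises prems by (rule prems(1)[OF prems(2-)])
    done
  define K where "K j k t q = G j t q $ 1 *\<^sub>R partial 1 (G k t) q + G j t q $ 2 *\<^sub>R partial 2 (G k t) q" for j k t q
  define H where "H t q = transform_coeffs (G 1 t q) (G 2 t q) (K 1 1 t q) (K 1 2 t q) (K 2 2 t q) (u q)" for t q
  have SU: "open (I \<times> U)" and SV: "open (I \<times> V)" by (intro open_Times I flow' V)+
  have K_smooth: "jointly_smooth I U (K j k)" for j k
    unfolding K_def
    by (intro smooth_on_add smooth_on_scaleR smooth_on_nth SU G(1) jointly_smooth_partial[OF I flow'(2)])
  have K_eq: "partial j (partial k (inv_into U (\<phi> t))) (\<phi> t q) = K j k t q" if "t \<in> I" "q \<in> U" for j k t q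
    unfolding K_def G(2)[OF that, symmetric]
  proof (rule pt_chain_partials[OF flow'(4)[OF that(1)] that(2) flow'(2) that(2) order_refl])
    show "G k t differentiable at q"
      by (rule smooth_on_differentiable[OF jointly_smooth_slice[OF I flow'(2) G(1) that(1)] flow'(2) that(2)])
    show "partial k (inv_into U (\<phi> t)) (\<phi> t x) = G k t x" if "x \<in> U" for x
      by (rule G(2)[OF \<open>t \<in> I\<close> that])
  qed
  have G_const: "partial l (G k 0) q = 0" if "q \<in> U" for k l q
  proof -
    have "partial l (G k 0) q = partial l (\<lambda>q. axis k 1) q"
      by (rule partial_cong_open[OF flow'(2) G(3) that])
    then show ?thesis by (simp add: partial_def)
  qed
  have K0: "K j k 0 q = 0" if "q \<in> U" for j k q by (simp add: K_def G_const[OF that])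
  have K': "((\<lambda>t. K j k t q) has_vector_derivative - partial j (partial k X) q) (at 0)" if "q \<in> U" for j k q
  proof -
    have X_smooth: "smooth_on U (partial k X)"
      by (rule smooth_on_partial[OF flow_smooth_field[OF flow]])
    have "partial j (\<lambda>x. - partial k X x) q = - partial j (partial k X) q"
      by (rule partial_linear_image[OF bounded_linear_minus[OF bounded_linear_ident] flow'(2) X_smooth that])
    then show ?thesis
      using time_derivative_pullback[where F="G k", OF I flow'(2) G(1) flow'(1) that G(4) G(4)[OF that] G(3)[OF that], of j]
      unfolding K_def by (simp add: G_const[OF that])
  qed
  have nz: "wedge (G 1 t q) (G 2 t q) \<noteq> 0" if "t \<in> I" "q \<in> U" for t q
  proof -
    let ?a = "partial 1 (\<phi> t) q" and ?b = "partial 2 (\<phi> t) q"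
    note p = pt_inverse_partials[OF flow'(4)[OF that(1)] that(2)]
    have "wedge (G 1 t q) (G 2 t q) = inverse (wedge ?a ?b) * inverse (wedge ?a ?b) * wedge ?a ?b"
      unfolding G(2)[OF that, symmetric] p(2,3) by (simp add: algebra_simps)
    then show ?thesis using p(1) by simp
  qed
  have "jointly_smooth I V H"
    unfolding H_def using V(2) nz
    by (intro smooth_on_transform_coeffs[OF SV] smooth_on_subset[OF G(1)] smooth_on_subset[OF K_smooth]
        smooth_on_compose[OF SV V(1,3)] smooth_on_snd[OF SV smooth_on_ident[OF SV]]) auto
  moreover have "push_section U (\<phi> t) u (\<phi> t q) = H t q" if "t \<in> I" "q \<in> V" for t q
  proof -
    have q: "q \<in> U" using that V by blast
    show ?thesis unfolding push_section_image[OF flow'(4)[OF that(1)] q] Let_def H_def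
      by (simp add: G(2)[OF that(1) q] K_eq[OF that(1) q])
  qed
  moreover have "H 0 q = u q" if "q \<in> V" for q
  proof -
    have q: "q \<in> U" using that V by blast
    show ?thesis by (simp add: H_def G(3)[OF q] K0[OF q] transform_coeffs_identity)
  qed
  moreover have "((\<lambda>t. H t q) has_vector_derivative lie_action X u q) (at 0)" if "q \<in> V" for q
  proof -
    have q: "q \<in> U" using that V by blast
    show ?thesis unfolding H_def lie_action_def
      by (intro transform_coeffs_derivative G(4) K' G(3) K0 q)
  qed
  ultimately show thesis by (rule that)
qed

text \<open>The correction term in the second formula arises because the derivative is taken in the
  coordinates at the moving point: the frame is transported by the inverse of the derivative of the
  flow.\<close>

lemma flow_jet_velocity:
  assumes flow: "local_flow X \<epsilon> U \<phi>" and V: "open V" "V \<subseteq> U" "smooth_on V u" and q: "q \<in> V"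
  shows "((\<lambda>t. push_section U (\<phi> t) u (\<phi> t q)) has_vector_derivative lie_action X u q) (at 0)"
    and "((\<lambda>t. partial j (push_section U (\<phi> t) u) (\<phi> t q)) has_vector_derivative
      partial j (lie_action X u) q - (partial j X q $ 1 *\<^sub>R partial 1 u q + partial j X q $ 2 *\<^sub>R partial 2 u q)) (at 0)"
proof -
  define I where "I = {-\<epsilon><..<\<epsilon>}"
  note flow' = flow_zero[OF flow] flow_open[OF flow] flow_joint[OF flow] flow_pt[OF flow] flow_id[OF flow] flow_velocity[OF flow]
  note flow' = flow'[folded I_def]
  have I: "open I" by (simp add: I_def)
  have qU: "q \<in> U" using q V by blast
  obtain G where G: "\<And>j. jointly_smooth I U (G j)"
    "\<And>t q j. t \<in> I \<Longrightarrow> q \<in> U \<Longrightarrow> partial j (inv_into U (\<phi> t)) (\<phi> t q) = G j t q"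
    "\<And>q j. q \<in> U \<Longrightarrow> G j 0 q = axis j 1"
    "\<And>q j. q \<in> U \<Longrightarrow> ((\<lambda>t. G j t q) has_vector_derivative - partial j X q) (at 0)"
    apply (rule flow_inverse_partials[OF flow, folded I_def])
    subgoal premises prems by (rule prems(1)[OF prems(2-)])
    done
  obtain H where H: "jointly_smooth I V H"
    "\<And>t q. t \<in> I \<Longrightarrow> q \<in> V \<Longrightarrow> push_section U (\<phi> t) u (\<phi> t q) = H t q"
    "\<And>q. q \<in> V \<Longrightarrow> H 0 q = u q"
    "\<And>q. q \<in> V \<Longrightarrow> ((\<lambda>t. H t q) has_vector_derivative lie_action X u q) (at 0)"
    apply (rule flow_action_on_section[OF flow V, folded I_def])
    subgoal premises prems by (rule prems(1)[OF prems(2-)])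
    done
  show "((\<lambda>t. push_section U (\<phi> t) u (\<phi> t q)) has_vector_derivative lie_action X u q) (at 0)"
    by (rule has_vector_derivative_transform_within_open[OF H(4)[OF q] I flow'(1)]) (simp add: H(2) q)
  have "((\<lambda>t. G j t q $ 1 *\<^sub>R partial 1 (H t) q + G j t q $ 2 *\<^sub>R partial 2 (H t) q) has_vector_derivative
      partial j (lie_action X u) q + (- partial j X q) $ 1 *\<^sub>R partial 1 (H 0) q + (- partial j X q) $ 2 *\<^sub>R partial 2 (H 0) q) (at 0)"
    by (rule time_derivative_pullback[OF I V(1) H(1) flow'(1) q H(4) G(4)[OF qU] G(3)[OF qU]])
  moreover have "partial i (H 0) q = partial i u q" for i
    by (rule partial_cong_open[OF V(1) H(3) q])
  ultimately have "((\<lambda>t. G j t q $ 1 *\<^sub>R partial 1 (H t) q + G j t q $ 2 *\<^sub>R partial 2 (H t) q) has_vector_derivative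
      partial j (lie_action X u) q - (partial j X q $ 1 *\<^sub>R partial 1 u q + partial j X q $ 2 *\<^sub>R partial 2 u q)) (at 0)"
    by (simp add: algebra_simps)
  then show "((\<lambda>t. partial j (push_section U (\<phi> t) u) (\<phi> t q)) has_vector_derivative
      partial j (lie_action X u) q - (partial j X q $ 1 *\<^sub>R partial 1 u q + partial j X q $ 2 *\<^sub>R partial 2 u q)) (at 0)"
  proof (rule has_vector_derivative_transform_within_open[OF _ I flow'(1)])
    fix t assume t: "t \<in> I"
    show "G j t q $ 1 *\<^sub>R partial 1 (H t) q + G j t q $ 2 *\<^sub>R partial 2 (H t) q = partial j (push_section U (\<phi> t) u) (\<phi> t q)"
      unfolding G(2)[OF t qU, symmetric]
      by (rule pt_chain_partials[symmetric, OF flow'(4)[OF t] qU V(1) q V(2)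
            smooth_on_differentiable[OF jointly_smooth_slice[OF I V(1) H(1) t] V(1) q] H(2)[OF t]])
  qed
qed

section \<open>Vector fields with prescribed jet and explicit flow\<close>

text \<open>The inverse function theorem gives an inverse \<open>\<psi>\<close> with derivative \<open>N v (\<psi> y)\<close>, where \<open>N v\<close> is smooth by
  Cramer's rule. So differentiability of \<open>\<psi>\<close> of any order bootstraps.\<close>

lemma smooth_local_inverse:
  fixes \<kappa> :: "real^2 \<Rightarrow> real^2"
  assumes W: "open W" "p \<in> W" and \<kappa>: "smooth_on W \<kappa>"
    and nz: "\<And>q. q \<in> W \<Longrightarrow> wedge (partial 1 \<kappa> q) (partial 2 \<kappa> q) \<noteq> 0"
  obtains U V \<psi> where "open U" "p \<in> U" "U \<subseteq> W" "open V" "\<kappa> ` U = V"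
    "\<And>q. q \<in> U \<Longrightarrow> \<psi> (\<kappa> q) = q" "\<And>z. z \<in> V \<Longrightarrow> \<psi> z \<in> U" "\<And>z. z \<in> V \<Longrightarrow> \<kappa> (\<psi> z) = z" "smooth_on V \<psi>"
proof -
  define N where "N v q = inverse (wedge (partial 1 \<kappa> q) (partial 2 \<kappa> q)) *\<^sub>R
      (vector [wedge v (partial 2 \<kappa> q), wedge (partial 1 \<kappa> q) v] :: real^2)" for v q
  have d\<kappa>: "(\<kappa> has_derivative frechet_derivative \<kappa> (at q)) (at q)" if "q \<in> W" for q
    by (rule smooth_on_has_derivative[OF \<kappa> W(1) that])
  have D_eq: "frechet_derivative \<kappa> (at q) w = w $ 1 *\<^sub>R partial 1 \<kappa> q + w $ 2 *\<^sub>R partial 2 \<kappa> q" if "q \<in> W" for q w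
    by (rule dirderiv_eq_partials) (rule smooth_on_differentiable[OF \<kappa> W(1) that])
  have N_D: "N (frechet_derivative \<kappa> (at q) w) q = w" if "q \<in> W" for q w
    using nz[OF that] unfolding N_def D_eq[OF that]
    by (simp add: vec2_eq_iff inverse_eq_divide divide_eq_eq) (simp add: algebra_simps)
  have D_N: "frechet_derivative \<kappa> (at q) (N v q) = v" if "q \<in> W" for q v
    using nz[OF that] unfolding N_def D_eq[OF that]
    by (simp add: vec2_eq_iff inverse_eq_divide add_divide_distrib[symmetric] divide_eq_eq) (simp add: algebra_simps)
  have N_lin: "bounded_linear (\<lambda>v. N v q)" for q
    unfolding N_def linear_conv_bounded_linear[symmetric]
    by (rule linearI) (simp_all add: vec2_eq_iff algebra_simps)
  define f' where "f' q = Blinfun (frechet_derivative \<kappa> (at q))" for q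
  have f': "blinfun_apply (f' q) = frechet_derivative \<kappa> (at q)" if "q \<in> W" for q
    unfolding f'_def by (rule bounded_linear_Blinfun_apply[OF has_derivative_bounded_linear[OF d\<kappa>[OF that]]])
  have cont: "continuous_on W f'"
  proof (rule continuous_on_blinfun_componentwise)
    fix i :: "real^2"
    show "continuous_on W (\<lambda>x. blinfun_apply (f' x) i)"
      using smooth_on_continuous_on[OF smooth_on_dirderiv[OF \<kappa>, of i]] by (simp add: f' cong: continuous_on_cong)
  qed
  have inv: "Blinfun (\<lambda>v. N v p) o\<^sub>L f' p = id_blinfun"
    by (rule blinfun_eqI) (simp add: bounded_linear_Blinfun_apply[OF N_lin] f'[OF W(2)] N_D[OF W(2)])
  have derf: "(\<kappa> has_derivative blinfun_apply (f' q)) (at q)" if "q \<in> W" for q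
    using d\<kappa>[OF that] by (simp add: f'[OF that])
  obtain U V \<psi> \<psi>' where IFT: "open U" "U \<subseteq> W" "p \<in> U" "open V" "\<kappa> p \<in> V" "homeomorphism U V \<kappa> \<psi>"
    "\<And>y. y \<in> V \<Longrightarrow> (\<psi> has_derivative (\<psi>' y)) (at y)"
    "\<And>y. y \<in> V \<Longrightarrow> \<psi>' y = inv (blinfun_apply (f' (\<psi> y)))"
    "\<And>y. y \<in> V \<Longrightarrow> bij (blinfun_apply (f' (\<psi> y)))"
    apply (rule inverse_function_theorem[OF W(1) derf cont W(2) inv])
     apply assumption
    subgoal premises prems by (rule prems(1)[OF prems(2-)])
    done
  have hom: "\<kappa> ` U = V" "\<And>q. q \<in> U \<Longrightarrow> \<psi> (\<kappa> q) = q" "\<And>z. z \<in> V \<Longrightarrow> \<psi> z \<in> U" "\<And>z. z \<in> V \<Longrightarrow> \<kappa> (\<psi> z) = z"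
    "continuous_on V \<psi>"
    using IFT(6) unfolding homeomorphism_def by auto
  have \<psi>': "(\<psi> has_derivative (\<lambda>v. N v (\<psi> y))) (at y)" if y: "y \<in> V" for y
  proof -
    have W': "\<psi> y \<in> W" using hom(3)[OF y] IFT(2) by blast
    have "\<psi>' y = (\<lambda>v. N v (\<psi> y))"
    proof
      fix v
      have "blinfun_apply (f' (\<psi> y)) (N v (\<psi> y)) = v" using D_N[OF W'] by (simp add: f'[OF W'])
      then show "\<psi>' y v = N v (\<psi> y)"
        unfolding IFT(8)[OF y] using IFT(9)[OF y] by (metis bij_inv_eq_iff)
    qed
    then show ?thesis using IFT(7)[OF y] by simp
  qed
  have N_smooth: "smooth_on W (N v)" for v
    unfolding N_def using nz
    by (intro smooth_on_scaleR smooth_on_inverse smooth_on_vector2 smooth_on_diff smooth_on_mult smooth_on_nth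
        smooth_on_const smooth_on_partial \<kappa> W)
  have "Ck_on k V \<psi>" for k
  proof (induction k)
    case 0 then show ?case using hom(5) by simp
  next
    case (Suc k)
    show ?case
    proof (rule Ck_on_SucI[OF IFT(4) \<psi>'])
      show "Ck_on k V (\<lambda>x. N v (\<psi> x))" for v
        by (rule Ck_on_compose[OF IFT(4) W(1) _ Suc])
          (use N_smooth hom(3) IFT(2) in \<open>auto simp: smooth_on_def\<close>)
    qed
  qed
  then have "smooth_on V \<psi>" by (simp add: smooth_on_def)
  from that[OF IFT(1,3,2,4) hom(1-4) this] show thesis .
qed

text \<open>In the chart \<open>\<kappa>\<close> the field is the first coordinate field, whose flow is a translation.\<close>

lemma local_flow_from_chart:
  fixes \<kappa> \<psi> :: "real^2 \<Rightarrow> real^2"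
  assumes U: "open U" "p \<in> U" and V: "open V" "\<kappa> ` U = V" and \<kappa>: "smooth_on U \<kappa>" and \<psi>: "smooth_on V \<psi>"
    and inv: "\<And>q. q \<in> U \<Longrightarrow> \<psi> (\<kappa> q) = q" "\<And>z. z \<in> V \<Longrightarrow> \<psi> z \<in> U" "\<And>z. z \<in> V \<Longrightarrow> \<kappa> (\<psi> z) = z"
  obtains \<epsilon> U' \<phi> where "p \<in> U'" "local_flow (\<lambda>q. frechet_derivative \<psi> (at (\<kappa> q)) (axis 1 1)) \<epsilon> U' \<phi>"
proof -
  define e1 :: "real^2" where "e1 = axis 1 1"
  have "\<kappa> p \<in> V" using U V by blast
  then obtain r where r: "r > 0" "ball (\<kappa> p) r \<subseteq> V" using V(1) open_contains_ball by blast
  define e where "e = r / 2"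
  define B where "B = ball (\<kappa> p) e"
  define U' where "U' = U \<inter> \<kappa> -` B"
  define \<phi> where "\<phi> t q = \<psi> (\<kappa> q + t *\<^sub>R e1)" for t q
  define I where "I = {-e<..<e}"
  have e: "e > 0" using r by (simp add: e_def)
  have in_V: "z + t *\<^sub>R e1 \<in> V" if "z \<in> B" "t \<in> I" for z t
  proof -
    have "dist (\<kappa> p) (z + t *\<^sub>R e1) \<le> dist (\<kappa> p) z + dist z (z + t *\<^sub>R e1)" by (rule dist_triangle)
    also have "\<dots> < e + e"
      using that by (intro add_strict_mono) (auto simp: B_def I_def dist_norm e1_def)
    finally show ?thesis using r(2) by (auto simp: e_def)
  qed
  have BV: "B \<subseteq> V" using in_V[of _ 0] e by (auto simp: I_def)
  have cont: "continuous_on U \<kappa>" by (rule smooth_on_continuous_on[OF \<kappa>])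
  have U'_open: "open U'"
    using iffD1[OF continuous_on_open_vimage[OF U(1)] cont, rule_format, of B]
    by (simp add: U'_def B_def Int_commute)
  have U'U: "U' \<subseteq> U" by (auto simp: U'_def)
  have pU': "p \<in> U'" using U e by (simp add: U'_def B_def)
  have \<kappa>U': "\<kappa> q \<in> B" if "q \<in> U'" for q using that by (simp add: U'_def)
  have smooth_image: "smooth_on (I \<times> U') (\<lambda>(t, q). \<phi> t q)"
  proof -
    have S: "open (I \<times> U')" using U'_open by (auto simp: I_def intro: open_Times)
    have "smooth_on (I \<times> U') (\<lambda>x. \<psi> (\<kappa> (snd x) + fst x *\<^sub>R e1))"
    proof (rule smooth_on_compose[OF S V(1) \<psi>])
      show "smooth_on (I \<times> U') (\<lambda>x. \<kappa> (snd x) + fst x *\<^sub>R e1)"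
        by (intro smooth_on_add[OF S] smooth_on_scaleR[OF S] smooth_on_const smooth_on_fst[OF S smooth_on_ident[OF S]]
            smooth_on_compose[OF S U(1) \<kappa>] smooth_on_snd[OF S smooth_on_ident[OF S]]) (use U'U in auto)
    qed (use in_V \<kappa>U' in auto)
    then show ?thesis by (simp add: \<phi>_def case_prod_unfold)
  qed
  have pt: "point_transformation U' (\<phi> t)" if t: "t \<in> I" for t
  proof -
    have inj: "inj_on (\<phi> t) U'"
    proof (rule inj_onI)
      fix q q' assume q: "q \<in> U'" "q' \<in> U'" "\<phi> t q = \<phi> t q'"
      have k: "\<kappa> (\<phi> t x) = \<kappa> x + t *\<^sub>R e1" if "x \<in> U'" for x
        unfolding \<phi>_def by (rule inv(3)[OF in_V[OF \<kappa>U'[OF that] t]])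
      have "\<kappa> q = \<kappa> q'" using k[OF q(1)] k[OF q(2)] unfolding q(3) by (metis add_right_cancel)
      then show "q = q'" using inv(1)[of q] inv(1)[of q'] q(1,2) U'U by auto
    qed
    have img: "\<phi> t ` U' = U \<inter> (\<lambda>z. \<kappa> z - t *\<^sub>R e1) -` B"
    proof (intro set_eqI iffI)
      fix z assume "z \<in> \<phi> t ` U'"
      then obtain q where q: "q \<in> U'" "z = \<psi> (\<kappa> q + t *\<^sub>R e1)" by (auto simp: \<phi>_def)
      have "\<kappa> q + t *\<^sub>R e1 \<in> V" by (rule in_V[OF \<kappa>U'[OF q(1)] t])
      then show "z \<in> U \<inter> (\<lambda>z. \<kappa> z - t *\<^sub>R e1) -` B" using q inv(2,3) \<kappa>U'[OF q(1)] by simp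
    next
      fix z assume z: "z \<in> U \<inter> (\<lambda>z. \<kappa> z - t *\<^sub>R e1) -` B"
      then have B: "\<kappa> z - t *\<^sub>R e1 \<in> B" by simp
      have "\<psi> (\<kappa> z - t *\<^sub>R e1) \<in> U'" using inv(2,3) BV B by (auto simp: U'_def)
      moreover have "\<phi> t (\<psi> (\<kappa> z - t *\<^sub>R e1)) = z" using inv(1)[of z] inv(3) BV B z by (auto simp: \<phi>_def)
      ultimately show "z \<in> \<phi> t ` U'" by force
    qed
    have open_img: "open (\<phi> t ` U')"
      unfolding img
      using iffD1[OF continuous_on_open_vimage[OF U(1)] continuous_on_diff[OF cont continuous_on_const], rule_format, of B "t *\<^sub>R e1"]
      by (simp add: B_def Int_commute)
    have smooth: "smooth_on U' (\<phi> t)"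
      unfolding \<phi>_def using in_V \<kappa>U' t
      by (intro smooth_on_compose[OF U'_open V(1) \<psi>] smooth_on_add smooth_on_const U'_open smooth_on_subset[OF \<kappa> U'U]) auto
    have "inv_into U' (\<phi> t) z = \<psi> (\<kappa> z - t *\<^sub>R e1)" if z: "z \<in> \<phi> t ` U'" for z
    proof -
      have B: "\<kappa> z - t *\<^sub>R e1 \<in> B" "z \<in> U" using z unfolding img by auto
      have "\<psi> (\<kappa> z - t *\<^sub>R e1) \<in> U'" using inv(2,3) BV B by (auto simp: U'_def)
      moreover have "\<phi> t (\<psi> (\<kappa> z - t *\<^sub>R e1)) = z" using inv(1)[of z] inv(3) BV B z by (auto simp: \<phi>_def)
      ultimately show ?thesis using inv_into_f_f[OF inj] by metis
    qed
    moreover have "smooth_on (\<phi> t ` U') (\<lambda>z. \<psi> (\<kappa> z - t *\<^sub>R e1))"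
      by (intro smooth_on_compose[OF open_img V(1) \<psi>] smooth_on_diff smooth_on_const open_img smooth_on_subset[OF \<kappa>])
        (use img BV in auto)
    ultimately have "smooth_on (\<phi> t ` U') (inv_into U' (\<phi> t))"
      by (rule iffD2[OF smooth_on_cong[OF open_img]])
    then show ?thesis
      unfolding point_transformation_def using U'_open open_img inj smooth by blast
  qed
  have vel: "((\<lambda>s. \<phi> s q) has_vector_derivative frechet_derivative \<psi> (at (\<kappa> (\<phi> t q))) e1) (at t)"
    if "t \<in> I" "q \<in> U'" for t q
  proof -
    have z: "\<kappa> q + t *\<^sub>R e1 \<in> V" by (rule in_V[OF \<kappa>U'[OF that(2)] that(1)])
    have "((\<lambda>s. \<kappa> q + s *\<^sub>R e1) has_vector_derivative e1) (at t)"
      by (auto intro!: derivative_eq_intros)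
    from vector_derivative_diff_chain_within[OF this has_derivative_at_withinI[OF smooth_on_has_derivative[OF \<psi> V(1) z]]]
    have "((\<lambda>s. \<phi> s q) has_vector_derivative frechet_derivative \<psi> (at (\<kappa> q + t *\<^sub>R e1)) e1) (at t)"
      by (simp add: \<phi>_def o_def)
    moreover have "\<kappa> (\<phi> t q) = \<kappa> q + t *\<^sub>R e1" using inv(3)[OF z] by (simp add: \<phi>_def)
    ultimately show ?thesis by simp
  qed
  have "local_flow (\<lambda>q. frechet_derivative \<psi> (at (\<kappa> q)) e1) e U' \<phi>"
    unfolding local_flow_def I_def[symmetric]
    by (intro conjI ballI e U'_open smooth_image pt vel) (use inv(1) U'U in \<open>auto simp: \<phi>_def\<close>)
  from that[OF pU' this[unfolded e1_def]] show thesis .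
qed

lemma smooth_near_nonvanishing:
  fixes s :: "real^2 \<Rightarrow> real"
  assumes "open S" "p \<in> S" "smooth_on S s" "s p \<noteq> 0"
  obtains W where "open W" "p \<in> W" "W \<subseteq> S" "\<And>q. q \<in> W \<Longrightarrow> s q \<noteq> 0"
proof
  let ?W = "s -` (- {0}) \<inter> S"
  show "open ?W"
    using iffD1[OF continuous_on_open_vimage[OF assms(1)] smooth_on_continuous_on[OF assms(3)], rule_format, of "- {0}"]
      open_Compl[OF closed_singleton] by blast
qed (use assms in auto)

text \<open>Straightening to finite order. Scale \<open>Z\<close> so that it differentiates the affine function \<open>\<tau>\<close> to 1, and
  let \<open>L\<close> be the derivation along the scaled field. The Lie series
  \<open>T F = \<tau> F - \<tau>\<^sup>2/2 L F + \<tau>\<^sup>3/6 L\<^sup>2 F - \<tau>\<^sup>4/24 L\<^sup>3 F\<close> is a primitive of \<open>F\<close> along \<open>L\<close>, up to an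
  error divisible by \<open>\<tau>\<^sup>4\<close>, because the sum telescopes. Applied to the reciprocal \<open>a\<close> of
  the scaling factor it gives a coordinate that \<open>Z\<close> differentiates to 1, and \<open>y - T (L y)\<close> is a
  coordinate that \<open>Z\<close> annihilates, in both cases up to that error.\<close>

lemma straightening_functions:
  fixes Z :: "real^2 \<Rightarrow> real^2"
  assumes "smooth_near p Z" "Z p \<noteq> 0"
  obtains W \<kappa> \<tau> \<tau>' E where "open W" "p \<in> W" "smooth_on W Z" "smooth_on W \<kappa>"
    "wedge (partial 1 \<kappa> p) (partial 2 \<kappa> p) \<noteq> 0"
    "\<And>x. (\<tau> has_derivative \<tau>') (at x)" "\<tau> p = 0" "smooth_on W E"
    "\<And>q. q \<in> W \<Longrightarrow> frechet_derivative \<kappa> (at q) (Z q) = axis 1 1 + (\<tau> q ^ 4) *\<^sub>R E q"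
proof -
  define c where "c = Z p"
  define c' :: "real^2" where "c' = vector [- c $ 2, c $ 1]"
  define \<tau> where "\<tau> q = c \<bullet> (q - p)" for q
  define y where "y q = c' \<bullet> (q - p)" for q
  define s where "s q = c \<bullet> Z q" for q
  define a where "a q = inverse (s q)" for q
  obtain S where S: "open S" "p \<in> S" "smooth_on S Z" using assms(1) unfolding smooth_near_def by blast
  have "s p \<noteq> 0" using assms(2) by (simp add: s_def c_def)
  moreover have "smooth_on S s"
    unfolding s_def by (rule smooth_on_linear_image[OF bounded_linear_inner_right S(1,3)])
  ultimately obtain W where W: "open W" "p \<in> W" "W \<subseteq> S" "\<And>q. q \<in> W \<Longrightarrow> s q \<noteq> 0"
    using smooth_near_nonvanishing[OF S(1,2)] by metis
  have Z: "smooth_on W Z" by (rule smooth_on_subset[OF S(3) W(3)])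
  have s_smooth: "smooth_on W s"
    unfolding s_def by (rule smooth_on_linear_image[OF bounded_linear_inner_right W(1) Z])
  have a_smooth: "smooth_on W a"
    unfolding a_def by (rule smooth_on_inverse[OF W(1) s_smooth W(4)])
  have sa: "s q * a q = 1" if "q \<in> W" for q using W(4)[OF that] by (simp add: a_def)
  \<comment> \<open>The derivation along \<open>Z / s\<close>, for which \<open>\<tau>\<close> is a time function.\<close>
  define L where "L F q = a q * frechet_derivative F (at q) (Z q)" for F :: "real^2 \<Rightarrow> real" and q
  have L_smooth: "smooth_on W (L F)" if "smooth_on W F" for F
    unfolding L_def by (intro smooth_on_mult W a_smooth smooth_on_derivative_along that Z)
  have D_L: "frechet_derivative F (at q) (Z q) = s q * L F q" if "q \<in> W" for F q
    using sa[OF that] by (simp add: L_def)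
  define T where "T F q = \<tau> q * F q - \<tau> q^2 / 2 * L F q + \<tau> q^3 / 6 * L (L F) q - \<tau> q^4 / 24 * L (L (L F)) q"
    for F q
  have \<tau>': "(\<tau> has_derivative (\<lambda>v. c \<bullet> v)) (at q)" for q
    unfolding \<tau>_def by (auto intro!: derivative_eq_intros)
  have y': "(y has_derivative (\<lambda>v. c' \<bullet> v)) (at q)" for q
    unfolding y_def by (auto intro!: derivative_eq_intros)
  have \<tau>_smooth: "smooth_on W \<tau>"
    by (rule smooth_onI_derivative[OF W(1) \<tau>']) (rule smooth_on_const)
  have y_smooth: "smooth_on W y"
    by (rule smooth_onI_derivative[OF W(1) y']) (rule smooth_on_const)
  have T_smooth: "smooth_on W (T F)" if "smooth_on W F" for F
    unfolding T_def by (intro smooth_on_add smooth_on_diff smooth_on_mult smooth_on_divide smooth_on_power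
        smooth_on_const W \<tau>_smooth L_smooth that) auto
  have T_der: "(T F has_derivative (\<lambda>v.
      (c \<bullet> v) * (F q - \<tau> q * L F q + \<tau> q^2 / 2 * L (L F) q - \<tau> q^3 / 6 * L (L (L F)) q)
      + \<tau> q * frechet_derivative F (at q) v - \<tau> q^2 / 2 * frechet_derivative (L F) (at q) v
      + \<tau> q^3 / 6 * frechet_derivative (L (L F)) (at q) v
      - \<tau> q^4 / 24 * frechet_derivative (L (L (L F))) (at q) v)) (at q)" if "smooth_on W F" "q \<in> W" for F q
  proof -
    note d = smooth_on_has_derivative[OF _ W(1) that(2)]
    note d0 = d[OF that(1)] and d1 = d[OF L_smooth[OF that(1)]] and d2 = d[OF L_smooth[OF L_smooth[OF that(1)]]]
      and d3 = d[OF L_smooth[OF L_smooth[OF L_smooth[OF that(1)]]]]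
    show ?thesis
      unfolding T_def
      by (auto intro!: derivative_eq_intros \<tau>' d0 d1 d2 d3 simp: fun_eq_iff) (simp add: field_simps power_numeral_reduce)
  qed
  have T_along: "frechet_derivative (T F) (at q) (Z q) = s q * (F q - \<tau> q^4 / 24 * L (L (L (L F))) q)"
    if "smooth_on W F" "q \<in> W" for F q
    unfolding frechet_derivative_eqI[OF T_der[OF that]] unfolding D_L[OF that(2)] s_def[symmetric]
    by (simp add: field_simps power_numeral_reduce)
  have T_at_p: "frechet_derivative (T F) (at p) v = (c \<bullet> v) * F p" if "smooth_on W F" for F v
    unfolding frechet_derivative_eqI[OF T_der[OF that W(2)]] by (simp add: \<tau>_def)
  define k1 where "k1 = T a"
  define k2 where "k2 q = y q - T (L y) q" for q
  define \<kappa> :: "real^2 \<Rightarrow> real^2" where "\<kappa> q = vector [k1 q, k2 q]" for q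
  define E :: "real^2 \<Rightarrow> real^2" where
    "E q = vector [- (s q / 24 * L (L (L (L a))) q), s q / 24 * L (L (L (L (L y)))) q]" for q
  have k_smooth: "smooth_on W k1" "smooth_on W k2"
    unfolding k1_def k2_def by (intro T_smooth a_smooth smooth_on_diff W y_smooth L_smooth)+
  have \<kappa>_smooth: "smooth_on W \<kappa>" unfolding \<kappa>_def by (intro smooth_on_vector2 W k_smooth)
  have E_smooth: "smooth_on W E"
    unfolding E_def by (intro smooth_on_vector2 smooth_on_minus smooth_on_mult smooth_on_divide W s_smooth
        L_smooth a_smooth y_smooth smooth_on_const) auto
  have k2_der: "frechet_derivative k2 (at q) v = c' \<bullet> v - frechet_derivative (T (L y)) (at q) v" if "q \<in> W" for q v
    unfolding k2_def
    by (rule frechet_derivative_eqI) (intro has_derivative_diff y' smooth_on_has_derivative[OF T_smooth[OF L_smooth[OF y_smooth]] W(1) that])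
  have \<kappa>_der: "frechet_derivative \<kappa> (at q) v = vector [frechet_derivative k1 (at q) v, frechet_derivative k2 (at q) v]"
    if "q \<in> W" for q v
  proof -
    note d = smooth_on_differentiable[OF \<kappa>_smooth W(1) that]
    have "frechet_derivative \<kappa> (at q) v $ i = frechet_derivative (\<lambda>x. \<kappa> x $ i) (at q) v" for i
      by (rule dirderiv_linear_image[OF bounded_linear_vec_nth d, symmetric])
    then show ?thesis by (simp add: vec2_eq_iff \<kappa>_def)
  qed
  have along: "frechet_derivative \<kappa> (at q) (Z q) = axis 1 1 + (\<tau> q ^ 4) *\<^sub>R E q" if q: "q \<in> W" for q
  proof -
    have 1: "frechet_derivative k1 (at q) (Z q) = 1 - \<tau> q^4 * (s q / 24 * L (L (L (L a))) q)"
      unfolding k1_def T_along[OF a_smooth q] using sa[OF q] by (simp add: algebra_simps)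
    have "c' \<bullet> Z q = s q * L y q"
      using D_L[OF q, of y] frechet_derivative_eqI[OF y'[of q], of "Z q"] by simp
    then have 2: "frechet_derivative k2 (at q) (Z q) = \<tau> q^4 * (s q / 24 * L (L (L (L (L y)))) q)"
      unfolding k2_der[OF q] T_along[OF L_smooth[OF y_smooth] q] by (simp add: algebra_simps)
    show ?thesis unfolding \<kappa>_der[OF q] 1 2 by (simp add: vec2_eq_iff E_def)
  qed
  have "wedge (partial 1 \<kappa> p) (partial 2 \<kappa> p) \<noteq> 0"
  proof -
    have "L y p = a p * (c' \<bullet> c)"
      unfolding L_def frechet_derivative_eqI[OF y'[of p]] by (simp add: c_def)
    then have Ly: "L y p = 0" by (simp add: c'_def inner_vec_def sum_2)
    have "frechet_derivative k2 (at p) v = c' \<bullet> v" for v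
      unfolding k2_der[OF W(2)] T_at_p[OF L_smooth[OF y_smooth]] Ly by simp
    moreover have "frechet_derivative k1 (at p) v = (c \<bullet> v) * a p" for v
      unfolding k1_def T_at_p[OF a_smooth] ..
    ultimately have p: "partial i \<kappa> p = vector [(c \<bullet> axis i 1) * a p, c' \<bullet> axis i 1]" for i
      unfolding partial_def \<kappa>_der[OF W(2)] by simp
    have "wedge (partial 1 \<kappa> p) (partial 2 \<kappa> p) = a p * (c $ 1 * c $ 1 + c $ 2 * c $ 2)"
      unfolding p by (simp add: inner_axis c'_def algebra_simps)
    also have "c $ 1 * c $ 1 + c $ 2 * c $ 2 = s p" by (simp add: s_def c_def inner_vec_def sum_2)
    finally show ?thesis using sa[OF W(2)] by (simp add: mult.commute)
  qed
  from that[OF W(1,2) Z \<kappa>_smooth this \<tau>' _ E_smooth along] show thesis by (simp add: \<tau>_def)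
qed

text \<open>The field whose coordinates in the chart \<open>\<kappa>\<close> are exactly \<open>(1, 0)\<close> has an explicit flow, and it differs
  from \<open>Z\<close> by a multiple of \<open>\<tau>\<^sup>4\<close>. The jets of order 3 are all that the isotropy
  spaces of 1-jets and 2-jets of sections involve.\<close>

lemma vector_field_with_jet_and_flow:
  fixes Z :: "real^2 \<Rightarrow> real^2"
  assumes "smooth_near p Z" "Z p \<noteq> 0"
  obtains X \<epsilon> U \<phi> where "smooth_near p X" "jet 3 X p = jet 3 Z p" "p \<in> U" "local_flow X \<epsilon> U \<phi>"
proof -
  obtain W \<kappa> \<tau> \<tau>' E where W: "open W" "p \<in> W" "smooth_on W Z" and \<kappa>: "smooth_on W \<kappa>"
    and nz: "wedge (partial 1 \<kappa> p) (partial 2 \<kappa> p) \<noteq> 0"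
    and \<tau>: "\<And>x. (\<tau> has_derivative \<tau>') (at x)" "\<tau> p = 0" and E: "smooth_on W E"
    and along: "\<And>q. q \<in> W \<Longrightarrow> frechet_derivative \<kappa> (at q) (Z q) = axis 1 1 + (\<tau> q ^ 4) *\<^sub>R E q"
    apply (rule straightening_functions[OF assms])
    subgoal premises prems by (rule prems(1)[OF prems(2-)])
    done
  have "smooth_on W (\<lambda>q. wedge (partial 1 \<kappa> q) (partial 2 \<kappa> q))"
    by (intro smooth_on_diff smooth_on_mult smooth_on_nth smooth_on_partial W \<kappa>)
  from smooth_near_nonvanishing[OF W(1,2) this nz]
  obtain W' where W': "open W'" "p \<in> W'" "W' \<subseteq> W" "\<And>q. q \<in> W' \<Longrightarrow> wedge (partial 1 \<kappa> q) (partial 2 \<kappa> q) \<noteq> 0"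
    by blast
  obtain U V \<psi> where U: "open U" "p \<in> U" "U \<subseteq> W'" and V: "open V" "\<kappa> ` U = V"
    and inv: "\<And>q. q \<in> U \<Longrightarrow> \<psi> (\<kappa> q) = q" "\<And>z. z \<in> V \<Longrightarrow> \<psi> z \<in> U" "\<And>z. z \<in> V \<Longrightarrow> \<kappa> (\<psi> z) = z"
    and \<psi>: "smooth_on V \<psi>"
    apply (rule smooth_local_inverse[OF W'(1,2) smooth_on_subset[OF \<kappa> W'(3)] W'(4)])
     apply assumption
    subgoal premises prems by (rule prems(1)[OF prems(2-)])
    done
  have UW: "U \<subseteq> W" using U W' by blast
  have \<kappa>U: "smooth_on U \<kappa>" by (rule smooth_on_subset[OF \<kappa> UW])
  define X where "X q = frechet_derivative \<psi> (at (\<kappa> q)) (axis 1 1)" for q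
  have \<psi>\<kappa>: "smooth_on U (\<lambda>q. dirderiv v \<psi> (\<kappa> q))" for v
    by (rule smooth_on_compose[OF U(1) V(1) smooth_on_dirderiv[OF \<psi>] \<kappa>U]) (use V in auto)
  have X: "smooth_on U X" unfolding X_def by (rule \<psi>\<kappa>)
  define R where "R q = frechet_derivative \<psi> (at (\<kappa> q)) (E q)" for q
  have R: "smooth_on U R"
  proof -
    have "R q = E q $ 1 *\<^sub>R partial 1 \<psi> (\<kappa> q) + E q $ 2 *\<^sub>R partial 2 \<psi> (\<kappa> q)" if "q \<in> U" for q
      unfolding R_def using V that by (intro dirderiv_eq_partials smooth_on_differentiable[OF \<psi> V(1)]) auto
    moreover have "smooth_on U (\<lambda>q. E q $ 1 *\<^sub>R partial 1 \<psi> (\<kappa> q) + E q $ 2 *\<^sub>R partial 2 \<psi> (\<kappa> q))"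
      using \<psi>\<kappa> unfolding partial_eq_dirderiv
      by (intro smooth_on_add smooth_on_scaleR smooth_on_nth smooth_on_subset[OF E UW] U(1))
    ultimately show ?thesis by (rule iffD2[OF smooth_on_cong[OF U(1)]])
  qed
  have "X q - Z q = (\<tau> q ^ Suc 3) *\<^sub>R (- R q)" if q: "q \<in> U" for q
  proof -
    have qW: "q \<in> W" and kV: "\<kappa> q \<in> V" using q UW V by auto
    have d\<psi>: "\<psi> differentiable at (\<kappa> q)" by (rule smooth_on_differentiable[OF \<psi> V(1) kV])
    have d\<kappa>: "\<kappa> differentiable at q" by (rule smooth_on_differentiable[OF \<kappa> W(1) qW])
    have "Z q = dirderiv (Z q) (\<lambda>x. x) q" by simp
    also have "\<dots> = dirderiv (Z q) (\<lambda>x. \<psi> (\<kappa> x)) q"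
      using frechet_derivative_cong_open[OF U(1) q, of "\<lambda>x. \<psi> (\<kappa> x)" "\<lambda>x. x"] inv(1) by simp
    also have "\<dots> = frechet_derivative \<psi> (at (\<kappa> q)) (axis 1 1 + (\<tau> q ^ 4) *\<^sub>R E q)"
      unfolding dirderiv_compose[OF d\<psi> d\<kappa>] along[OF qW] ..
    also have "\<dots> = X q + (\<tau> q ^ 4) *\<^sub>R R q"
      using linear_frechet_derivative[OF d\<psi>] by (simp add: linear_add linear_cmul X_def R_def)
    finally have "Z q = X q + (\<tau> q ^ 4) *\<^sub>R R q" .
    then show ?thesis by simp
  qed
  then have "flat 3 p (\<lambda>q. X q - Z q) \<longleftrightarrow> flat 3 p (\<lambda>q. (\<tau> q ^ Suc 3) *\<^sub>R (- R q))"
    by (rule flat_cong[OF U(1,2)])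
  moreover have "flat 3 p (\<lambda>q. (\<tau> q ^ Suc 3) *\<^sub>R (- R q))"
    by (rule flat_affine_power[OF U(1,2) \<tau> smooth_on_minus[OF U(1) R]])
  ultimately have jet: "jet 3 X p = jet 3 Z p"
    using jet_eq_iff_flat_diff[OF U(1,2) X smooth_on_subset[OF W(3) UW]] by blast
  obtain \<epsilon> U' \<phi> where fl: "p \<in> U'" "local_flow (\<lambda>q. frechet_derivative \<psi> (at (\<kappa> q)) (axis 1 1)) \<epsilon> U' \<phi>"
    by (rule local_flow_from_chart[OF U(1,2) V \<kappa>U \<psi> inv])
  have "smooth_near p X" unfolding smooth_near_def using U X by blast
  from that[OF this jet fl(1)] fl(2) show thesis by (simp add: X_def[abs_def])
qed

section \<open>Jets of polynomials\<close>

definition monomial_at :: "real^2 \<Rightarrow> nat \<Rightarrow> nat \<Rightarrow> real^2 \<Rightarrow> real" where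
  "monomial_at p i j q = ((q $ 1 - p $ 1) ^ i / fact i) * ((q $ 2 - p $ 2) ^ j / fact j)"

lemma partial_monomial:
  "partial 1 (\<lambda>q. monomial_at p i j q *\<^sub>R c) = (\<lambda>q. if i = 0 then 0 else monomial_at p (i - 1) j q *\<^sub>R c)"
  "partial 2 (\<lambda>q. monomial_at p i j q *\<^sub>R c) = (\<lambda>q. if j = 0 then 0 else monomial_at p i (j - 1) q *\<^sub>R c)"
proof -
  have pow: "((\<lambda>q::real^2. (q $ m - p $ m) ^ i / fact i) has_derivative
      (\<lambda>v. if i = 0 then 0 else v $ m * ((q $ m - p $ m) ^ (i - 1) / fact (i - 1)))) (at q)" for i m q
  proof (cases i)
    case (Suc n)
    have "((\<lambda>x. (x - p $ m) ^ Suc n) has_real_derivative real (Suc n) * (q $ m - p $ m) ^ n) (at (q $ m))"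
      by (rule DERIV_cong[OF DERIV_power[OF DERIV_diff[OF DERIV_ident DERIV_const]]]) simp
    from DERIV_cdivide[OF this, of "fact (Suc n)"]
    have "((\<lambda>x. (x - p $ m) ^ Suc n / fact (Suc n)) has_real_derivative (q $ m - p $ m) ^ n / fact n) (at (q $ m))"
      by (simp add: field_simps del: of_nat_Suc)
    from DERIV_compose_FDERIV[OF this bounded_linear_imp_has_derivative[OF bounded_linear_vec_nth]]
    show ?thesis using Suc by simp
  qed simp
  show "partial 1 (\<lambda>q. monomial_at p i j q *\<^sub>R c) = (\<lambda>q. if i = 0 then 0 else monomial_at p (i - 1) j q *\<^sub>R c)"
    unfolding partial_def monomial_at_def
    by (intro ext, subst frechet_derivative_eqI[OF has_derivative_scaleR[OF has_derivative_mult[OF pow pow] has_derivative_const]]) simp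
  show "partial 2 (\<lambda>q. monomial_at p i j q *\<^sub>R c) = (\<lambda>q. if j = 0 then 0 else monomial_at p i (j - 1) q *\<^sub>R c)"
    unfolding partial_def monomial_at_def
    by (intro ext, subst frechet_derivative_eqI[OF has_derivative_scaleR[OF has_derivative_mult[OF pow pow] has_derivative_const]]) simp
qed

lemma funpow_partial_zero: "(partial i ^^ n) (\<lambda>q. 0::'b::real_normed_vector) = (\<lambda>q. 0)"
  by (induction n) (auto simp: partial_def)

lemma funpow_partial_monomial:
  "(partial 1 ^^ a) (\<lambda>q. monomial_at p i j q *\<^sub>R c) = (\<lambda>q. if i < a then 0 else monomial_at p (i - a) j q *\<^sub>R c)"
  "(partial 2 ^^ b) (\<lambda>q. monomial_at p i j q *\<^sub>R c) = (\<lambda>q. if j < b then 0 else monomial_at p i (j - b) q *\<^sub>R c)"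
proof -
  show "(partial 1 ^^ a) (\<lambda>q. monomial_at p i j q *\<^sub>R c) = (\<lambda>q. if i < a then 0 else monomial_at p (i - a) j q *\<^sub>R c)"
  proof (induction a arbitrary: i)
    case (Suc a)
    then show ?case
      by (cases i) (auto simp: funpow_swap1 partial_monomial(1) funpow_partial_zero funpow_Suc_right o_def
          simp del: funpow.simps(2))
  qed simp
  show "(partial 2 ^^ b) (\<lambda>q. monomial_at p i j q *\<^sub>R c) = (\<lambda>q. if j < b then 0 else monomial_at p i (j - b) q *\<^sub>R c)"
  proof (induction b arbitrary: j)
    case (Suc b)
    then show ?case
      by (cases j) (auto simp: funpow_swap1 partial_monomial(2) funpow_partial_zero funpow_Suc_right o_def
          simp del: funpow.simps(2))
  qed simp
qed

lemma jet_monomial: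
  assumes "i + j \<le> k"
  shows "jet k (\<lambda>q. monomial_at p i j q *\<^sub>R c) p = (\<lambda>m. if m = (i, j) then c else 0)"
proof -
  have "(partial 1 ^^ a) ((partial 2 ^^ b) (\<lambda>q. monomial_at p i j q *\<^sub>R c)) p = (if a = i \<and> b = j then c else 0)" for a b
  proof (cases "j < b")
    case False
    then have "(partial 1 ^^ a) ((partial 2 ^^ b) (\<lambda>q. monomial_at p i j q *\<^sub>R c)) p =
      (if i < a then 0 else monomial_at p (i - a) (j - b) p *\<^sub>R c)"
      by (simp add: funpow_partial_monomial)
    also have "\<dots> = (if a = i \<and> b = j then c else 0)"
      using False by (auto simp: monomial_at_def power_0_left)
    finally show ?thesis .
  qed (simp add: funpow_partial_monomial funpow_partial_zero)
  then show ?thesis using assms by (auto simp: jet_def fun_eq_iff)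
qed

lemma jet_sum:
  assumes "open S" "p \<in> S" "\<And>a. a \<in> A \<Longrightarrow> smooth_on S (f a)"
  shows "jet k (\<lambda>x. \<Sum>a\<in>A. f a x) p = (\<Sum>a\<in>A. jet k (f a) p)"
  using assms(3)
proof (induction A rule: infinite_finite_induct)
  case (insert a A)
  have "smooth_on S (\<lambda>x. \<Sum>a\<in>A. f a x)" using insert.prems by (intro smooth_on_sum[OF assms(1)]) auto
  then show ?case using insert jet_add[OF assms(1,2), of "f a" "\<lambda>x. \<Sum>a\<in>A. f a x"] by simp
qed (simp_all add: jet_zero)

lemma smooth_on_monomial: "open S \<Longrightarrow> smooth_on S (\<lambda>q. monomial_at p i j q *\<^sub>R c)"
  unfolding monomial_at_def
  by (intro smooth_on_scaleR smooth_on_mult smooth_on_divide smooth_on_power smooth_on_diff smooth_on_nth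
      smooth_on_ident smooth_on_const) auto

lemma jet_realizable:
  fixes \<xi> :: "'b::real_normed_vector jet"
  assumes "\<And>i j. \<not> i + j \<le> k \<Longrightarrow> \<xi> (i, j) = 0"
  obtains h where "smooth_near p h" "jet k h p = \<xi>"
proof
  let ?A = "{m. fst m + snd m \<le> k}"
  let ?h = "\<lambda>q. \<Sum>m\<in>?A. monomial_at p (fst m) (snd m) q *\<^sub>R \<xi> m"
  have fin: "finite ?A"
    by (rule finite_subset[of _ "{..k} \<times> {..k}"]) auto
  show "smooth_near p ?h"
    unfolding smooth_near_def by (intro exI[of _ UNIV]) (auto intro!: smooth_on_sum smooth_on_monomial)
  have "jet k ?h p = (\<Sum>m\<in>?A. jet k (\<lambda>q. monomial_at p (fst m) (snd m) q *\<^sub>R \<xi> m) p)"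
    by (rule jet_sum[of UNIV]) (auto intro: smooth_on_monomial)
  also have "\<dots> = (\<Sum>m\<in>?A. (\<lambda>n. if n = m then \<xi> m else 0))"
    by (intro sum.cong refl) (simp add: jet_monomial)
  also have "\<dots> = \<xi>"
  proof
    fix n
    have "(\<Sum>m\<in>?A. (\<lambda>n. if n = m then \<xi> m else 0)) n = (\<Sum>m\<in>?A. if n = m then \<xi> m else 0)"
      using fin by (induction rule: finite_induct) auto
    also have "\<dots> = \<xi> n" using fin assms[of "fst n" "snd n"] by (simp add: sum.delta)
    finally show "(\<Sum>m\<in>?A. (\<lambda>n. if n = m then \<xi> m else 0)) n = \<xi> n" .
  qed
  finally show "jet k ?h p = \<xi>" .
qed

section \<open>Isotropy spaces\<close>

lemma vf_jets_iff: "\<xi> \<in> vf_jets k p \<longleftrightarrow> (\<forall>i j. \<not> i + j \<le> k \<longrightarrow> \<xi> (i, j) = 0)"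
proof
  assume "\<xi> \<in> vf_jets k p" then show "\<forall>i j. \<not> i + j \<le> k \<longrightarrow> \<xi> (i, j) = 0"
    by (auto simp: vf_jets_def jet_def)
next
  assume "\<forall>i j. \<not> i + j \<le> k \<longrightarrow> \<xi> (i, j) = 0"
  then obtain h where "smooth_near p h" "jet k h p = \<xi>" by (meson jet_realizable)
  then show "\<xi> \<in> vf_jets k p" by (auto simp: vf_jets_def)
qed

lemma has_velocity_unique:
  assumes "has_velocity c v" "has_velocity c w"
  shows "v = w"
proof -
  have "fst v = fst w" using assms vector_derivative_unique_at unfolding has_velocity_def by blast
  moreover have "snd v m = snd w m" for m
    using assms vector_derivative_unique_at unfolding has_velocity_def by blast
  ultimately show ?thesis by (auto simp: prod_eq_iff)
qed

definition jet_shift :: "nat \<Rightarrow> fibre jet \<Rightarrow> real^2 \<Rightarrow> fibre jet" where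
  "jet_shift k \<upsilon> w = (\<lambda>(i, j). if i + j \<le> k then w $ 1 *\<^sub>R \<upsilon> (Suc i, j) + w $ 2 *\<^sub>R \<upsilon> (i, Suc j) else 0)"

lemma prolong_velocity:
  assumes "smooth_near p u" "\<gamma> 0 = p" "(\<gamma> has_vector_derivative w) (at 0)"
  shows "has_velocity (\<lambda>t. prolong k u (\<gamma> t)) (w, jet_shift k (jet (k + 1) u p) w)"
proof -
  obtain S where S: "open S" "p \<in> S" "smooth_on S u" using assms(1) unfolding smooth_near_def by blast
  have "((\<lambda>t. jet k u (\<gamma> t) (i, j)) has_vector_derivative jet_shift k (jet (k + 1) u p) w (i, j)) (at 0)" for i j
  proof (cases "i + j \<le> k")
    case True
    let ?h = "(partial 1 ^^ i) ((partial 2 ^^ j) u)"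
    have h: "smooth_on S ?h" by (intro smooth_on_funpow_partial S)
    have "(?h has_derivative frechet_derivative ?h (at p)) (at (\<gamma> 0))"
      using smooth_on_has_derivative[OF h S(1,2)] assms(2) by simp
    from vector_derivative_diff_chain_within[OF assms(3) has_derivative_at_withinI[OF this]]
    have "((\<lambda>t. ?h (\<gamma> t)) has_vector_derivative frechet_derivative ?h (at p) w) (at 0)"
      by (simp add: o_def)
    moreover have "partial 2 ?h p = (partial 1 ^^ i) ((partial 2 ^^ Suc j) u) p"
      using funpow_partial_commute[OF S(1) smooth_on_funpow_partial[OF S(3)] S(2)] by simp
    then have "frechet_derivative ?h (at p) w = jet_shift k (jet (k + 1) u p) w (i, j)"
      using dirderiv_eq_partials[OF smooth_on_differentiable[OF h S(1,2)], of w] True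
      by (simp add: jet_shift_def jet_def)
    ultimately show ?thesis using True by (simp add: jet_def)
  next
    case False then show ?thesis by (simp add: jet_def jet_shift_def)
  qed
  then show ?thesis using assms(3) by (auto simp: has_velocity_def prolong_def)
qed

text \<open>A curve with any prescribed velocity \<open>w\<close> on the base lifts to the jets of the section, and by the chain
  rule the velocity of the lift involves the section only through its \<open>(k + 1)\<close>-jet.\<close>

lemma jet_plane_eq:
  assumes "smooth_near p u"
  shows "jet_plane k (p, jet (k + 1) u p) = {(w, jet_shift k (jet (k + 1) u p) w) | w. True}"
proof (intro set_eqI iffI)
  fix v assume "v \<in> jet_plane k (p, jet (k + 1) u p)"
  then obtain u' \<gamma> where u': "smooth_near p u'" "prolong (k + 1) u' p = (p, jet (k + 1) u p)" "\<gamma> 0 = p"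
    "has_velocity (\<lambda>t. prolong k u' (\<gamma> t)) v"
    unfolding jet_plane_def by auto
  have "(\<gamma> has_vector_derivative fst v) (at 0)"
    using u'(4) by (simp add: has_velocity_def prolong_def)
  from has_velocity_unique[OF u'(4) prolong_velocity[OF u'(1,3) this]]
  show "v \<in> {(w, jet_shift k (jet (k + 1) u p) w) | w. True}"
    using u'(2) by (auto simp: prolong_def prod_eq_iff)
next
  fix v assume "v \<in> {(w, jet_shift k (jet (k + 1) u p) w) | w. True}"
  then obtain w where v: "v = (w, jet_shift k (jet (k + 1) u p) w)" by blast
  have "((\<lambda>t. p + t *\<^sub>R w) has_vector_derivative w) (at 0)"
    by (auto intro!: derivative_eq_intros)
  from prolong_velocity[OF assms _ this, of k]
  have "has_velocity (\<lambda>t. prolong k u (p + t *\<^sub>R w)) v" by (simp add: v)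
  then show "v \<in> jet_plane k (p, jet (k + 1) u p)"
    unfolding jet_plane_def using assms
    by (intro CollectI exI[of _ u] exI[of _ "\<lambda>t. p + t *\<^sub>R w"]) (simp add: prolong_def)
qed

lemma bounded_bilinear_first_order_part:
  "bounded_bilinear (\<lambda>ab u. first_order_part (fst ab) (snd ab) u)"
  unfolding bilinear_conv_bounded_bilinear[symmetric] bilinear_def
  by (intro conjI allI linearI) (simp_all add: first_order_part_def fibre_eq_iff algebra_simps)

lemma bounded_linear_second_order_part:
  "bounded_linear (\<lambda>abc. second_order_part (fst abc) (fst (snd abc)) (snd (snd abc)))"
  unfolding linear_conv_bounded_linear[symmetric]
  by (intro linearI) (simp_all add: second_order_part_def fibre_eq_iff algebra_simps)

lemma partial_lie_action:
  assumes S: "open S" "q \<in> S" and X: "smooth_on S X" and u: "smooth_on S u"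
  shows "partial j (lie_action X u) q =
     first_order_part (partial j (partial 1 X) q) (partial j (partial 2 X) q) (u q)
   + first_order_part (partial 1 X q) (partial 2 X q) (partial j u q)
   + second_order_part (partial j (partial 1 (partial 1 X)) q) (partial j (partial 1 (partial 2 X)) q)
       (partial j (partial 2 (partial 2 X)) q)"
proof -
  have d: "(h has_derivative frechet_derivative h (at q)) (at q)" if "smooth_on S h" for h :: "real^2 \<Rightarrow> 'c::real_normed_vector"
    using smooth_on_has_derivative[OF that S] .
  have d1: "((\<lambda>q. (partial 1 X q, partial 2 X q)) has_derivative
      (\<lambda>v. (dirderiv v (partial 1 X) q, dirderiv v (partial 2 X) q))) (at q)"
    by (intro has_derivative_Pair d smooth_on_partial X)
  have d2: "((\<lambda>q. (partial 1 (partial 1 X) q, partial 1 (partial 2 X) q, partial 2 (partial 2 X) q)) has_derivative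
      (\<lambda>v. (dirderiv v (partial 1 (partial 1 X)) q, dirderiv v (partial 1 (partial 2 X)) q, dirderiv v (partial 2 (partial 2 X)) q))) (at q)"
    by (intro has_derivative_Pair d smooth_on_partial X)
  have "(lie_action X u has_derivative (\<lambda>v.
     (first_order_part (partial 1 X q) (partial 2 X q) (dirderiv v u q)
       + first_order_part (dirderiv v (partial 1 X) q) (dirderiv v (partial 2 X) q) (u q))
     + second_order_part (dirderiv v (partial 1 (partial 1 X)) q) (dirderiv v (partial 1 (partial 2 X)) q)
       (dirderiv v (partial 2 (partial 2 X)) q))) (at q)"
    unfolding lie_action_def[abs_def]
    using has_derivative_add[OF bounded_bilinear.FDERIV[OF bounded_bilinear_first_order_part d1 d[OF u]]
        bounded_linear.has_derivative[OF bounded_linear_second_order_part d2]] by simp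
  from frechet_derivative_eqI[OF this, of "axis j 1"] show ?thesis
    by (simp add: partial_def[of j] algebra_simps)
qed

lemma third_partials:
  fixes X :: "real^2 \<Rightarrow> 'b::euclidean_space"
  assumes S: "open S" "q \<in> S" and X: "smooth_on S X"
  shows "partial 2 (partial 1 X) q = partial 1 (partial 2 X) q"
    and "partial 2 (partial 1 (partial 1 X)) q = partial 1 (partial 1 (partial 2 X)) q"
    and "partial 2 (partial 1 (partial 2 X)) q = partial 1 (partial 2 (partial 2 X)) q"
proof -
  show "partial 2 (partial 1 X) q = partial 1 (partial 2 X) q"
    by (rule partial_commute[OF S(1) X S(2)])
  have "partial 2 (partial 1 (partial 1 X)) q = partial 1 (partial 2 (partial 1 X)) q"
    by (rule partial_commute[OF S(1) smooth_on_partial[OF X] S(2)])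
  also have "\<dots> = partial 1 (partial 1 (partial 2 X)) q"
    by (rule partial_cong_open[OF S(1) partial_commute[OF S(1) X] S(2)])
  finally show "partial 2 (partial 1 (partial 1 X)) q = partial 1 (partial 1 (partial 2 X)) q" .
  show "partial 2 (partial 1 (partial 2 X)) q = partial 1 (partial 2 (partial 2 X)) q"
    by (rule partial_commute[OF S(1) smooth_on_partial[OF X] S(2)])
qed

lemma jet_components:
  "k \<ge> 0 \<Longrightarrow> jet k h p (0,0) = h p"
  "k \<ge> 1 \<Longrightarrow> jet k h p (1,0) = partial 1 h p" "k \<ge> 1 \<Longrightarrow> jet k h p (0,1) = partial 2 h p"
  "k \<ge> 2 \<Longrightarrow> jet k h p (2,0) = partial 1 (partial 1 h) p" "k \<ge> 2 \<Longrightarrow> jet k h p (1,1) = partial 1 (partial 2 h) p"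
  "k \<ge> 2 \<Longrightarrow> jet k h p (0,2) = partial 2 (partial 2 h) p"
  "k \<ge> 3 \<Longrightarrow> jet k h p (3,0) = partial 1 (partial 1 (partial 1 h)) p"
  "k \<ge> 3 \<Longrightarrow> jet k h p (2,1) = partial 1 (partial 1 (partial 2 h)) p"
  "k \<ge> 3 \<Longrightarrow> jet k h p (1,2) = partial 1 (partial 2 (partial 2 h)) p"
  "k \<ge> 3 \<Longrightarrow> jet k h p (0,3) = partial 2 (partial 2 (partial 2 h)) p"
  by (simp_all add: jet_def numeral_2_eq_2 numeral_3_eq_3)

text \<open>Meaningful for \<open>k \<le> 1\<close>, where the listed positions are all that a \<open>k\<close>-jet has.\<close>

definition lift_component :: "nat \<Rightarrow> fibre jet \<Rightarrow> (real^2) jet \<Rightarrow> fibre jet" where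
  "lift_component k \<upsilon> \<xi> m =
    (if m = (0,0) then defect00 \<upsilon> \<xi> else if k = 1 \<and> m = (1,0) then defect10 \<upsilon> \<xi>
     else if k = 1 \<and> m = (0,1) then defect01 \<upsilon> \<xi> else 0) + jet_shift k \<upsilon> (\<xi> (0,0)) m"

text \<open>The velocity of the lifted flow, written as the tangent vector of the jet plane over the same base
  vector plus the defects. Tangency to the plane is thus the vanishing of the defects.\<close>

lemma lift_velocity:
  assumes flow: "local_flow X \<epsilon> U \<phi>" and p: "p \<in> U" and u: "smooth_near p u" and k: "k \<le> 1"
  shows "has_velocity (\<lambda>t. lift k U (\<phi> t) (p, jet k u p)) (X p, lift_component k (jet (k + 1) u p) (jet (k + 2) X p))"
proof -
  note [simp del] = One_nat_def
  define u' where "u' = jet_rep k p (jet k u p)"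
  have u': "smooth_near p u'" "jet k u' p = jet k u p"
    using jet_rep[OF u, of k] by (auto simp: u'_def)
  obtain S where S: "open S" "p \<in> S" "smooth_on S u'" using u'(1) unfolding smooth_near_def by blast
  define V where "V = S \<inter> U"
  have V: "open V" "V \<subseteq> U" "smooth_on V u'" and pV: "p \<in> V"
    using S p flow_open[OF flow] by (auto simp: V_def intro: smooth_on_subset)
  have X: "smooth_on V X" by (rule smooth_on_subset[OF flow_smooth_field[OF flow] V(2)])
  have lift: "lift k U (\<phi> t) (p, jet k u p) = (\<phi> t p, jet k (push_section U (\<phi> t) u') (\<phi> t p))" for t
    by (simp add: lift_def prolong_def u'_def)
  note vel = flow_jet_velocity[OF flow V pV]
  have u0: "u' p = u p" using fun_cong[OF u'(2), of "(0,0)"] by (simp add: jet_def)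
  let ?\<xi> = "jet (k + 2) X p" and ?\<upsilon> = "jet (k + 1) u p"
  have "((\<lambda>t. jet k (push_section U (\<phi> t) u') (\<phi> t p) m) has_vector_derivative lift_component k ?\<upsilon> ?\<xi> m) (at 0)" for m
  proof -
    consider "m = (0,0)" | "k = 1" "m = (1,0)" | "k = 1" "m = (0,1)" | "\<not> fst m + snd m \<le> k"
      using k by (cases m) (force simp: One_nat_def)
    then show ?thesis
    proof cases
      case 1
      have "lie_action X u' p = lift_component k ?\<upsilon> ?\<xi> m"
        by (simp add: 1 lift_component_def lie_action_def defect00_def jet_shift_def jet_components u0 flip: One_nat_def)
      then show ?thesis using vel(1) by (simp add: 1 jet_def)
    next
      case 2
      have "partial i u' p = partial i u p" for i
        using fun_cong[OF u'(2), of "(1,0)"] fun_cong[OF u'(2), of "(0,1)"] exhaust_2[of i]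
        by (auto simp: 2 jet_components)
      then have "partial 1 (lie_action X u') p - (partial 1 X p $ 1 *\<^sub>R partial 1 u' p + partial 1 X p $ 2 *\<^sub>R partial 2 u' p)
          = lift_component k ?\<upsilon> ?\<xi> m"
        unfolding partial_lie_action[OF V(1) pV X V(3)]
        by (simp add: 2 lift_component_def defect10_def jet_shift_def jet_components u0 flip: One_nat_def numeral_2_eq_2)
      moreover have "jet k (push_section U (\<phi> t) u') (\<phi> t p) m = partial 1 (push_section U (\<phi> t) u') (\<phi> t p)" for t
        by (simp add: 2 jet_components)
      ultimately show ?thesis using vel(2)[of 1] by simp
    next
      case 3
      have "partial i u' p = partial i u p" for i
        using fun_cong[OF u'(2), of "(1,0)"] fun_cong[OF u'(2), of "(0,1)"] exhaust_2[of i]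
        by (auto simp: 3 jet_components)
      then have "partial 2 (lie_action X u') p - (partial 2 X p $ 1 *\<^sub>R partial 1 u' p + partial 2 X p $ 2 *\<^sub>R partial 2 u' p)
          = lift_component k ?\<upsilon> ?\<xi> m"
        unfolding partial_lie_action[OF V(1) pV X V(3)] third_partials[OF V(1) pV X]
        by (simp add: 3 lift_component_def defect01_def jet_shift_def jet_components u0 flip: One_nat_def numeral_2_eq_2)
      moreover have "jet k (push_section U (\<phi> t) u') (\<phi> t p) m = partial 2 (push_section U (\<phi> t) u') (\<phi> t p)" for t
        by (simp add: 3 jet_components)
      ultimately show ?thesis using vel(2)[of 2] by simp
    next
      case 4
      then have "lift_component k ?\<upsilon> ?\<xi> m = 0" "jet k h q m = 0" for h :: "real^2 \<Rightarrow> fibre" and q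
        by (auto simp: lift_component_def jet_shift_def jet_def split: prod.split)
      then show ?thesis by simp
    qed
  qed
  then show ?thesis
    unfolding has_velocity_def lift using flow_velocity[OF flow p] by simp
qed

lemma jet_proj_prolong: "k \<le> l \<Longrightarrow> jet_proj k (p, jet l u p) = (p, jet k u p)"
  by (simp add: jet_proj_def jet_trunc_jet)

lemma isotropy_defect:
  assumes u: "smooth_near p u" and k: "k \<le> 1" and \<xi>: "\<xi> \<in> isotropy k (p, jet (k + 1) u p)"
  shows "defect00 (jet (k + 1) u p) \<xi> = 0"
    and "k = 1 \<Longrightarrow> defect10 (jet (k + 1) u p) \<xi> = 0" "k = 1 \<Longrightarrow> defect01 (jet (k + 1) u p) \<xi> = 0"
    and "\<xi> \<in> vf_jets (k + 2) p"
proof -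
  let ?\<upsilon> = "jet (k + 1) u p"
  obtain X v where X: "smooth_near p X" "\<xi> = jet (k + 2) X p" "v \<in> jet_plane k (p, ?\<upsilon>)" "has_lift k X (p, jet k u p) v"
    using \<xi> unfolding isotropy_def by (auto simp: jet_proj_prolong)
  obtain \<epsilon> U \<phi> where fl: "p \<in> U" "local_flow X \<epsilon> U \<phi>" "has_velocity (\<lambda>t. lift k U (\<phi> t) (p, jet k u p)) v"
    using X(4) unfolding has_lift_def by auto
  have v: "v = (X p, lift_component k ?\<upsilon> \<xi>)"
    using has_velocity_unique[OF fl(3) lift_velocity[OF fl(2,1) u k]] X(2) by simp
  obtain w where "v = (w, jet_shift k ?\<upsilon> w)" using X(3) jet_plane_eq[OF u, of k] by auto
  moreover have "X p = \<xi> (0,0)" by (simp add: X(2) jet_def)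
  ultimately have "lift_component k ?\<upsilon> \<xi> = jet_shift k ?\<upsilon> (\<xi> (0,0))" using v by auto
  then have "lift_component k ?\<upsilon> \<xi> m = jet_shift k ?\<upsilon> (\<xi> (0,0)) m" for m by simp
  from this[of "(0,0)"] this[of "(1,0)"] this[of "(0,1)"]
  show "defect00 ?\<upsilon> \<xi> = 0" "k = 1 \<Longrightarrow> defect10 ?\<upsilon> \<xi> = 0" "k = 1 \<Longrightarrow> defect01 ?\<upsilon> \<xi> = 0"
    by (auto simp: lift_component_def)
  show "\<xi> \<in> vf_jets (k + 2) p" using X by (auto simp: vf_jets_def)
qed

lemma zero_field_flow: "local_flow (\<lambda>_. 0) 1 UNIV (\<lambda>t q. q)"
proof -
  have "inv_into UNIV (\<lambda>q. q) = (\<lambda>q::real^2. q)" by (simp add: fun_eq_iff inv_into_f_f[where A=UNIV and f="\<lambda>q. q"])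
  moreover have S: "open ({-1<..<1::real} \<times> (UNIV :: (real^2) set))"
    by (intro open_Times) auto
  have "smooth_on ({-1<..<1} \<times> UNIV) (\<lambda>(t::real, q::real^2). q)"
    using smooth_on_snd[OF S smooth_on_ident[OF S]] by (simp only: case_prod_unfold)
  ultimately show ?thesis
    by (simp add: local_flow_def point_transformation_def smooth_on_ident)
qed

text \<open>The field realising the jet has to have a flow. For a non-zero value it is obtained by straightening, and
  the zero jet has the zero field. A horizontal subspace contains no other jets.\<close>

lemma isotropyI:
  assumes u: "smooth_near p u" and k: "k \<le> 1" and \<xi>: "\<xi> \<in> vf_jets (k + 2) p" "\<xi> (0,0) \<noteq> 0 \<or> \<xi> = 0"
    and d: "defect00 (jet (k + 1) u p) \<xi> = 0"
      "k = 1 \<Longrightarrow> defect10 (jet (k + 1) u p) \<xi> = 0" "k = 1 \<Longrightarrow> defect01 (jet (k + 1) u p) \<xi> = 0"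
  shows "\<xi> \<in> isotropy k (p, jet (k + 1) u p)"
proof -
  have "\<exists>X \<epsilon> U \<phi>. smooth_near p X \<and> jet (k + 2) X p = \<xi> \<and> p \<in> U \<and> local_flow X \<epsilon> U \<phi>"
    using \<xi>(2)
  proof
    assume "\<xi> = 0"
    then show ?thesis using zero_field_flow smooth_on_const[of UNIV "0 :: real^2"]
      by (intro exI[of _ "\<lambda>_. 0"] exI[of _ 1] exI[of _ UNIV] exI[of _ "\<lambda>t q. q"])
        (auto simp: jet_zero smooth_near_def intro: exI[of _ UNIV])
  next
    assume nz: "\<xi> (0,0) \<noteq> 0"
    obtain Z where Z: "smooth_near p Z" "\<xi> = jet (k + 2) Z p" using \<xi>(1) by (auto simp: vf_jets_def)
    have "Z p \<noteq> 0" using nz by (simp add: Z(2) jet_def)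
    then obtain X \<epsilon> U \<phi> where X: "smooth_near p X" "jet 3 X p = jet 3 Z p" "p \<in> U" "local_flow X \<epsilon> U \<phi>"
      by (rule vector_field_with_jet_and_flow[OF Z(1)])
    have "jet (k + 2) X p = \<xi>" using jet_mono_eq[OF X(2), of "k + 2"] k by (simp add: Z(2))
    then show ?thesis using X by blast
  qed
  then obtain X \<epsilon> U \<phi> where X: "smooth_near p X" "jet (k + 2) X p = \<xi>" "p \<in> U" "local_flow X \<epsilon> U \<phi>" by blast
  let ?\<upsilon> = "jet (k + 1) u p"
  have "lift_component k ?\<upsilon> \<xi> = jet_shift k ?\<upsilon> (\<xi> (0,0))"
    using d by (auto simp: lift_component_def fun_eq_iff)
  moreover have "X p = \<xi> (0,0)" by (simp add: X(2)[symmetric] jet_def)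
  ultimately have "(X p, lift_component k ?\<upsilon> \<xi>) \<in> jet_plane k (p, ?\<upsilon>)"
    using jet_plane_eq[OF u, of k] by auto
  moreover have "has_lift k X (p, jet k u p) (X p, lift_component k ?\<upsilon> \<xi>)"
    unfolding has_lift_def using X(3,4) lift_velocity[OF X(4,3) u k] X(2) by auto
  ultimately show ?thesis
    unfolding isotropy_def using X(1,2) by (auto simp: jet_proj_prolong)
qed

section \<open>Brackets of jets\<close>

definition transport :: "(real^2 \<Rightarrow> real^2) \<Rightarrow> (real^2 \<Rightarrow> 'b::real_normed_vector) \<Rightarrow> real^2 \<Rightarrow> 'b" where
  "transport X Y q = X q $ 1 *\<^sub>R partial 1 Y q + X q $ 2 *\<^sub>R partial 2 Y q"

lemma smooth_on_transport:
  "open S \<Longrightarrow> smooth_on S X \<Longrightarrow> smooth_on S Y \<Longrightarrow> smooth_on S (transport X Y)"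
  unfolding transport_def[abs_def] by (intro smooth_on_add smooth_on_scaleR smooth_on_nth smooth_on_partial)

lemma partial_transport:
  fixes Y :: "real^2 \<Rightarrow> 'b::euclidean_space"
  assumes S: "open S" and X: "smooth_on S X" and Y: "smooth_on S Y" and q: "q \<in> S"
  shows "partial l (transport X Y) q = transport (partial l X) Y q + transport X (partial l Y) q"
proof -
  note dX = smooth_on_has_derivative[OF X S q]
  note d1 = smooth_on_has_derivative[OF smooth_on_partial[OF Y] S q, of 1]
  note d2 = smooth_on_has_derivative[OF smooth_on_partial[OF Y] S q, of 2]
  have "(transport X Y has_derivative (\<lambda>v.
      (X q $ 1 *\<^sub>R dirderiv v (partial 1 Y) q + dirderiv v X q $ 1 *\<^sub>R partial 1 Y q)
      + (X q $ 2 *\<^sub>R dirderiv v (partial 2 Y) q + dirderiv v X q $ 2 *\<^sub>R partial 2 Y q))) (at q)"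
    unfolding transport_def[abs_def]
    by (intro has_derivative_add has_derivative_scaleR d1 d2 bounded_linear.has_derivative[OF bounded_linear_vec_nth dX])
  from frechet_derivative_eqI[OF this, of "axis l 1"]
  have "partial l (transport X Y) q =
      (X q $ 1 *\<^sub>R partial l (partial 1 Y) q + partial l X q $ 1 *\<^sub>R partial 1 Y q)
      + (X q $ 2 *\<^sub>R partial l (partial 2 Y) q + partial l X q $ 2 *\<^sub>R partial 2 Y q)"
    by (simp add: partial_def[of l])
  then show ?thesis
    unfolding partial_commute[OF S Y q, of l] by (simp add: transport_def)
qed

lemma jet_transport:
  fixes Y :: "real^2 \<Rightarrow> 'b::euclidean_space"
  assumes S: "open S" "p \<in> S" and X: "smooth_on S X" and Y: "smooth_on S Y" and ij: "i + j \<le> 2" "i + j < k"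
  shows "(partial 1 ^^ i) ((partial 2 ^^ j) (transport X Y)) p = advect (jet k X p) (jet k Y p) (i, j)"
proof -
  note [simp del] = One_nat_def
  note pt = partial_transport[OF S(1)]
  note sm = smooth_on_partial smooth_on_transport[OF S(1)] X Y
  have 2: "partial m (partial l (transport X Y)) p =
      (transport (partial m (partial l X)) Y p + transport (partial l X) (partial m Y) p)
      + (transport (partial m X) (partial l Y) p + transport X (partial m (partial l Y)) p)" for l m
  proof -
    have "partial m (partial l (transport X Y)) p = partial m (\<lambda>q. transport (partial l X) Y q + transport X (partial l Y) q) p"
      by (rule partial_cong_open[OF S(1) pt[OF X Y] S(2)])
    also have "\<dots> = partial m (transport (partial l X) Y) p + partial m (transport X (partial l Y)) p"
      by (intro partial_add[OF S(1) _ _ S(2)] sm)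
    finally show ?thesis
      by (simp add: pt[OF smooth_on_partial[OF X] Y S(2)] pt[OF X smooth_on_partial[OF Y] S(2)])
  qed
  note third = third_partials[OF S Y]
  have fp: "(partial l ^^ 1) h = partial l h" for l and h :: "real^2 \<Rightarrow> 'b"
    by (simp add: One_nat_def)
  consider "i = 0" "j = 0" | "i = 1" "j = 0" | "i = 0" "j = 1" | "i = 2" "j = 0" | "i = 1" "j = 1" | "i = 0" "j = 2"
    using ij(1) by linarith
  then show ?thesis
  proof cases
    case 1 then show ?thesis using ij by (simp add: advect_explicit jet_components transport_def)
  next
    case 2 then show ?thesis using ij pt[OF X Y S(2), of 1]
      by (simp add: fp advect_explicit jet_components third transport_def algebra_simps)
  next
    case 3 then show ?thesis using ij pt[OF X Y S(2), of 2]
      by (simp add: fp advect_explicit jet_components third transport_def algebra_simps)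
  next
    case 4 
    then have "(partial 1 ^^ i) ((partial 2 ^^ j) (transport X Y)) p = partial 1 (partial 1 (transport X Y)) p"
      by (simp add: numeral_2_eq_2)
    then show ?thesis using 4 ij 2[of 1 1]
      by (simp add: advect_explicit jet_components third transport_def scaleR_2 ac_simps)
  next
    case 5 then show ?thesis using ij 2[of 1 2]
      by (simp add: fp advect_explicit jet_components third transport_def algebra_simps)
  next
    case 6
    then have "(partial 1 ^^ i) ((partial 2 ^^ j) (transport X Y)) p = partial 2 (partial 2 (transport X Y)) p"
      by (simp add: numeral_2_eq_2)
    then show ?thesis using 6 ij 2[of 2 2]
      by (simp add: advect_explicit jet_components third transport_def scaleR_2 ac_simps)
  qed
qed

lemma lie_bracket_eq_transport:
  assumes "X differentiable (at q)" "Y differentiable (at q)"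
  shows "lie_bracket X Y q = transport X Y q - transport Y X q"
  unfolding lie_bracket_def transport_def dirderiv_eq_partials[OF assms(1)] dirderiv_eq_partials[OF assms(2)] ..

lemma smooth_on_lie_bracket:
  assumes "open S" "smooth_on S X" "smooth_on S Y"
  shows "smooth_on S (lie_bracket X Y)"
  unfolding lie_bracket_def[abs_def]
  by (intro smooth_on_diff smooth_on_derivative_along assms)

lemma jet_lie_bracket:
  assumes S: "open S" "p \<in> S" and X: "smooth_on S X" and Y: "smooth_on S Y" and kl: "k \<le> 2" "k < l"
  shows "jet k (lie_bracket X Y) p = (\<lambda>(i, j). if i + j \<le> k then bracket (jet l X p) (jet l Y p) (i, j) else 0)"
proof -
  have "jet k (lie_bracket X Y) p = jet k (\<lambda>q. transport X Y q - transport Y X q) p"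
    by (rule jet_cong_open[OF S]) (intro lie_bracket_eq_transport smooth_on_differentiable[OF _ S(1)] X Y)
  also have "\<dots> = jet k (transport X Y) p - jet k (transport Y X) p"
    by (rule jet_diff[OF S smooth_on_transport[OF S(1) X Y] smooth_on_transport[OF S(1) Y X]])
  finally have *: "jet k (lie_bracket X Y) p = jet k (transport X Y) p - jet k (transport Y X) p" .
  show ?thesis unfolding *
    using jet_transport[OF S X Y, of _ _ l] jet_transport[OF S Y X, of _ _ l] kl
    by (auto simp: fun_eq_iff jet_def bracket_def)
qed

lemma jet_bracket_eq:
  assumes "\<xi> \<in> vf_jets k p" "\<eta> \<in> vf_jets k p" "k \<le> 3" "k \<ge> 1"
  shows "jet_bracket k p \<xi> \<eta> = (\<lambda>(i, j). if i + j < k then bracket \<xi> \<eta> (i, j) else 0)"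
proof -
  let ?X = "jet_rep k p \<xi>" and ?Y = "jet_rep k p \<eta>"
  have r: "smooth_near p ?X" "jet k ?X p = \<xi>" "smooth_near p ?Y" "jet k ?Y p = \<eta>"
    using assms(1,2) jet_rep unfolding vf_jets_def by blast+
  obtain S where S: "open S" "p \<in> S" "smooth_on S ?X" "smooth_on S ?Y"
    using smooth_near_common[OF r(1,3)] .
  have "jet (k - 1) (lie_bracket ?X ?Y) p = (\<lambda>(i, j). if i + j \<le> k - 1 then bracket \<xi> \<eta> (i, j) else 0)"
    using jet_lie_bracket[OF S, of "k - 1" k] assms(3,4) unfolding r(2,4) by linarith
  moreover have "i + j \<le> k - 1 \<longleftrightarrow> i + j < k" for i j using assms(4) by linarith
  ultimately show ?thesis unfolding jet_bracket_def by simp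
qed

section \<open>The horizontal subspaces\<close>

text \<open>A linear surjection between spaces of the same finite dimension is injective. The argument
  uses a basis of \<open>H\<close>, because the surrounding space of functions is infinite-dimensional.\<close>

lemma inj_on_jet_value_horizontal:
  assumes "horizontal k p H"
  shows "inj_on jet_value H"
proof -
  have H: "subspace H" "dim H = 2" "jet_value ` H = UNIV" using assms by (auto simp: horizontal_def)
  obtain B where B: "B \<subseteq> H" "independent B" "H \<subseteq> span B" "card B = 2"
    using basis_exists[of H] H(2) by metis
  obtain b1 b2 where b: "B = {b1, b2}" using B(4) by (auto simp: card_2_iff)
  have rep: "\<exists>s t. \<xi> = s *\<^sub>R b1 + t *\<^sub>R b2" if "\<xi> \<in> H" for \<xi>
  proof -
    have "\<xi> \<in> span (insert b1 {b2})" using that B(3) b by auto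
    then obtain s where "\<xi> - s *\<^sub>R b1 \<in> span (insert b2 {})" unfolding span_breakdown_eq by blast
    then obtain t where "\<xi> - s *\<^sub>R b1 - t *\<^sub>R b2 \<in> span {}" unfolding span_breakdown_eq by blast
    then have "\<xi> = s *\<^sub>R b1 + t *\<^sub>R b2" by (simp add: algebra_simps)
    then show ?thesis by blast
  qed
  have val: "jet_value (s *\<^sub>R b1 + t *\<^sub>R b2) = s *\<^sub>R jet_value b1 + t *\<^sub>R jet_value b2" for s t
    by (simp add: jet_value_def scaleR_fun_def)
  have "\<exists>s t. v = s *\<^sub>R jet_value b1 + t *\<^sub>R jet_value b2" for v
  proof -
    obtain \<xi> where "\<xi> \<in> H" "v = jet_value \<xi>" using H(3) by blast
    then show ?thesis using rep val by metis
  qed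
  from this[of "axis 1 1"] this[of "axis 2 1"] obtain x1 x2 y1 y2 where
    xy: "axis 1 1 = x1 *\<^sub>R jet_value b1 + x2 *\<^sub>R jet_value b2" "axis 2 1 = y1 *\<^sub>R jet_value b1 + y2 *\<^sub>R jet_value b2" by blast
  have "wedge (axis 1 1) (axis 2 1) = (x1 * y2 - x2 * y1) * wedge (jet_value b1) (jet_value b2)"
    unfolding xy by (simp add: algebra_simps)
  then have nz: "wedge (jet_value b1) (jet_value b2) \<noteq> 0" by auto
  show ?thesis
  proof (rule inj_onI)
    fix \<xi> \<eta> assume *: "\<xi> \<in> H" "\<eta> \<in> H" "jet_value \<xi> = jet_value \<eta>"
    then have "\<xi> - \<eta> \<in> H" using H(1) subspace_diff by blast
    then obtain s t where st: "\<xi> - \<eta> = s *\<^sub>R b1 + t *\<^sub>R b2" using rep by blast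
    have "s *\<^sub>R jet_value b1 + t *\<^sub>R jet_value b2 = jet_value (\<xi> - \<eta>)" unfolding st val ..
    also have "\<dots> = 0" using *(3) by (simp add: jet_value_def)
    finally have e: "s * jet_value b1 $ 1 + t * jet_value b2 $ 1 = 0" "s * jet_value b1 $ 2 + t * jet_value b2 $ 2 = 0"
      by (simp_all add: vec2_eq_iff)
    have "s * wedge (jet_value b1) (jet_value b2) = 0" "t * wedge (jet_value b1) (jet_value b2) = 0"
      using e by algebra+
    then have "s = 0" "t = 0" using nz by auto
    then show "\<xi> = \<eta>" using st by simp
  qed
qed

lemma horizontal_lift_in:
  assumes "horizontal k p H"
  shows "horizontal_lift H v \<in> H" "jet_value (horizontal_lift H v) = v"
proof -
  have "v \<in> jet_value ` H" using assms by (simp add: horizontal_def)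
  then show "horizontal_lift H v \<in> H" "jet_value (horizontal_lift H v) = v"
    unfolding horizontal_lift_def by (auto simp: inv_into_into f_inv_into_f)
qed

lemma horizontal_range:
  assumes add: "\<And>v w. \<Lambda> (v + w) = \<Lambda> v + \<Lambda> w" and scale: "\<And>c v. \<Lambda> (c *\<^sub>R v) = c *\<^sub>R \<Lambda> v"
    and val: "\<And>v. jet_value (\<Lambda> v) = v" and sub: "\<And>v. \<Lambda> v \<in> vf_jets k p"
  shows "horizontal k p (range \<Lambda>)" "horizontal_lift (range \<Lambda>) v = \<Lambda> v"
proof -
  have lin: "linear \<Lambda>" by (rule linearI) (simp_all add: add scale)
  have inj: "inj \<Lambda>" using val by (metis injI)
  have "independent (\<Lambda> ` {axis 1 1, axis 2 1})"
  proof (rule linear_independent_injective_image[OF lin])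
    show "independent {axis 1 1, axis 2 1 :: real^2}"
      by (rule independent_mono[OF independent_Basis]) (auto simp: Basis_vec_def)
    show "inj_on \<Lambda> (span {axis 1 1, axis 2 1})" using inj by (rule inj_on_subset) simp
  qed
  moreover have "card (\<Lambda> ` {axis 1 1, axis 2 1}) = 2"
  proof -
    have "(axis 1 1 :: real^2) \<noteq> axis 2 1" by (simp add: vec2_eq_iff)
    then show ?thesis by (simp add: inj_eq[OF inj])
  qed
  moreover have "range \<Lambda> \<subseteq> span (\<Lambda> ` {axis 1 1, axis 2 1})"
  proof
    fix \<xi> assume "\<xi> \<in> range \<Lambda>"
    then obtain v where v: "\<xi> = \<Lambda> v" by blast
    have "\<Lambda> (v $ 1 *\<^sub>R axis 1 1 + v $ 2 *\<^sub>R axis 2 1) = \<Lambda> v"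
      by (rule arg_cong[of _ _ \<Lambda>]) (simp add: vec2_eq_iff)
    then have "\<xi> = v $ 1 *\<^sub>R \<Lambda> (axis 1 1) + v $ 2 *\<^sub>R \<Lambda> (axis 2 1)" unfolding v add scale by simp
    then show "\<xi> \<in> span (\<Lambda> ` {axis 1 1, axis 2 1})" by (simp add: span_add span_scale span_base)
  qed
  ultimately have "dim (range \<Lambda>) = 2"
    by (intro dim_unique[of "\<Lambda> ` {axis 1 1, axis 2 1}"]) auto
  moreover have "subspace (range \<Lambda>)" by (rule linear_subspace_image[OF lin subspace_UNIV])
  moreover have "jet_value ` range \<Lambda> = UNIV" by (simp add: image_image val)
  ultimately show "horizontal k p (range \<Lambda>)"
    unfolding horizontal_def using sub by blast
  have "jet_value (inv_into (range \<Lambda>) jet_value v) = v" "inv_into (range \<Lambda>) jet_value v \<in> range \<Lambda>"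
    using \<open>jet_value ` range \<Lambda> = UNIV\<close> by (simp_all add: f_inv_into_f inv_into_into)
  then show "horizontal_lift (range \<Lambda>) v = \<Lambda> v"
    unfolding horizontal_lift_def using val by auto
qed

lemma horizontal_eq_range:
  assumes H: "horizontal k p H" and R: "horizontal k p (range \<Lambda>)" and val: "\<And>v. jet_value (\<Lambda> v) = v"
    and sub: "range \<Lambda> \<subseteq> H"
  shows "H = range \<Lambda>"
proof
  show "H \<subseteq> range \<Lambda>"
  proof
    fix \<xi> assume "\<xi> \<in> H"
    moreover have "\<Lambda> (jet_value \<xi>) \<in> H" using sub by blast
    ultimately have "\<xi> = \<Lambda> (jet_value \<xi>)"
      by (intro inj_onD[OF inj_on_jet_value_horizontal[OF H]]) (simp_all add: val)
    then show "\<xi> \<in> range \<Lambda>" by blast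
  qed
qed (rule sub)

lemma constant_jet: "jet k (\<lambda>_. c) p = (\<lambda>m. if m = (0,0) then c else 0)"
proof -
  have "partial i (\<lambda>_. c) = (\<lambda>_. 0)" for i by (simp add: partial_def fun_eq_iff)
  then have "(partial i ^^ n) (\<lambda>_. c) = (if n = 0 then (\<lambda>_. c) else (\<lambda>_. 0))" for i n
    by (cases n) (simp_all add: funpow_Suc_right funpow_partial_zero del: funpow.simps(2))
  then have "(partial 1 ^^ a) ((partial 2 ^^ b) (\<lambda>_. c)) p = (if (a, b) = (0, 0) then c else 0)" for a b
    by (cases b) (simp_all add: funpow_partial_zero del: funpow.simps(2))
  then show ?thesis unfolding jet_def by (intro ext) (auto split: prod.split)
qed

lemma vf_jets_eqI:
  assumes "\<xi> \<in> vf_jets k p" "\<eta> \<in> vf_jets k p" "\<And>i j. i + j \<le> k \<Longrightarrow> \<xi> (i, j) = \<eta> (i, j)"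
  shows "\<xi> = \<eta>"
proof
  fix m :: "nat \<times> nat"
  obtain i j where m: "m = (i, j)" by (cases m)
  show "\<xi> m = \<eta> m" using assms unfolding vf_jets_iff m by (cases "i + j \<le> k") auto
qed

lemma jet_value_lift: "jet_value (lift2 \<upsilon> v) = v" "jet_value (lift3 \<upsilon> v) = v"
  by (simp_all add: jet_value_def lift3_def lift2_def Let_def)

lemma lift_in_vf_jets: "lift2 \<upsilon> v \<in> vf_jets 2 p" "lift3 \<upsilon> v \<in> vf_jets 3 p"
  by (simp_all add: vf_jets_iff lift2_support lift3_support)

lemma horizontal_lift2: "horizontal 2 p (range (lift2 \<upsilon>))" "horizontal_lift (range (lift2 \<upsilon>)) v = lift2 \<upsilon> v"
  using horizontal_range[where \<Lambda>="lift2 \<upsilon>" and k=2 and p=p, OF lift2_add lift2_scaleR jet_value_lift(1) lift_in_vf_jets(1)] by blast+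

lemma horizontal_lift3: "horizontal 3 p (range (lift3 \<upsilon>))" "horizontal_lift (range (lift3 \<upsilon>)) v = lift3 \<upsilon> v"
  using horizontal_range[where \<Lambda>="lift3 \<upsilon>" and k=3 and p=p, OF lift3_add lift3_scaleR jet_value_lift(2) lift_in_vf_jets(2)] by blast+

lemma lift_zero: "lift2 \<upsilon> 0 = 0" "lift3 \<upsilon> 0 = 0"
  using lift2_scaleR[of \<upsilon> 0 0] lift3_scaleR[of \<upsilon> 0 0] by simp_all

text \<open>The condition on the bracket is only evaluated on the lifts of \<open>e\<^sub>1\<close> and \<open>e\<^sub>2\<close>; by \<open>lift2_unique\<close> this fixes
  the two lifts, hence their span.\<close>

lemma H1_eq:
  assumes u: "smooth_near p u"
  shows "H1 (p, jet 1 u p) = range (lift2 (jet 1 u p))"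
  unfolding H1_def fst_conv
proof (rule the_equality)
  let ?\<upsilon> = "jet 1 u p" and ?R = "range (lift2 (jet 1 u p))"
  have "lift2 ?\<upsilon> v \<in> isotropy 0 (p, ?\<upsilon>)" for v
  proof -
    have "lift2 ?\<upsilon> v (0,0) \<noteq> 0 \<or> lift2 ?\<upsilon> v = 0"
      using jet_value_lift(1)[of ?\<upsilon> v] lift_zero(1) by (auto simp: jet_value_def)
    then show ?thesis
      using isotropyI[OF u, of 0 "lift2 ?\<upsilon> v"] lift_in_vf_jets(1)[of ?\<upsilon> v p] defect00_lift2[of ?\<upsilon> v]
      by (simp add: numeral_2_eq_2)
  qed
  moreover have "jet_trunc 1 (lift2 ?\<upsilon> v) = jet 1 (\<lambda>_. v) p" for v
    by (auto simp: constant_jet jet_trunc_def lift2_def fun_eq_iff)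
  then have "jet_trunc 1 ` ?R = constant_jets p"
    unfolding constant_jets_def image_image by auto
  moreover have "jet_bracket 2 p (lift2 ?\<upsilon> v) (lift2 ?\<upsilon> w) = 0" for v w
    by (subst jet_bracket_eq[OF lift_in_vf_jets(1) lift_in_vf_jets(1)]) (auto simp: fun_eq_iff bracket_lift2)
  ultimately show "horizontal 2 p ?R \<and> ?R \<subseteq> isotropy 0 (p, ?\<upsilon>) \<and> jet_trunc 1 ` ?R = constant_jets p \<and>
    (\<forall>v w. jet_bracket 2 p (horizontal_lift ?R v) (horizontal_lift ?R w) = 0)"
    using horizontal_lift2 by auto
next
  let ?\<upsilon> = "jet 1 u p" and ?R = "range (lift2 (jet 1 u p))"
  fix H assume "horizontal 2 p H \<and> H \<subseteq> isotropy 0 (p, ?\<upsilon>) \<and> jet_trunc 1 ` H = constant_jets p \<and>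
    (\<forall>v w. jet_bracket 2 p (horizontal_lift H v) (horizontal_lift H w) = 0)"
  then have H: "horizontal 2 p H" "H \<subseteq> isotropy 0 (p, ?\<upsilon>)" "jet_trunc 1 ` H = constant_jets p"
    "\<And>v w. jet_bracket 2 p (horizontal_lift H v) (horizontal_lift H w) = 0" by blast+
  let ?\<xi> = "horizontal_lift H (axis 1 1)" and ?\<eta> = "horizontal_lift H (axis 2 1)"
  have in_H: "?\<xi> \<in> H" "?\<eta> \<in> H" using horizontal_lift_in[OF H(1)] by blast+
  have val: "?\<xi> (0,0) = axis 1 1" "?\<eta> (0,0) = axis 2 1"
    using horizontal_lift_in(2)[OF H(1)] by (simp_all add: jet_value_def)
  have vf: "\<zeta> \<in> vf_jets 2 p" if "\<zeta> \<in> H" for \<zeta> using H(1) that by (auto simp: horizontal_def)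
  have d: "defect00 ?\<upsilon> \<zeta> = 0" if "\<zeta> \<in> H" for \<zeta>
    using isotropy_defect(1)[OF u, of 0 \<zeta>] that H(2) by auto
  have z: "\<zeta> (1,0) = 0 \<and> \<zeta> (0,1) = 0" if "\<zeta> \<in> H" for \<zeta>
  proof -
    have "jet_trunc 1 \<zeta> \<in> constant_jets p" using that H(3) by blast
    then obtain c where "jet_trunc 1 \<zeta> = jet 1 (\<lambda>_. c) p" by (auto simp: constant_jets_def)
    then have "jet_trunc 1 \<zeta> m = jet 1 (\<lambda>_. c) p m" for m by simp
    from this[of "(1,0)"] this[of "(0,1)"] show ?thesis by (simp add: constant_jet jet_trunc_def)
  qed
  have jb: "jet_bracket 2 p ?\<xi> ?\<eta> = (\<lambda>(i, j). if i + j < 2 then bracket ?\<xi> ?\<eta> (i, j) else 0)"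
    by (rule jet_bracket_eq[OF vf[OF in_H(1)] vf[OF in_H(2)]]) simp_all
  have "bracket ?\<xi> ?\<eta> (i, j) = 0" if "i + j < 2" for i j
    using fun_cong[OF H(4)[of "axis 1 1" "axis 2 1"], of "(i, j)"] that
    unfolding jb by simp
  then have br: "bracket ?\<xi> ?\<eta> (1,0) = 0" "bracket ?\<xi> ?\<eta> (0,1) = 0" by simp_all
  have "?\<xi> = lift2 ?\<upsilon> (axis 1 1)" "?\<eta> = lift2 ?\<upsilon> (axis 2 1)"
    using lift2_unique[OF val z[OF in_H(1), THEN conjunct1] z[OF in_H(1), THEN conjunct2]
        z[OF in_H(2), THEN conjunct1] z[OF in_H(2), THEN conjunct2] d[OF in_H(1)] d[OF in_H(2)] br]
    by (auto intro!: vf_jets_eqI[OF _ lift_in_vf_jets(1)] vf in_H)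
  then have fr: "lift2 ?\<upsilon> (axis 1 1) \<in> H" "lift2 ?\<upsilon> (axis 2 1) \<in> H" using in_H by simp_all
  have sub: "subspace H" using H(1) by (simp add: horizontal_def)
  have "lift2 ?\<upsilon> v \<in> H" for v
  proof -
    have "lift2 ?\<upsilon> v = lift2 ?\<upsilon> (v $ 1 *\<^sub>R axis 1 1 + v $ 2 *\<^sub>R axis 2 1)"
      by (rule arg_cong[of _ _ "lift2 ?\<upsilon>"]) (simp add: vec2_eq_iff)
    also have "\<dots> \<in> H" unfolding lift2_add lift2_scaleR
      by (intro subspace_add[OF sub] subspace_scale[OF sub] fr)
    finally show ?thesis .
  qed
  then show "H = ?R"
    by (intro horizontal_eq_range[OF H(1) horizontal_lift2(1) jet_value_lift(1)]) auto
qed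

lemma H2_eq:
  assumes u: "smooth_near p u"
  shows "H2 (p, jet 2 u p) = range (lift3 (jet 2 u p))"
  unfolding H2_def fst_conv
proof (rule the_equality)
  let ?\<upsilon> = "jet 2 u p" and ?R = "range (lift3 (jet 2 u p))"
  have H1: "H1 (jet_proj 1 (p, ?\<upsilon>)) = range (lift2 ?\<upsilon>)"
    using H1_eq[OF u] lift2_cong[of "jet 1 u p" ?\<upsilon>] by (simp add: jet_proj_prolong jet_components del: One_nat_def)
  have trunc: "jet_trunc 2 (lift3 ?\<upsilon> v) = lift2 ?\<upsilon> v" for v
    by (auto simp: jet_trunc_def fun_eq_iff lift3_eq_lift2 lift2_support)
  {
    have "lift3 ?\<upsilon> v \<in> isotropy 1 (p, ?\<upsilon>)" for v
    proof -
      have "lift3 ?\<upsilon> v (0,0) \<noteq> 0 \<or> lift3 ?\<upsilon> v = 0"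
        using jet_value_lift(2)[of ?\<upsilon> v] lift_zero(2) by (auto simp: jet_value_def)
      then show ?thesis
        using isotropyI[OF u, of 1 "lift3 ?\<upsilon> v"] lift_in_vf_jets(2)[of ?\<upsilon> v p] defect_lift3[of ?\<upsilon> v]
        by (simp add: numeral_2_eq_2 numeral_3_eq_3)
    qed
    moreover have "jet_trunc 2 ` ?R = H1 (jet_proj 1 (p, ?\<upsilon>))"
      unfolding H1 image_image trunc ..
    ultimately show "horizontal 3 p ?R \<and> ?R \<subseteq> isotropy 1 (p, ?\<upsilon>) \<and> jet_trunc 2 ` ?R = H1 (jet_proj 1 (p, ?\<upsilon>))"
      using horizontal_lift3 by auto
  }
  fix H assume "horizontal 3 p H \<and> H \<subseteq> isotropy 1 (p, ?\<upsilon>) \<and> jet_trunc 2 ` H = H1 (jet_proj 1 (p, ?\<upsilon>))"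
  then have H: "horizontal 3 p H" "H \<subseteq> isotropy 1 (p, ?\<upsilon>)" "jet_trunc 2 ` H = range (lift2 ?\<upsilon>)"
    unfolding H1 by blast+
  have "H \<subseteq> ?R"
  proof
    fix \<zeta> assume \<zeta>: "\<zeta> \<in> H"
    have iso: "\<zeta> \<in> isotropy 1 (p, jet (1 + 1) u p)" using \<zeta> H(2) unfolding one_add_one by blast
    have d: "defect10 ?\<upsilon> \<zeta> = 0" "defect01 ?\<upsilon> \<zeta> = 0"
      using isotropy_defect(2,3)[OF u order_refl iso refl] unfolding one_add_one .
    have vf: "\<zeta> \<in> vf_jets 3 p" using H(1) \<zeta> by (auto simp: horizontal_def)
    obtain v where v: "jet_trunc 2 \<zeta> = lift2 ?\<upsilon> v" using \<zeta> H(3) by blast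
    have "\<zeta> (i, j) = lift2 ?\<upsilon> v (i, j)" if "i + j \<le> 2" for i j
      using fun_cong[OF v, of "(i, j)"] that by (simp add: jet_trunc_def)
    from lift3_unique[OF d this] have "\<zeta> = lift3 ?\<upsilon> v"
      by (intro vf_jets_eqI[OF vf lift_in_vf_jets(2)]) blast
    then show "\<zeta> \<in> ?R" by blast
  qed
  moreover have "?R \<subseteq> H"
  proof
    fix \<zeta> assume "\<zeta> \<in> ?R"
    then obtain v where v: "\<zeta> = lift3 ?\<upsilon> v" by blast
    have l: "horizontal_lift H v \<in> H" "jet_value (horizontal_lift H v) = v" using horizontal_lift_in[OF H(1)] by blast+
    then obtain w where w: "horizontal_lift H v = lift3 ?\<upsilon> w" using \<open>H \<subseteq> ?R\<close> by blast
    then have "w = v" using l(2) jet_value_lift(2) by simp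
    then show "\<zeta> \<in> H" using l(1) w v by simp
  qed
  ultimately show "H = ?R" by blast
qed

lemma omega_eq:
  assumes u: "smooth_near p u"
  shows "omega (p, jet 2 u p) v w = wedge v w *\<^sub>R liouville_jet (jet 2 u p)"
proof -
  let ?\<upsilon> = "jet 2 u p"
  have "omega (p, ?\<upsilon>) v w = (\<lambda>(i, j). if i + j < 3 then bracket (lift3 ?\<upsilon> v) (lift3 ?\<upsilon> w) (i, j) else 0)"
    unfolding omega_def H2_eq[OF u] horizontal_lift3(2) fst_conv
    by (rule jet_bracket_eq[OF lift_in_vf_jets(2) lift_in_vf_jets(2)]) simp_all
  moreover have "bracket (lift3 ?\<upsilon> v) (lift3 ?\<upsilon> w) (i, j) = wedge v w *\<^sub>R liouville_jet ?\<upsilon> (i, j)" if "i + j < 3" for i j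
  proof -
    let ?a = "lift3 ?\<upsilon> (axis 1 1)" and ?b = "lift3 ?\<upsilon> (axis 2 1)"
    have rep: "lift3 ?\<upsilon> v = (\<lambda>m. v $ 1 *\<^sub>R ?a m + v $ 2 *\<^sub>R ?b m)" for v
    proof -
      have "lift3 ?\<upsilon> v = lift3 ?\<upsilon> (v $ 1 *\<^sub>R axis 1 1 + v $ 2 *\<^sub>R axis 2 1)"
        by (rule arg_cong[of _ _ "lift3 ?\<upsilon>"]) (simp add: vec2_eq_iff)
      then show ?thesis unfolding lift3_add lift3_scaleR by (simp add: fun_eq_iff scaleR_fun_def)
    qed
    have val: "?a (0,0) = axis 1 1" "?b (0,0) = axis 2 1"
      using jet_value_lift(2)[of ?\<upsilon>] by (simp_all add: jet_value_def)
    have br: "bracket ?a ?b (i, j) = 0" if "i + j \<le> 1" for i j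
      using bracket_lift2[OF that, of ?\<upsilon> "axis 1 1" "axis 2 1"] that
      unfolding bracket_def advect_def by (simp add: lift3_eq_lift2)
    have "bracket ?a ?b (i, j) = liouville_jet ?\<upsilon> (i, j)"
      using that by (intro bracket_standard_frame val defect_lift3 br) auto
    then show ?thesis unfolding rep[of v] rep[of w] bracket_combination by simp
  qed
  moreover have "liouville_jet ?\<upsilon> (i, j) = 0" if "\<not> i + j < 3" for i j
    using that by (auto simp: liouville_jet_def)
  ultimately show ?thesis by (auto simp: fun_eq_iff scaleR_fun_def)
qed

section \<open>Second and third derivatives as symmetric forms\<close>

definition hess :: "(real^2 \<Rightarrow> 'b::real_normed_vector) \<Rightarrow> real^2 \<Rightarrow> real^2 \<Rightarrow> real^2 \<Rightarrow> 'b" where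
  "hess h q v w = (v$1 * w$1) *\<^sub>R partial 1 (partial 1 h) q
     + (v$1 * w$2 + v$2 * w$1) *\<^sub>R partial 1 (partial 2 h) q + (v$2 * w$2) *\<^sub>R partial 2 (partial 2 h) q"

definition third :: "(real^2 \<Rightarrow> 'b::real_normed_vector) \<Rightarrow> real^2 \<Rightarrow> real^2 \<Rightarrow> real^2 \<Rightarrow> real^2 \<Rightarrow> 'b" where
  "third h q a b c = (a$1 * b$1 * c$1) *\<^sub>R partial 1 (partial 1 (partial 1 h)) q
     + (a$1 * b$1 * c$2 + a$1 * b$2 * c$1 + a$2 * b$1 * c$1) *\<^sub>R partial 1 (partial 1 (partial 2 h)) q
     + (a$1 * b$2 * c$2 + a$2 * b$1 * c$2 + a$2 * b$2 * c$1) *\<^sub>R partial 1 (partial 2 (partial 2 h)) q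
     + (a$2 * b$2 * c$2) *\<^sub>R partial 2 (partial 2 (partial 2 h)) q"

lemma hess_commute: "hess h q v w = hess h q w v"
  by (simp add: hess_def mult.commute add.commute)

lemma third_rotate: "third h q a b c = third h q c b a"
  by (simp add: third_def mult_ac add_ac)

lemma dirderiv_eq_transport:
  assumes "h differentiable (at q)"
  shows "frechet_derivative h (at q) (Y q) = transport Y h q"
  unfolding transport_def by (rule dirderiv_eq_partials[OF assms])

lemma dirderiv_of_derivative_along:
  fixes h :: "real^2 \<Rightarrow> 'b::euclidean_space"
  assumes S: "open S" "q \<in> S" and h: "smooth_on S h" and Y: "smooth_on S Y"
  shows "dirderiv v (\<lambda>x. frechet_derivative h (at x) (Y x)) q
    = hess h q v (Y q) + frechet_derivative h (at q) (dirderiv v Y q)"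
proof -
  have "dirderiv v (\<lambda>x. frechet_derivative h (at x) (Y x)) q = dirderiv v (transport Y h) q"
    by (rule fun_cong[OF frechet_derivative_cong_open[OF S]])
      (intro dirderiv_eq_transport smooth_on_differentiable[OF h S(1)])
  also have "\<dots> = v $ 1 *\<^sub>R partial 1 (transport Y h) q + v $ 2 *\<^sub>R partial 2 (transport Y h) q"
    by (intro dirderiv_eq_partials smooth_on_differentiable[OF smooth_on_transport[OF S(1) Y h] S])
  also have "\<dots> = hess h q v (Y q) + frechet_derivative h (at q) (v $ 1 *\<^sub>R partial 1 Y q + v $ 2 *\<^sub>R partial 2 Y q)"
    unfolding partial_transport[OF S(1) Y h S(2)] dirderiv_eq_partials[OF smooth_on_differentiable[OF h S]]
    by (simp add: transport_def hess_def third_partials(1)[OF S h] algebra_simps)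
  finally show ?thesis
    unfolding dirderiv_eq_partials[OF smooth_on_differentiable[OF Y S]] .
qed

lemma dirderiv_hess:
  fixes h :: "real^2 \<Rightarrow> 'b::euclidean_space"
  assumes S: "open S" "q \<in> S" and h: "smooth_on S h" and Y: "smooth_on S Y"
  shows "dirderiv v (\<lambda>x. hess h x a (Y x)) q = third h q v a (Y q) + hess h q a (dirderiv v Y q)"
    and "((\<lambda>x. hess h x a (Y x)) has_derivative (\<lambda>v. third h q v a (Y q) + hess h q a (dirderiv v Y q))) (at q)"
proof -
  have d: "(k has_derivative frechet_derivative k (at q)) (at q)" if "smooth_on S k" for k :: "real^2 \<Rightarrow> 'c::real_normed_vector"
    by (rule smooth_on_has_derivative[OF that S])
  note dh = d[OF smooth_on_partial[OF smooth_on_partial[OF h]]]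
  note dY = bounded_linear.has_derivative[OF bounded_linear_vec_nth d[OF Y]]
  note e = dirderiv_eq_partials[OF smooth_on_differentiable[OF smooth_on_partial[OF smooth_on_partial[OF h]] S]]
  have "((\<lambda>x. hess h x a (Y x)) has_derivative (\<lambda>v.
      ((a$1 * Y q$1) *\<^sub>R dirderiv v (partial 1 (partial 1 h)) q + (a$1 * dirderiv v Y q$1) *\<^sub>R partial 1 (partial 1 h) q)
      + ((a$1 * Y q$2 + a$2 * Y q$1) *\<^sub>R dirderiv v (partial 1 (partial 2 h)) q
         + (a$1 * dirderiv v Y q$2 + a$2 * dirderiv v Y q$1) *\<^sub>R partial 1 (partial 2 h) q)
      + ((a$2 * Y q$2) *\<^sub>R dirderiv v (partial 2 (partial 2 h)) q + (a$2 * dirderiv v Y q$2) *\<^sub>R partial 2 (partial 2 h) q))) (at q)"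
    unfolding hess_def
    by (intro has_derivative_add has_derivative_scaleR has_derivative_mult_right dh dY)
  moreover have "(\<lambda>v.
      ((a$1 * Y q$1) *\<^sub>R dirderiv v (partial 1 (partial 1 h)) q + (a$1 * dirderiv v Y q$1) *\<^sub>R partial 1 (partial 1 h) q)
      + ((a$1 * Y q$2 + a$2 * Y q$1) *\<^sub>R dirderiv v (partial 1 (partial 2 h)) q
         + (a$1 * dirderiv v Y q$2 + a$2 * dirderiv v Y q$1) *\<^sub>R partial 1 (partial 2 h) q)
      + ((a$2 * Y q$2) *\<^sub>R dirderiv v (partial 2 (partial 2 h)) q + (a$2 * dirderiv v Y q$2) *\<^sub>R partial 2 (partial 2 h) q))
    = (\<lambda>v. third h q v a (Y q) + hess h q a (dirderiv v Y q))"
  proof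
    fix v
    note e' = e[of _ _ v]
    show "((a$1 * Y q$1) *\<^sub>R dirderiv v (partial 1 (partial 1 h)) q + (a$1 * dirderiv v Y q$1) *\<^sub>R partial 1 (partial 1 h) q)
      + ((a$1 * Y q$2 + a$2 * Y q$1) *\<^sub>R dirderiv v (partial 1 (partial 2 h)) q
         + (a$1 * dirderiv v Y q$2 + a$2 * dirderiv v Y q$1) *\<^sub>R partial 1 (partial 2 h) q)
      + ((a$2 * Y q$2) *\<^sub>R dirderiv v (partial 2 (partial 2 h)) q + (a$2 * dirderiv v Y q$2) *\<^sub>R partial 2 (partial 2 h) q)
      = third h q v a (Y q) + hess h q a (dirderiv v Y q)"
      unfolding e'[of 1 1] e'[of 1 2] e'[of 2 2] third_partials[OF S h]
      by (simp add: third_def hess_def algebra_simps)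
  qed
  ultimately show *: "((\<lambda>x. hess h x a (Y x)) has_derivative (\<lambda>v. third h q v a (Y q) + hess h q a (dirderiv v Y q))) (at q)"
    by (rule subst[rotated])
  show "dirderiv v (\<lambda>x. hess h x a (Y x)) q = third h q v a (Y q) + hess h q a (dirderiv v Y q)"
    by (rule frechet_derivative_eqI[OF *])
qed

section \<open>Right-hand sides as cubic forms\<close>

text \<open>Homogenising the right-hand side turns the transformation rule into an equation between functions of a
  tangent vector, free of binomial coefficients.\<close>

definition cubic :: "fibre \<Rightarrow> real^2 \<Rightarrow> real" where
  "cubic u \<xi> = coef0 u * \<xi>$1^3 + coef1 u * \<xi>$1^2 * \<xi>$2 + coef2 u * \<xi>$1 * \<xi>$2^2 + coef3 u * \<xi>$2^3"

definition dcubic :: "fibre \<Rightarrow> real^2 \<Rightarrow> real^2 \<Rightarrow> real" where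
  "dcubic u \<xi> \<zeta> = 3 * coef0 u * \<xi>$1^2 * \<zeta>$1 + coef1 u * (2 * \<xi>$1 * \<zeta>$1 * \<xi>$2 + \<xi>$1^2 * \<zeta>$2)
     + coef2 u * (\<zeta>$1 * \<xi>$2^2 + 2 * \<xi>$1 * \<xi>$2 * \<zeta>$2) + 3 * coef3 u * \<xi>$2^2 * \<zeta>$2"

lemma dcubic_add: "dcubic u \<xi> (\<zeta> + \<zeta>') = dcubic u \<xi> \<zeta> + dcubic u \<xi> \<zeta>'"
  by (simp add: dcubic_def algebra_simps)

lemma cubic_eqI:
  assumes "\<And>\<xi>. cubic u \<xi> = cubic v \<xi>"
  shows "u = v"
  using assms[of "vector [1, 0]"] assms[of "vector [0, 1]"] assms[of "vector [1, 1]"] assms[of "vector [1, -1]"]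
  by (simp add: cubic_def fibre_eq_iff)

lemma cubic_diff: "cubic (u - v) \<xi> = cubic u \<xi> - cubic v \<xi>"
  by (simp add: cubic_def algebra_simps)

lemma cubic_add: "cubic (u + v) \<xi> = cubic u \<xi> + cubic v \<xi>"
  by (simp add: cubic_def algebra_simps)

lemma cubic_first_order_part:
  "cubic (first_order_part a b u) \<xi> = (a$1 + b$2) * cubic u \<xi> - dcubic u \<xi> (\<xi>$1 *\<^sub>R a + \<xi>$2 *\<^sub>R b)"
  by (simp add: cubic_def dcubic_def first_order_part_def algebra_simps power2_eq_square power3_eq_cube)

lemma cubic_second_order_part:
  "cubic (second_order_part a b c) \<xi> = wedge \<xi> ((\<xi>$1 * \<xi>$1) *\<^sub>R a + (\<xi>$1 * \<xi>$2 + \<xi>$2 * \<xi>$1) *\<^sub>R b + (\<xi>$2 * \<xi>$2) *\<^sub>R c)"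
  by (simp add: cubic_def second_order_part_def algebra_simps power2_eq_square power3_eq_cube)

lemma cubic_transform_coeffs:
  "cubic (transform_coeffs a b c d e u) \<eta> = inverse (wedge a b) *
     (cubic u (\<eta>$1 *\<^sub>R a + \<eta>$2 *\<^sub>R b)
      - wedge (\<eta>$1 *\<^sub>R a + \<eta>$2 *\<^sub>R b) ((\<eta>$1 * \<eta>$1) *\<^sub>R c + (\<eta>$1 * \<eta>$2 + \<eta>$2 * \<eta>$1) *\<^sub>R d + (\<eta>$2 * \<eta>$2) *\<^sub>R e))"
proof -
  have "cubic (r *\<^sub>R x) \<eta> = r * cubic x \<eta>" for r x by (simp add: cubic_def algebra_simps)
  then show ?thesis
    unfolding transform_coeffs_def
    by (simp only:) (simp add: cubic_def algebra_simps power2_eq_square power3_eq_cube)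
qed

lemma cubic_has_derivative:
  assumes "(u has_derivative u') (at q)" "(\<xi> has_derivative \<xi>') (at q)"
  shows "((\<lambda>x. cubic (u x) (\<xi> x)) has_derivative (\<lambda>h. cubic (u' h) (\<xi> q) + dcubic (u q) (\<xi> q) (\<xi>' h))) (at q)"
proof -
  have c: "((\<lambda>x. coef0 (u x)) has_derivative (\<lambda>h. coef0 (u' h))) (at q)" "((\<lambda>x. coef1 (u x)) has_derivative (\<lambda>h. coef1 (u' h))) (at q)"
    "((\<lambda>x. coef2 (u x)) has_derivative (\<lambda>h. coef2 (u' h))) (at q)" "((\<lambda>x. coef3 (u x)) has_derivative (\<lambda>h. coef3 (u' h))) (at q)"
    unfolding coef_defs by (intro has_derivative_fst has_derivative_snd assms)+
  note n = bounded_linear.has_derivative[OF bounded_linear_vec_nth assms(2)]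
  show ?thesis
    unfolding cubic_def
    by (auto intro!: derivative_eq_intros c n simp: fun_eq_iff dcubic_def algebra_simps power2_eq_square power3_eq_cube)
qed

text \<open>The trace of a linear map with columns \<open>m1\<close>, \<open>m2\<close> as its infinitesimal action on area.\<close>

lemma wedge_trace:
  fixes m1 m2 v w :: "real^2"
  shows "wedge (v$1 *\<^sub>R m1 + v$2 *\<^sub>R m2) w + wedge v (w$1 *\<^sub>R m1 + w$2 *\<^sub>R m2) = (m1$1 + m2$2) * wedge v w"
  by (simp add: algebra_simps)

section \<open>Naturality\<close>

definition lie_defect :: "(real^2 \<Rightarrow> real^2) \<Rightarrow> (real^2 \<Rightarrow> fibre) \<Rightarrow> real^2 \<Rightarrow> fibre" where
  "lie_defect X u q = lie_action X u q - transport X u q"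

context
  fixes U V :: "(real^2) set" and f :: "real^2 \<Rightarrow> real^2"
  assumes f: "point_transformation U f" and V: "open V" "V \<subseteq> U"
begin

abbreviation (input) "finv \<equiv> inv_into U f"
abbreviation (input) "Df q \<equiv> frechet_derivative f (at q)"
abbreviation (input) "jac q \<equiv> wedge (partial 1 f q) (partial 2 f q)"

lemma f_smooth: "smooth_on V f" by (rule smooth_on_subset[OF pt_smooth[OF f] V(2)])

lemma image_open: "open (f ` V)"
proof -
  have "f ` V = finv -` V \<inter> f ` U"
    using V pt_inv[OF f] by force
  moreover have "open (finv -` V \<inter> f ` U)"
    using continuous_on_open_vimage[OF pt_open_image[OF f]] smooth_on_continuous_on[OF pt_smooth_inv[OF f]] V(1)
    by blast
  ultimately show ?thesis by simp
qed

lemma inv_smooth: "smooth_on (f ` V) finv"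
  by (rule smooth_on_subset[OF pt_smooth_inv[OF f]]) (use V in blast)

lemma inv_f: "q \<in> V \<Longrightarrow> finv (f q) = q"
  using pt_inv[OF f] V by blast

lemma smooth_on_pullback_inv: "smooth_on V F \<Longrightarrow> smooth_on (f ` V) (\<lambda>z. F (finv z))"
  by (rule smooth_on_compose[OF image_open V(1) _ inv_smooth]) (auto simp: inv_f)

lemma push_field_at: "q \<in> V \<Longrightarrow> push_field U f X (f q) = Df q (X q)"
  by (simp add: push_field_def inv_f)

lemma smooth_push_field: "smooth_on V X \<Longrightarrow> smooth_on (f ` V) (push_field U f X)"
  unfolding push_field_def[abs_def]
  by (rule smooth_on_pullback_inv[where F="\<lambda>q. Df q (X q)"]) (rule smooth_on_derivative_along[OF V(1) f_smooth])

lemma Df_eq: "q \<in> V \<Longrightarrow> Df q v = v $ 1 *\<^sub>R partial 1 f q + v $ 2 *\<^sub>R partial 2 f q"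
  by (rule dirderiv_eq_partials) (rule smooth_on_differentiable[OF f_smooth V(1)])

lemma Df_linear: "q \<in> V \<Longrightarrow> linear (Df q)"
  by (rule smooth_on_linear_derivative[OF f_smooth V(1)])

lemma wedge_Df: "q \<in> V \<Longrightarrow> wedge (Df q v) (Df q w) = jac q * wedge v w"
  unfolding Df_eq by (simp add: algebra_simps)

lemma Df_surj: "q \<in> V \<Longrightarrow> \<exists>v. w = Df q v"
  using pt_derivative_inverse(2)[OF f, of q w] V by (metis subsetD)

lemma jac_nonzero: "q \<in> V \<Longrightarrow> jac q \<noteq> 0"
  using pt_inverse_partials(1)[OF f] V by blast

lemma chain_at_image:
  assumes "smooth_on (f ` V) F" "q \<in> V"
  shows "dirderiv v (\<lambda>x. F (f x)) q = frechet_derivative F (at (f q)) (Df q v)"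
  by (rule dirderiv_compose)
    (use assms smooth_on_differentiable[OF _ image_open] smooth_on_differentiable[OF f_smooth V(1)] in auto)

lemma push_field_derivative:
  assumes X: "smooth_on V X" and q: "q \<in> V"
  shows "frechet_derivative (push_field U f X) (at (f q)) (Df q v) = hess f q v (X q) + Df q (dirderiv v X q)"
proof -
  have "frechet_derivative (push_field U f X) (at (f q)) (Df q v) = dirderiv v (\<lambda>x. push_field U f X (f x)) q"
    by (rule chain_at_image[OF smooth_push_field[OF X] q, symmetric])
  also have "\<dots> = dirderiv v (\<lambda>x. Df x (X x)) q"
    by (rule fun_cong[OF frechet_derivative_cong_open[OF V(1) q]]) (rule push_field_at)
  also have "\<dots> = hess f q v (X q) + Df q (dirderiv v X q)"
    by (rule dirderiv_of_derivative_along[OF V(1) q f_smooth X])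
  finally show ?thesis .
qed

text \<open>The second derivatives of \<open>f\<close> enter symmetrically in \<open>X\<close> and \<open>Y\<close> and cancel.\<close>

lemma lie_bracket_push_field:
  assumes X: "smooth_on V X" and Y: "smooth_on V Y" and q: "q \<in> V"
  shows "lie_bracket (push_field U f X) (push_field U f Y) (f q) = push_field U f (lie_bracket X Y) (f q)"
  unfolding lie_bracket_def push_field_at[OF q] push_field_derivative[OF X q] push_field_derivative[OF Y q]
  by (simp add: linear_diff[OF Df_linear[OF q]] hess_commute[of f q "X q"])

text \<open>Differentiate the relation between the field and its push-forward twice along \<open>\<xi>\<close>. On the image side
  this uses the push-forward \<open>E\<close> of the constant field \<open>\<xi>\<close> as direction field, whose own derivative
  accounts for the second term on the left.\<close>

lemma push_field_second_derivative:
  assumes X: "smooth_on V X" and q: "q \<in> V"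
  shows "hess (push_field U f X) (f q) (Df q \<xi>) (Df q \<xi>)
      + frechet_derivative (push_field U f X) (at (f q)) (hess f q \<xi> \<xi>)
    = third f q \<xi> \<xi> (X q) + 2 *\<^sub>R hess f q \<xi> (dirderiv \<xi> X q) + Df q (hess X q \<xi> \<xi>)"
proof -
  let ?Y = "push_field U f X" and ?E = "push_field U f (\<lambda>_. \<xi>)"
  have Y: "smooth_on (f ` V) ?Y" and E: "smooth_on (f ` V) ?E"
    by (intro smooth_push_field X smooth_on_const)+
  have fq: "f q \<in> f ` V" using q by simp
  have dX: "smooth_on V (dirderiv \<xi> X)" by (rule smooth_on_dirderiv[OF X])
  have DE: "frechet_derivative ?E (at (f q)) (Df q \<xi>) = hess f q \<xi> \<xi>"
    using push_field_derivative[OF smooth_on_const q, of \<xi> \<xi>] linear_0[OF Df_linear[OF q]] by simp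
  have "dirderiv (Df q \<xi>) (\<lambda>z. frechet_derivative ?Y (at z) (?E z)) (f q)
    = dirderiv \<xi> (\<lambda>x. frechet_derivative ?Y (at (f x)) (?E (f x))) q"
    by (rule chain_at_image[OF smooth_on_derivative_along[OF image_open Y E] q, symmetric])
  also have "\<dots> = dirderiv \<xi> (\<lambda>x. hess f x \<xi> (X x) + Df x (dirderiv \<xi> X x)) q"
    by (rule fun_cong[OF frechet_derivative_cong_open[OF V(1) q]])
      (simp add: push_field_at push_field_derivative[OF X])
  also have "\<dots> = (third f q \<xi> \<xi> (X q) + hess f q \<xi> (dirderiv \<xi> X q))
      + (hess f q \<xi> (dirderiv \<xi> X q) + Df q (dirderiv \<xi> (dirderiv \<xi> X) q))"
  proof (rule frechet_derivative_eqI[where f'="\<lambda>v. (third f q v \<xi> (X q) + hess f q \<xi> (dirderiv v X q))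
      + (hess f q v (dirderiv \<xi> X q) + Df q (dirderiv v (dirderiv \<xi> X) q))"])
    have "((\<lambda>x. Df x (dirderiv \<xi> X x)) has_derivative frechet_derivative (\<lambda>x. Df x (dirderiv \<xi> X x)) (at q)) (at q)"
      by (rule smooth_on_has_derivative[OF smooth_on_derivative_along[OF V(1) f_smooth dX] V(1) q])
    then have "((\<lambda>x. Df x (dirderiv \<xi> X x)) has_derivative
        (\<lambda>v. hess f q v (dirderiv \<xi> X q) + Df q (dirderiv v (dirderiv \<xi> X) q))) (at q)"
      unfolding dirderiv_of_derivative_along[OF V(1) q f_smooth dX, symmetric] by simp
    from has_derivative_add[OF dirderiv_hess(2)[OF V(1) q f_smooth X] this]
    show "((\<lambda>x. hess f x \<xi> (X x) + Df x (dirderiv \<xi> X x)) has_derivative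
      (\<lambda>v. (third f q v \<xi> (X q) + hess f q \<xi> (dirderiv v X q))
      + (hess f q v (dirderiv \<xi> X q) + Df q (dirderiv v (dirderiv \<xi> X) q)))) (at q)" .
  qed
  also have "dirderiv \<xi> (dirderiv \<xi> X) q = hess X q \<xi> \<xi>"
    using dirderiv_of_derivative_along[OF V(1) q X smooth_on_const, of \<xi> \<xi>]
      linear_0[OF smooth_on_linear_derivative[OF X V(1) q]] by simp
  finally show ?thesis
    unfolding dirderiv_of_derivative_along[OF image_open fq Y E] push_field_at[OF q] DE
    by (simp add: scaleR_2 algebra_simps)
qed

text \<open>The transformation rule of the cubic forms, expressed by derivatives of \<open>f\<close> instead of its inverse. The
  second derivative of the inverse is eliminated by differentiating
  \<open>Dg (Df \<xi>) = \<xi>\<close>, with \<open>g\<close> the inverse map.\<close>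

lemma push_section_cubic:
  assumes q: "q \<in> V"
  shows "cubic (push_section U f u (f q)) (Df q \<xi>)
    = jac q * cubic (u q) \<xi> + wedge (Df q \<xi>) (hess f q \<xi> \<xi>)"
proof -
  let ?E = "push_field U f (\<lambda>_. \<xi>)" and ?\<eta> = "Df q \<xi>"
  have qU: "q \<in> U" using q V by blast
  have fq: "f q \<in> f ` V" using q by simp
  have E: "smooth_on (f ` V) ?E" by (intro smooth_push_field smooth_on_const)
  have DE: "frechet_derivative ?E (at (f q)) ?\<eta> = hess f q \<xi> \<xi>"
    using push_field_derivative[OF smooth_on_const q, of \<xi> \<xi>] linear_0[OF Df_linear[OF q]] by simp
  have Dg: "frechet_derivative finv (at (f q)) v = v $ 1 *\<^sub>R partial 1 finv (f q) + v $ 2 *\<^sub>R partial 2 finv (f q)" for v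
    by (rule dirderiv_eq_partials) (rule smooth_on_differentiable[OF inv_smooth image_open fq])
  have const: "frechet_derivative finv (at z) (?E z) = \<xi>" if z: "z \<in> f ` V" for z
  proof -
    obtain x where x: "x \<in> V" "z = f x" using z by blast
    show ?thesis unfolding x(2) push_field_at[OF x(1)] using pt_derivative_inverse(1)[OF f] x V by blast
  qed
  have "dirderiv ?\<eta> (\<lambda>z. frechet_derivative finv (at z) (?E z)) (f q) = dirderiv ?\<eta> (\<lambda>z. \<xi>) (f q)"
    by (rule fun_cong[OF frechet_derivative_cong_open[OF image_open fq]]) (rule const)
  then have h: "hess finv (f q) ?\<eta> ?\<eta> = - frechet_derivative finv (at (f q)) (hess f q \<xi> \<xi>)"
    unfolding dirderiv_of_derivative_along[OF image_open fq inv_smooth E] DE push_field_at[OF q]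
    by (simp add: eq_neg_iff_add_eq_0)
  define w where "w = frechet_derivative finv (at (f q)) (hess f q \<xi> \<xi>)"
  have w: "hess f q \<xi> \<xi> = Df q w" unfolding w_def using pt_derivative_inverse(2)[OF f qU] by simp
  have J: "inverse (wedge (partial 1 finv (f q)) (partial 2 finv (f q))) = jac q"
  proof -
    note p = pt_inverse_partials[OF f qU]
    have "wedge (partial 1 finv (f q)) (partial 2 finv (f q)) = inverse (jac q) * inverse (jac q) * jac q"
      unfolding p(2,3) by (simp add: algebra_simps)
    then show ?thesis using p(1) by simp
  qed
  have "cubic (push_section U f u (f q)) ?\<eta> = inverse (wedge (partial 1 finv (f q)) (partial 2 finv (f q))) *
     (cubic (u q) (?\<eta>$1 *\<^sub>R partial 1 finv (f q) + ?\<eta>$2 *\<^sub>R partial 2 finv (f q))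
      - wedge (?\<eta>$1 *\<^sub>R partial 1 finv (f q) + ?\<eta>$2 *\<^sub>R partial 2 finv (f q)) (hess finv (f q) ?\<eta> ?\<eta>))"
    unfolding push_section_image[OF f qU] Let_def cubic_transform_coeffs hess_def ..
  also have "\<dots> = jac q * (cubic (u q) \<xi> - wedge \<xi> (- w))"
    unfolding J h w_def[symmetric] Dg[symmetric] pt_derivative_inverse(1)[OF f qU] ..
  also have "\<dots> = jac q * cubic (u q) \<xi> + jac q * wedge \<xi> w" by (simp add: algebra_simps)
  also have "jac q * wedge \<xi> w = wedge ?\<eta> (hess f q \<xi> \<xi>)" unfolding w wedge_Df[OF q] ..
  finally show ?thesis .
qed

text \<open>Polarisation of the transformation rule: both sides are polynomial in \<open>\<xi>\<close>, so they may be
  differentiated in direction \<open>\<zeta>\<close>.\<close>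

lemma push_section_dcubic:
  assumes q: "q \<in> V"
  shows "dcubic (push_section U f u (f q)) (Df q \<xi>) (Df q \<zeta>)
    = jac q * dcubic (u q) \<xi> \<zeta> + wedge (Df q \<zeta>) (hess f q \<xi> \<xi>) + 2 * wedge (Df q \<xi>) (hess f q \<xi> \<zeta>)"
proof -
  let ?x = "\<lambda>s. \<xi> + s *\<^sub>R \<zeta>" and ?P = "push_section U f u (f q)"
  have dx: "(?x has_derivative (\<lambda>s. s *\<^sub>R \<zeta>)) (at 0)" by (auto intro!: derivative_eq_intros)
  have D: "bounded_linear (Df q)" using Df_linear[OF q] by (simp add: linear_conv_bounded_linear)
  have 1: "((\<lambda>s. cubic ?P (Df q (?x s))) has_derivative (\<lambda>s. cubic 0 (Df q (?x 0)) + dcubic ?P (Df q (?x 0)) (Df q (s *\<^sub>R \<zeta>)))) (at 0)"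
    by (intro cubic_has_derivative has_derivative_const bounded_linear.has_derivative[OF D dx])
  have h: "((\<lambda>s. hess f q (?x s) (?x s)) has_derivative (\<lambda>s. (2 * s) *\<^sub>R hess f q \<xi> \<zeta>)) (at 0)"
    unfolding hess_def by (auto intro!: derivative_eq_intros simp: fun_eq_iff algebra_simps)
  note n = bounded_linear.has_derivative[OF bounded_linear_vec_nth]
  have 2: "((\<lambda>s. jac q * cubic (u q) (?x s) + wedge (Df q (?x s)) (hess f q (?x s) (?x s))) has_derivative
    (\<lambda>s. jac q * (cubic 0 (?x 0) + dcubic (u q) (?x 0) (s *\<^sub>R \<zeta>))
      + ((Df q (?x 0) $ 1 * ((2 * s) *\<^sub>R hess f q \<xi> \<zeta>) $ 2 + Df q (s *\<^sub>R \<zeta>) $ 1 * hess f q (?x 0) (?x 0) $ 2)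
       - (Df q (?x 0) $ 2 * ((2 * s) *\<^sub>R hess f q \<xi> \<zeta>) $ 1 + Df q (s *\<^sub>R \<zeta>) $ 2 * hess f q (?x 0) (?x 0) $ 1)))) (at 0)"
    by (intro has_derivative_add has_derivative_diff has_derivative_mult has_derivative_mult_right cubic_has_derivative
        has_derivative_const dx n h bounded_linear.has_derivative[OF D dx])
  have eq: "(\<lambda>s. cubic ?P (Df q (?x s))) = (\<lambda>s. jac q * cubic (u q) (?x s) + wedge (Df q (?x s)) (hess f q (?x s) (?x s)))"
    by (intro ext push_section_cubic[OF q])
  from fun_cong[OF has_derivative_unique[OF 1[unfolded eq] 2], of 1]
  show ?thesis by (simp add: cubic_def[of 0] algebra_simps)
qed

lemma smooth_push_section:
  assumes u: "smooth_on V u"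
  shows "smooth_on (f ` V) (push_section U f u)"
proof -
  have z: "push_section U f u z = transform_coeffs (partial 1 finv z) (partial 2 finv z) (partial 1 (partial 1 finv) z)
      (partial 1 (partial 2 finv) z) (partial 2 (partial 2 finv) z) (u (finv z))"
    and nz: "wedge (partial 1 finv z) (partial 2 finv z) \<noteq> 0" if zV: "z \<in> f ` V" for z
  proof -
    obtain q where q: "q \<in> V" "z = f q" using zV by blast
    have qU: "q \<in> U" using q V by blast
    show "push_section U f u z = transform_coeffs (partial 1 finv z) (partial 2 finv z) (partial 1 (partial 1 finv) z)
      (partial 1 (partial 2 finv) z) (partial 2 (partial 2 finv) z) (u (finv z))"
      unfolding q(2) push_section_image[OF f qU] Let_def inv_f[OF q(1)] ..
    note p = pt_inverse_partials[OF f qU]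
    have "wedge (partial 1 finv (f q)) (partial 2 finv (f q)) = inverse (jac q) * inverse (jac q) * jac q"
      unfolding p(2,3) by (simp add: algebra_simps)
    then show "wedge (partial 1 finv z) (partial 2 finv z) \<noteq> 0" unfolding q(2) using p(1) by simp
  qed
  have "smooth_on (f ` V) (\<lambda>z. transform_coeffs (partial 1 finv z) (partial 2 finv z) (partial 1 (partial 1 finv) z)
      (partial 1 (partial 2 finv) z) (partial 2 (partial 2 finv) z) (u (finv z)))"
    by (intro smooth_on_transform_coeffs image_open smooth_on_partial inv_smooth smooth_on_pullback_inv u nz)
  moreover note smooth_on_cong[OF image_open, of "push_section U f u", OF z]
  ultimately show ?thesis by (simp only:)
qed

text \<open>Infinitesimally the transformation rule reads as follows: differentiate it along \<open>X\<close> and, in the cubic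
  variable, along the derivative of \<open>X\<close>, and combine the two with the formula for second derivatives of the
  push-forward. The third derivatives of \<open>f\<close> cancel, and the remaining second derivatives
  of \<open>f\<close> cancel because of the trace identity \<open>wedge_trace\<close>.\<close>

lemma lie_defect_natural:
  assumes X: "smooth_on V X" and u: "smooth_on V u" and q: "q \<in> V"
  shows "cubic (lie_defect (push_field U f X) (push_section U f u) (f q)) (Df q \<xi>) = jac q * cubic (lie_defect X u q) \<xi>"
proof -
  let ?Y = "push_field U f X" and ?P = "push_section U f u"
  define w \<eta> \<zeta> h k a b where defs: "w = X q" "\<eta> = Df q \<xi>" "\<zeta> = dirderiv \<xi> X q" "h = hess f q \<xi> \<xi>"
    "k = hess f q \<xi> (dirderiv \<xi> X q)" "a = hess f q \<xi> (X q)" "b = Df q (dirderiv \<xi> X q)"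
  have fq: "f q \<in> f ` V" using q by simp
  have Y: "smooth_on (f ` V) ?Y" and P: "smooth_on (f ` V) ?P"
    by (intro smooth_push_field smooth_push_section X u)+
  note dY = dirderiv_eq_partials[OF smooth_on_differentiable[OF Y image_open fq]]
  note dX = dirderiv_eq_partials[OF smooth_on_differentiable[OF X V(1) q]]
  have M\<eta>: "frechet_derivative ?Y (at (f q)) \<eta> = a + b"
    unfolding defs by (rule push_field_derivative[OF X q])
  define divY where "divY = partial 1 ?Y (f q) $ 1 + partial 2 ?Y (f q) $ 2"
  define divX where "divX = partial 1 X q $ 1 + partial 2 X q $ 2"
  define Mh where "Mh = frechet_derivative ?Y (at (f q)) h"
  define hY where "hY = hess ?Y (f q) \<eta> \<eta>"
  define T where "T = third f q \<xi> \<xi> (X q)"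
  define dJ where "dJ = wedge (hess f q w (axis 1 1)) (partial 2 f q) + wedge (partial 1 f q) (hess f q w (axis 2 1))"
  define cu where "cu = cubic (u q) \<xi>"
  define cuw where "cuw = cubic (transport X u q) \<xi>"
  define ct where "ct = cubic (transport ?Y ?P (f q)) \<eta>"
  define da where "da = dcubic (?P (f q)) \<eta> a"
  define db where "db = dcubic (?P (f q)) \<eta> b"
  define dc where "dc = dcubic (u q) \<xi> \<zeta>"
  define cP where "cP = cubic (?P (f q)) \<eta>"
  define x2 where "x2 = hess X q \<xi> \<xi>"
  \<comment> \<open>The transformation rule itself, and its derivatives along \<open>X\<close> and in the cubic variable.\<close>
  have star: "cP = jac q * cu + wedge \<eta> h"
    unfolding cP_def cu_def defs by (rule push_section_cubic[OF q])
  have D2: "db = jac q * dc + wedge b h + 2 * wedge \<eta> k"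
    unfolding db_def dc_def defs by (rule push_section_dcubic[OF q])
  have D1: "ct + da = dJ * cu + jac q * cuw + wedge a h + wedge \<eta> T"
  proof -
    have fd: "((\<lambda>x. Df x \<xi>) has_derivative (\<lambda>v. hess f q v \<xi>)) (at q)"
    proof -
      have "((\<lambda>x. Df x \<xi>) has_derivative frechet_derivative (\<lambda>x. Df x \<xi>) (at q)) (at q)"
        by (rule smooth_on_has_derivative[OF smooth_on_dirderiv[OF f_smooth] V(1) q])
      moreover have "frechet_derivative (\<lambda>x. Df x \<xi>) (at q) v = hess f q v \<xi>" for v
        using dirderiv_of_derivative_along[where v=v, OF V(1) q f_smooth smooth_on_const[of _ \<xi>]] linear_0[OF Df_linear[OF q]] by simp
      then have "frechet_derivative (\<lambda>x. Df x \<xi>) (at q) = (\<lambda>v. hess f q v \<xi>)" by (rule ext)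
      ultimately show ?thesis by (simp only:)
    qed
    have Pd: "((\<lambda>x. ?P (f x)) has_derivative (\<lambda>v. frechet_derivative ?P (at (f q)) (Df q v))) (at q)"
      using diff_chain_at[OF smooth_on_has_derivative[OF f_smooth V(1) q] smooth_on_has_derivative[OF P image_open fq]]
      by (simp add: o_def)
    have lhs: "((\<lambda>x. cubic (?P (f x)) (Df x \<xi>)) has_derivative
        (\<lambda>v. cubic (frechet_derivative ?P (at (f q)) (Df q v)) \<eta> + dcubic (?P (f q)) \<eta> (hess f q v \<xi>))) (at q)"
      unfolding defs by (rule cubic_has_derivative[OF Pd fd])
    have pd: "(partial i f has_derivative (\<lambda>v. hess f q v (axis i 1))) (at q)" for i
    proof -
      have "(partial i f has_derivative frechet_derivative (partial i f) (at q)) (at q)"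
        by (rule smooth_on_has_derivative[OF smooth_on_partial[OF f_smooth] V(1) q])
      moreover have "frechet_derivative (partial i f) (at q) v = hess f q v (axis i 1)" for v
        using dirderiv_of_derivative_along[where v=v, OF V(1) q f_smooth smooth_on_const[of _ "axis i 1"]] linear_0[OF Df_linear[OF q]]
        by (simp add: partial_eq_dirderiv)
      then have "frechet_derivative (partial i f) (at q) = (\<lambda>v. hess f q v (axis i 1))" by (rule ext)
      ultimately show ?thesis by (simp only:)
    qed
    have hd: "((\<lambda>x. hess f x \<xi> \<xi>) has_derivative (\<lambda>v. third f q v \<xi> \<xi>)) (at q)"
    proof -
      have "hess f q \<xi> 0 = 0" by (simp add: hess_def)
      then show ?thesis using dirderiv_hess(2)[OF V(1) q f_smooth smooth_on_const, of \<xi> \<xi>] by simp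
    qed
    note n = bounded_linear.has_derivative[OF bounded_linear_vec_nth]
    have J: "((\<lambda>x. jac x) has_derivative (\<lambda>v. (partial 1 f q $ 1 * hess f q v (axis 2 1) $ 2 + hess f q v (axis 1 1) $ 1 * partial 2 f q $ 2)
        - (partial 1 f q $ 2 * hess f q v (axis 2 1) $ 1 + hess f q v (axis 1 1) $ 2 * partial 2 f q $ 1))) (at q)"
      by (intro has_derivative_diff has_derivative_mult n pd)
    have uc: "((\<lambda>x. cubic (u x) \<xi>) has_derivative (\<lambda>v. cubic (frechet_derivative u (at q) v) \<xi> + dcubic (u q) \<xi> 0)) (at q)"
      by (rule cubic_has_derivative[OF smooth_on_has_derivative[OF u V(1) q] has_derivative_const])
    have rhs: "((\<lambda>x. jac x * cubic (u x) \<xi> + wedge (Df x \<xi>) (hess f x \<xi> \<xi>)) has_derivative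
      (\<lambda>v. (jac q * (cubic (frechet_derivative u (at q) v) \<xi> + dcubic (u q) \<xi> 0)
         + ((partial 1 f q $ 1 * hess f q v (axis 2 1) $ 2 + hess f q v (axis 1 1) $ 1 * partial 2 f q $ 2)
        - (partial 1 f q $ 2 * hess f q v (axis 2 1) $ 1 + hess f q v (axis 1 1) $ 2 * partial 2 f q $ 1)) * cubic (u q) \<xi>)
       + ((Df q \<xi> $ 1 * third f q v \<xi> \<xi> $ 2 + hess f q v \<xi> $ 1 * hess f q \<xi> \<xi> $ 2)
        - (Df q \<xi> $ 2 * third f q v \<xi> \<xi> $ 1 + hess f q v \<xi> $ 2 * hess f q \<xi> \<xi> $ 1)))) (at q)"
      by (intro has_derivative_add has_derivative_diff has_derivative_mult n J uc fd hd)
    have eq: "frechet_derivative (\<lambda>x. cubic (?P (f x)) (Df x \<xi>)) (at q)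
        = frechet_derivative (\<lambda>x. jac x * cubic (u x) \<xi> + wedge (Df x \<xi>) (hess f x \<xi> \<xi>)) (at q)"
      by (rule frechet_derivative_cong_open[OF V(1) q]) (rule push_section_cubic)
    have "frechet_derivative ?P (at (f q)) (Df q w) = transport ?Y ?P (f q)"
      using dirderiv_eq_transport[OF smooth_on_differentiable[OF P image_open fq], of ?Y] push_field_at[OF q, of X]
      by (simp add: defs)
    moreover have "frechet_derivative u (at q) w = transport X u q"
      using dirderiv_eq_transport[OF smooth_on_differentiable[OF u V(1) q], of X] by (simp add: defs)
    moreover have "hess f q w \<xi> = a" by (simp add: defs hess_commute)
    moreover have "third f q w \<xi> \<xi> = T" by (simp add: defs T_def third_rotate[of f q "X q"])
    moreover have "dcubic (u q) \<xi> 0 = 0" by (simp add: dcubic_def)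
    ultimately show ?thesis
      using fun_cong[OF eq, of w] unfolding frechet_derivative_eqI[OF lhs] frechet_derivative_eqI[OF rhs]
      by (simp add: ct_def da_def cuw_def cu_def dJ_def defs algebra_simps)
  qed
  \<comment> \<open>The divergence of the transported field.\<close>
  have div: "divY * jac q = dJ + jac q * divX"
  proof -
    have m: "frechet_derivative ?Y (at (f q)) (partial i f q) = hess f q w (axis i 1) + Df q (partial i X q)" for i
      using push_field_derivative[OF X q, of "axis i 1"] unfolding partial_def defs by (simp add: hess_commute)
    have "divY * jac q = wedge (frechet_derivative ?Y (at (f q)) (partial 1 f q)) (partial 2 f q)
        + wedge (partial 1 f q) (frechet_derivative ?Y (at (f q)) (partial 2 f q))"
      unfolding divY_def dY by (rule wedge_trace[symmetric])
    also have "\<dots> = dJ + jac q * divX"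
      unfolding m Df_eq[OF q] by (simp add: dJ_def divX_def algebra_simps)
    finally show ?thesis .
  qed
  have tr: "divY * wedge \<eta> h = wedge (a + b) h + wedge \<eta> Mh"
    unfolding divY_def M\<eta>[symmetric] Mh_def dY by (rule wedge_trace[symmetric])
  have "hY + Mh = T + 2 *\<^sub>R k + Df q x2"
    unfolding hY_def Mh_def T_def x2_def defs by (rule push_field_second_derivative[OF X q])
  then have "wedge \<eta> (hY + Mh) = wedge \<eta> (T + 2 *\<^sub>R k + Df q x2)" by simp
  then have hess: "wedge \<eta> hY + wedge \<eta> Mh = wedge \<eta> T + 2 * wedge \<eta> k + jac q * wedge \<xi> x2"
    using wedge_Df[OF q, of \<xi> x2] by (simp add: defs(2)[symmetric] algebra_simps)
  have "cubic (lie_defect ?Y ?P (f q)) \<eta> = divY * cP - dcubic (?P (f q)) \<eta> (frechet_derivative ?Y (at (f q)) \<eta>) + wedge \<eta> hY - ct"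
    unfolding lie_defect_def lie_action_def cubic_diff cubic_add cubic_first_order_part cubic_second_order_part
      divY_def cP_def hY_def hess_def ct_def dY by simp
  also have "\<dots> = divY * (jac q * cu + wedge \<eta> h) - (da + db) + wedge \<eta> hY - ct"
    unfolding M\<eta> dcubic_add star da_def db_def ..
  also have "\<dots> = (divY * jac q) * cu + divY * wedge \<eta> h - db + wedge \<eta> hY - (ct + da)"
    by (simp add: algebra_simps)
  also have "\<dots> = jac q * (divX * cu - dc + wedge \<xi> x2 - cuw)"
    unfolding div tr D1 D2 using hess by (simp add: algebra_simps)
  also have "divX * cu - dc + wedge \<xi> x2 - cuw = cubic (lie_defect X u q) \<xi>"
    unfolding lie_defect_def lie_action_def cubic_diff cubic_add cubic_first_order_part cubic_second_order_part
      divX_def cu_def dc_def x2_def hess_def cuw_def defs dX by simp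
  finally show ?thesis unfolding defs .
qed

end

section \<open>Push-forward of isotropy jets and of the form\<close>

lemma smooth_on_lie_defect:
  assumes "open S" "smooth_on S X" "smooth_on S u"
  shows "smooth_on S (lie_defect X u)"
proof -
  have "smooth_on S (\<lambda>q. first_order_part (fst (partial 1 X q, partial 2 X q)) (snd (partial 1 X q, partial 2 X q)) (u q))"
    by (intro smooth_on_bilinear[OF bounded_bilinear_first_order_part] smooth_on_Pair smooth_on_partial assms)
  moreover have "smooth_on S (\<lambda>q. second_order_part (fst (partial 1 (partial 1 X) q, partial 1 (partial 2 X) q, partial 2 (partial 2 X) q))
      (fst (snd (partial 1 (partial 1 X) q, partial 1 (partial 2 X) q, partial 2 (partial 2 X) q)))
      (snd (snd (partial 1 (partial 1 X) q, partial 1 (partial 2 X) q, partial 2 (partial 2 X) q))))"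
    by (intro smooth_on_linear_image[OF bounded_linear_second_order_part] smooth_on_Pair smooth_on_partial assms)
  ultimately have "smooth_on S (lie_action X u)"
    unfolding lie_action_def[abs_def] fst_conv snd_conv by (intro smooth_on_add assms)
  then show ?thesis
    unfolding lie_defect_def[abs_def] by (intro smooth_on_diff smooth_on_transport assms)
qed

text \<open>Identifies the jet equations used in the algebraic part with the 1-jet of the defect field, the form
  in which naturality is available.\<close>

lemma flat_lie_defect_iff:
  assumes S: "open S" "p \<in> S" and X: "smooth_on S X" and u: "smooth_on S u"
  shows "flat 1 p (lie_defect X u) \<longleftrightarrow> defect00 (jet 2 u p) (jet 3 X p) = 0 \<and>
    defect10 (jet 2 u p) (jet 3 X p) = 0 \<and> defect01 (jet 2 u p) (jet 3 X p) = 0"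
proof -
  note [simp del] = One_nat_def
  have sm: "smooth_on S (lie_defect X u)" by (rule smooth_on_lie_defect[OF S(1) X u])
  have smt: "smooth_on S (transport X u)" by (rule smooth_on_transport[OF S(1) X u])
  have "smooth_on S (\<lambda>q. lie_defect X u q + transport X u q)" by (rule smooth_on_add[OF S(1) sm smt])
  then have sma: "smooth_on S (lie_action X u)" by (simp add: lie_defect_def)
  have 0: "lie_defect X u p = defect00 (jet 2 u p) (jet 3 X p)"
    by (simp add: lie_defect_def lie_action_def transport_def defect00_def jet_components)
  have d: "partial j (lie_defect X u) p = partial j (lie_action X u) p - partial j (transport X u) p" for j
    unfolding partial_def lie_defect_def[abs_def]
    by (rule frechet_derivative_eqI) (intro has_derivative_diff smooth_on_has_derivative[OF _ S] sma smt)
  have 1: "partial 1 (lie_defect X u) p = defect10 (jet 2 u p) (jet 3 X p)"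
    unfolding d partial_lie_action[OF S X u] partial_transport[OF S(1) X u S(2)]
    unfolding transport_def third_partials(1)[OF S u]
    by (simp add: defect10_def jet_components)
  have 2: "partial 2 (lie_defect X u) p = defect01 (jet 2 u p) (jet 3 X p)"
    unfolding d partial_lie_action[OF S X u] partial_transport[OF S(1) X u S(2)] third_partials[OF S X]
    unfolding transport_def third_partials(1)[OF S u]
    by (simp add: defect01_def jet_components)
  have "flat 1 p (lie_defect X u) \<longleftrightarrow> jet 1 (lie_defect X u) p = 0"
    by (rule jet_eq_0_iff_flat[OF S sm, symmetric])
  also have "\<dots> \<longleftrightarrow> lie_defect X u p = 0 \<and> partial 1 (lie_defect X u) p = 0 \<and> partial 2 (lie_defect X u) p = 0"
  proof
    assume "jet 1 (lie_defect X u) p = 0"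
    then have "jet 1 (lie_defect X u) p m = 0" for m by simp
    from this[of "(0,0)"] this[of "(1,0)"] this[of "(0,1)"]
    show "lie_defect X u p = 0 \<and> partial 1 (lie_defect X u) p = 0 \<and> partial 2 (lie_defect X u) p = 0"
      by (simp add: jet_components)
  next
    assume *: "lie_defect X u p = 0 \<and> partial 1 (lie_defect X u) p = 0 \<and> partial 2 (lie_defect X u) p = 0"
    show "jet 1 (lie_defect X u) p = 0"
    proof
      fix m :: "nat \<times> nat"
      obtain i j where m: "m = (i, j)" by (cases m)
      have "i = 0 \<and> j = 0 \<or> i = 1 \<and> j = 0 \<or> i = 0 \<and> j = 1 \<or> \<not> i + j \<le> 1" by linarith
      then show "jet 1 (lie_defect X u) p m = 0 m"
        using * unfolding m by (elim disjE) (simp_all add: jet_components, simp add: jet_def)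
    qed
  qed
  finally show ?thesis unfolding 0 1 2 .
qed

lemma flat_linear_image:
  assumes "bounded_linear A" "open S" "p \<in> S" "smooth_on S h" "flat k p h"
  shows "flat k p (\<lambda>x. A (h x))"
  using assms(4,5)
proof (induction k arbitrary: h)
  case 0 then show ?case using linear_0[OF bounded_linear.linear[OF assms(1)]] by simp
next
  case (Suc k)
  have "flat k p (dirderiv v (\<lambda>x. A (h x))) \<longleftrightarrow> flat k p (\<lambda>x. A (dirderiv v h x))" for v
    by (rule flat_cong[OF assms(2,3)])
      (intro dirderiv_linear_image[OF assms(1)] smooth_on_differentiable[OF Suc.prems(1) assms(2)])
  then show ?case
    using Suc linear_0[OF bounded_linear.linear[OF assms(1)]] by (auto intro: smooth_on_dirderiv)
qed

lemma bounded_linear_coef: "bounded_linear coef0" "bounded_linear coef1" "bounded_linear coef2" "bounded_linear coef3"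
  unfolding linear_conv_bounded_linear[symmetric] by (rule linearI; simp)+

lemma transform_coeffs_expand:
  "transform_coeffs a b 0 0 0 u = coef0 u *\<^sub>R transform_coeffs a b 0 0 0 (1, 0, 0, 0)
     + coef1 u *\<^sub>R transform_coeffs a b 0 0 0 (0, 1, 0, 0) + coef2 u *\<^sub>R transform_coeffs a b 0 0 0 (0, 0, 1, 0)
     + coef3 u *\<^sub>R transform_coeffs a b 0 0 0 (0, 0, 0, 1)"
  by (simp add: transform_coeffs_def fibre_eq_iff algebra_simps)

lemma flat_transform_coeffs:
  assumes S: "open S" "p \<in> S" and sm: "smooth_on S a" "smooth_on S b" "smooth_on S Q"
    and nz: "\<And>x. x \<in> S \<Longrightarrow> wedge (a x) (b x) \<noteq> 0" and fl: "flat k p Q"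
  shows "flat k p (\<lambda>x. transform_coeffs (a x) (b x) 0 0 0 (Q x))"
proof -
  have t: "smooth_on S (\<lambda>x. transform_coeffs (a x) (b x) 0 0 0 c)" for c
    by (intro smooth_on_transform_coeffs S sm smooth_on_const nz)
  show ?thesis
    unfolding transform_coeffs_expand[of _ _ "Q _"]
    by (intro flat_add[OF S] smooth_on_add smooth_on_scaleR smooth_on_coef t sm S
        flat_bilinear[OF bounded_bilinear_scaleR S] flat_linear_image[OF bounded_linear_coef(1) S]
        flat_linear_image[OF bounded_linear_coef(2) S] flat_linear_image[OF bounded_linear_coef(3) S]
        flat_linear_image[OF bounded_linear_coef(4) S] fl)
qed

text \<open>By naturality the new defect field is the old one, composed with the inverse map and multiplied by an
  invertible matrix of smooth functions; neither changes the order of vanishing.\<close>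

lemma flat_lie_defect_push:
  assumes f: "point_transformation U f" and V: "open V" "V \<subseteq> U" "p \<in> V"
    and X: "smooth_on V X" and u: "smooth_on V u" and fl: "flat k p (lie_defect X u)"
  shows "flat k (f p) (lie_defect (push_field U f X) (push_section U f u))"
proof -
  let ?g = "inv_into U f" and ?Q = "lie_defect X u"
  note im = image_open[OF f V(1,2)]
  note gs = inv_smooth[OF f V(1,2)]
  have fp: "f p \<in> f ` V" using V by blast
  have Q: "smooth_on V ?Q" by (rule smooth_on_lie_defect[OF V(1) X u])
  have key: "lie_defect (push_field U f X) (push_section U f u) z
      = transform_coeffs (partial 1 ?g z) (partial 2 ?g z) 0 0 0 (?Q (?g z))"
    and nz: "wedge (partial 1 ?g z) (partial 2 ?g z) \<noteq> 0" if zV: "z \<in> f ` V" for z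
  proof -
    obtain q where q: "q \<in> V" "z = f q" using zV by blast
    have qU: "q \<in> U" using q V by blast
    note p = pt_inverse_partials[OF f qU]
    have w: "wedge (partial 1 ?g (f q)) (partial 2 ?g (f q)) = inverse (wedge (partial 1 f q) (partial 2 f q))"
    proof -
      have "wedge (partial 1 ?g (f q)) (partial 2 ?g (f q)) = inverse (wedge (partial 1 f q) (partial 2 f q))
          * inverse (wedge (partial 1 f q) (partial 2 f q)) * wedge (partial 1 f q) (partial 2 f q)"
        unfolding p(2,3) by (simp add: algebra_simps)
      then show ?thesis using p(1) by simp
    qed
    show "wedge (partial 1 ?g z) (partial 2 ?g z) \<noteq> 0" unfolding q(2) w using p(1) by simp
    have Dg: "frechet_derivative ?g (at (f q)) v = v $ 1 *\<^sub>R partial 1 ?g (f q) + v $ 2 *\<^sub>R partial 2 ?g (f q)" for v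
      by (rule dirderiv_eq_partials) (rule smooth_on_differentiable[OF gs im], use q in blast)
    show "lie_defect (push_field U f X) (push_section U f u) z
      = transform_coeffs (partial 1 ?g z) (partial 2 ?g z) 0 0 0 (?Q (?g z))"
    proof (rule cubic_eqI)
      fix \<eta>
      obtain \<xi> where \<xi>: "\<eta> = frechet_derivative f (at q) \<xi>" using Df_surj[OF f V(1,2) q(1)] by blast
      show "cubic (lie_defect (push_field U f X) (push_section U f u) z) \<eta>
        = cubic (transform_coeffs (partial 1 ?g z) (partial 2 ?g z) 0 0 0 (?Q (?g z))) \<eta>"
        unfolding q(2) cubic_transform_coeffs w Dg[symmetric] inv_f[OF f V(1,2) q(1)]
        unfolding \<xi> lie_defect_natural[OF f V(1,2) X u q(1)] pt_derivative_inverse(1)[OF f qU]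
        by simp
    qed
  qed
  have gp: "?g (f p) = p" by (rule inv_f[OF f V])
  have "flat k (f p) (\<lambda>z. ?Q (?g z))"
    by (rule flat_compose[OF im fp V(1) Q gs]) (use fl gp inv_f[OF f V(1,2)] in auto)
  then have "flat k (f p) (\<lambda>z. transform_coeffs (partial 1 ?g z) (partial 2 ?g z) 0 0 0 (?Q (?g z)))"
    by (intro flat_transform_coeffs[OF im fp] smooth_on_partial gs smooth_on_pullback_inv[OF f V(1,2)] Q nz)
  moreover note flat_cong[OF im fp, of "lie_defect (push_field U f X) (push_section U f u)"
      "\<lambda>z. transform_coeffs (partial 1 ?g z) (partial 2 ?g z) 0 0 0 (?Q (?g z))" k, OF key]
  ultimately show ?thesis by (simp only:)
qed

lemma flat_push_field:
  assumes f: "point_transformation U f" and V: "open V" "V \<subseteq> U" "p \<in> V"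
    and X: "smooth_on V X" and fl: "flat k p X"
  shows "flat k (f p) (push_field U f X)"
proof -
  let ?g = "inv_into U f"
  note im = image_open[OF f V(1,2)] and gs = inv_smooth[OF f V(1,2)] and fs = f_smooth[OF f V(1,2)]
  have fp: "f p \<in> f ` V" using V by blast
  have "flat k p (\<lambda>q. X q $ 1 *\<^sub>R partial 1 f q + X q $ 2 *\<^sub>R partial 2 f q)"
    by (intro flat_add[OF V(1,3)] smooth_on_scaleR smooth_on_nth smooth_on_partial fs X V(1)
        flat_bilinear[OF bounded_bilinear_scaleR V(1,3)] flat_linear_image[OF bounded_linear_vec_nth V(1,3)] fl)
  moreover have "frechet_derivative f (at q) (X q) = X q $ 1 *\<^sub>R partial 1 f q + X q $ 2 *\<^sub>R partial 2 f q"
    if "q \<in> V" for q by (rule Df_eq[OF f V(1,2) that])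
  ultimately have "flat k p (\<lambda>q. frechet_derivative f (at q) (X q))"
    using flat_cong[OF V(1,3), of "\<lambda>q. frechet_derivative f (at q) (X q)"
        "\<lambda>q. X q $ 1 *\<^sub>R partial 1 f q + X q $ 2 *\<^sub>R partial 2 f q" k] by blast
  then have "flat k (f p) (\<lambda>z. (\<lambda>q. frechet_derivative f (at q) (X q)) (?g z))"
    by (intro flat_compose[OF im fp V(1) smooth_on_derivative_along[OF V(1) fs X] gs])
      (use inv_f[OF f V(1,2)] V(3) in auto)
  then show ?thesis by (simp add: push_field_def[abs_def])
qed

text \<open>The push-forward of a jet of a field is well defined: it depends on the chosen germ only through
  the jet. The scalar \<open>c\<close> absorbs the values of the form on different pairs of vectors.\<close>

lemma jet_push_field_cong:
  assumes f: "point_transformation U f" and V: "open V" "V \<subseteq> U" "p \<in> V"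
    and X: "smooth_on V X" and Y: "smooth_on V Y" and eq: "jet k X p = c *\<^sub>R jet k Y p"
  shows "jet k (push_field U f X) (f p) = c *\<^sub>R jet k (push_field U f Y) (f p)"
proof -
  note im = image_open[OF f V(1,2)] and sp = smooth_push_field[OF f V(1,2)]
  have fp: "f p \<in> f ` V" using V by blast
  have cY: "smooth_on V (\<lambda>q. c *\<^sub>R Y q)" by (intro smooth_on_scaleR smooth_on_const Y V(1))
  have "flat k p (\<lambda>q. X q - c *\<^sub>R Y q)"
    using eq jet_scaleR[OF V(1,3) Y, of k c] jet_eq_iff_flat_diff[OF V(1,3) X cY, of k] by simp
  from flat_push_field[OF f V smooth_on_diff[OF V(1) X cY] this]
  have "flat k (f p) (push_field U f (\<lambda>q. X q - c *\<^sub>R Y q))" .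
  moreover have "push_field U f (\<lambda>q. X q - c *\<^sub>R Y q) z = push_field U f X z - c *\<^sub>R push_field U f Y z"
    if zV: "z \<in> f ` V" for z
  proof -
    obtain q where q: "q \<in> V" "z = f q" using zV by blast
    show ?thesis
      unfolding q(2) push_field_at[OF f V(1,2) q(1)]
      using Df_linear[OF f V(1,2) q(1)] by (simp add: linear_diff linear_cmul)
  qed
  ultimately have "flat k (f p) (\<lambda>z. push_field U f X z - c *\<^sub>R push_field U f Y z)"
    using flat_cong[OF im fp, of "push_field U f (\<lambda>q. X q - c *\<^sub>R Y q)"
        "\<lambda>z. push_field U f X z - c *\<^sub>R push_field U f Y z" k] by blast
  moreover have "smooth_on (f ` V) (\<lambda>z. c *\<^sub>R push_field U f Y z)"
    by (intro smooth_on_scaleR smooth_on_const sp Y im)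
  ultimately show ?thesis
    using jet_eq_iff_flat_diff[OF im fp sp[OF X], of "\<lambda>z. c *\<^sub>R push_field U f Y z" k]
      jet_scaleR[OF im fp sp[OF Y], of k c] by simp
qed

lemma vf_jets_ex_smooth:
  assumes "\<xi> \<in> vf_jets k p"
  obtains X where "smooth_near p X" "jet k X p = \<xi>"
  using assms unfolding vf_jets_def by blast

theorem theorem4p3:
  fixes f :: "real^2 \<Rightarrow> real^2" and U :: "(real^2) set" and p :: "real^2" and \<theta> :: jet_point
  assumes "point_transformation U f"
    and "p \<in> U"
    and "\<theta> \<in> jet_fibre 2 p"
  shows "\<forall>v w. omega (lift 2 U f \<theta>) (frechet_derivative f (at p) v) (frechet_derivative f (at p) w)
           = push_jet 2 U f p (omega \<theta> v w)"
proof (intro allI)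
  fix v w :: "real^2"
  note f = assms(1)
  obtain u0 where u0: "smooth_near p u0" "\<theta> = (p, jet 2 u0 p)"
    using assms(3) by (auto simp: jet_fibre_def)
  define u where "u = jet_rep 2 p (jet 2 u0 p)"
  have u: "smooth_near p u" "jet 2 u p = jet 2 u0 p" using jet_rep[OF u0(1), of 2] by (auto simp: u_def)
  define \<upsilon> where "\<upsilon> = jet 2 u p"
  have \<theta>: "\<theta> = (p, jet 2 u p)" by (simp add: u u0(2))
  obtain X where X: "smooth_near p X" "jet 3 X p = lift3 \<upsilon> (axis 1 1)"
    using vf_jets_ex_smooth[OF lift_in_vf_jets(2)] .
  obtain Y where Y: "smooth_near p Y" "jet 3 Y p = lift3 \<upsilon> (axis 2 1)"
    using vf_jets_ex_smooth[OF lift_in_vf_jets(2)] .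
  have lj: "wedge v w *\<^sub>R liouville_jet \<upsilon> \<in> vf_jets 2 p"
    by (auto simp: vf_jets_iff scaleR_fun_def liouville_jet_def)
  define Z where "Z = jet_rep 2 p (wedge v w *\<^sub>R liouville_jet \<upsilon>)"
  have Z: "smooth_near p Z" "jet 2 Z p = wedge v w *\<^sub>R liouville_jet \<upsilon>"
  proof -
    obtain h where "smooth_near p h" "jet 2 h p = wedge v w *\<^sub>R liouville_jet \<upsilon>" using vf_jets_ex_smooth[OF lj] .
    then show "smooth_near p Z" "jet 2 Z p = wedge v w *\<^sub>R liouville_jet \<upsilon>"
      using jet_rep[of p h 2] by (auto simp: Z_def)
  qed
  obtain S1 where S1: "open S1" "p \<in> S1" "smooth_on S1 X" "smooth_on S1 Y" by (rule smooth_near_common[OF X(1) Y(1)])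
  obtain S2 where S2: "open S2" "p \<in> S2" "smooth_on S2 u" "smooth_on S2 Z" by (rule smooth_near_common[OF u(1) Z(1)])
  define V where "V = U \<inter> (S1 \<inter> S2)"
  have V: "open V" "V \<subseteq> U" "p \<in> V"
    using S1 S2 assms(2) pt_open[OF f] by (auto simp: V_def)
  have sX: "smooth_on V X" and sY: "smooth_on V Y" and su: "smooth_on V u" and sZ: "smooth_on V Z"
    by (rule smooth_on_subset[OF S1(3)] smooth_on_subset[OF S1(4)] smooth_on_subset[OF S2(3)] smooth_on_subset[OF S2(4)],
        auto simp: V_def)+
  note im = image_open[OF f V(1,2)] and sp = smooth_push_field[OF f V(1,2)]
  have fp: "f p \<in> f ` V" using V by blast
  define u' where "u' = push_section U f u"
  have su': "smooth_on (f ` V) u'" unfolding u'_def by (rule smooth_push_section[OF f V(1,2) su])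
  have nu': "smooth_near (f p) u'" unfolding smooth_near_def using im fp su' by blast
  define \<upsilon>' where "\<upsilon>' = jet 2 u' (f p)"
  have lift: "lift 2 U f \<theta> = (f p, jet 2 u' (f p))"
    by (simp add: lift_def prolong_def u0(2) u'_def u_def)
  let ?X = "push_field U f X" and ?Y = "push_field U f Y" and ?B = "lie_bracket X Y"
  let ?\<xi> = "jet 3 ?X (f p)" and ?\<eta> = "jet 3 ?Y (f p)"
  \<comment> \<open>The bracket of the two representatives has as 2-jet the value of the form on the standard frame.\<close>
  have sB: "smooth_on V ?B" by (rule smooth_on_lie_bracket[OF V(1) sX sY])
  have jB: "jet 2 ?B p = liouville_jet \<upsilon>"
  proof -
    have lt: "i + j < 3 \<longleftrightarrow> i + j \<le> 2" for i j :: nat by linarith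
    have "(\<lambda>(i, j). if i + j \<le> 2 then bracket (lift3 \<upsilon> (axis 1 1)) (lift3 \<upsilon> (axis 2 1)) (i, j) else 0) = liouville_jet \<upsilon>"
      using omega_eq[OF u(1), folded \<upsilon>_def, of "axis 1 1" "axis 2 1"]
      unfolding omega_def fst_conv H2_eq[OF u(1), folded \<upsilon>_def] horizontal_lift3(2)
        jet_bracket_eq[OF lift_in_vf_jets(2)[of \<upsilon> "axis 1 1" p] lift_in_vf_jets(2)[of \<upsilon> "axis 2 1" p] order_refl one_le_numeral]
      by (simp add: lt)
    then show ?thesis
      using jet_lie_bracket[OF V(1,3) sX sY, of 2 3] unfolding X(2) Y(2) by simp
  qed
  have jpB: "jet k (lie_bracket ?X ?Y) (f p) = jet k (push_field U f ?B) (f p)" for k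
  proof (rule jet_cong_open[OF im fp])
    fix z assume "z \<in> f ` V"
    then obtain q where "q \<in> V" "z = f q" by blast
    then show "lie_bracket ?X ?Y z = push_field U f ?B z" using lie_bracket_push_field[OF f V(1,2) sX sY] by simp
  qed
  have j1: "jet 1 ?B p = 0"
  proof -
    have "jet 1 ?B p = jet_trunc 1 (liouville_jet \<upsilon>)" using jet_trunc_jet[of 1 2 ?B p] jB by simp
    also have "\<dots> = 0" by (auto simp: jet_trunc_def liouville_jet_def fun_eq_iff)
    finally show ?thesis .
  qed
  have "jet 1 (push_field U f ?B) (f p) = 0 *\<^sub>R jet 1 (push_field U f ?B) (f p)"
    by (rule jet_push_field_cong[OF f V sB sB]) (simp only: j1 scaleR_zero_right)
  then have "jet 1 (lie_bracket ?X ?Y) (f p) = 0" using jpB by simp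
  then have jb0: "(if i + j \<le> 1 then bracket ?\<xi> ?\<eta> (i, j) else 0) = 0" for i j
    using fun_cong[OF jet_lie_bracket[OF im fp sp[OF sX] sp[OF sY], of 1 3], of "(i, j)"] by simp
  have br: "bracket ?\<xi> ?\<eta> (0,0) = 0" "bracket ?\<xi> ?\<eta> (1,0) = 0" "bracket ?\<xi> ?\<eta> (0,1) = 0"
    using jb0[of 0 0] jb0[of 1 0] jb0[of 0 1] by simp_all
  \<comment> \<open>The transported fields are again infinitesimal symmetries to first order.\<close>
  have dX: "flat 1 p (lie_defect X u)" and dY: "flat 1 p (lie_defect Y u)"
    unfolding flat_lie_defect_iff[OF V(1,3) sX su] flat_lie_defect_iff[OF V(1,3) sY su] X(2) Y(2) \<upsilon>_def[symmetric]
    by (simp_all add: defect_lift3)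
  have d: "defect00 \<upsilon>' ?\<xi> = 0" "defect10 \<upsilon>' ?\<xi> = 0" "defect01 \<upsilon>' ?\<xi> = 0"
    "defect00 \<upsilon>' ?\<eta> = 0" "defect10 \<upsilon>' ?\<eta> = 0" "defect01 \<upsilon>' ?\<eta> = 0"
    using flat_lie_defect_push[OF f V sX su dX] flat_lie_defect_push[OF f V sY su dY]
    unfolding u'_def[symmetric] \<upsilon>'_def flat_lie_defect_iff[OF im fp sp[OF sX] su'] flat_lie_defect_iff[OF im fp sp[OF sY] su']
    by blast+
  define J where "J = wedge (partial 1 f p) (partial 2 f p)"
  have val: "?\<xi> (0,0) = partial 1 f p" "?\<eta> (0,0) = partial 2 f p"
  proof -
    have "X p = axis 1 1" "Y p = axis 2 1"
      using fun_cong[OF X(2), of "(0,0)"] fun_cong[OF Y(2), of "(0,0)"] jet_value_lift(2)[of \<upsilon>]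
      by (simp_all add: jet_components jet_value_def)
    then show "?\<xi> (0,0) = partial 1 f p" "?\<eta> (0,0) = partial 2 f p"
      by (simp_all add: jet_components push_field_at[OF f V] partial_def)
  qed
  have J0: "wedge (?\<xi> (0,0)) (?\<eta> (0,0)) \<noteq> 0" unfolding val by (rule jac_nonzero[OF f V])
  have "bracket ?\<xi> ?\<eta> (i, j) = J *\<^sub>R liouville_jet \<upsilon>' (i, j)" if "i + j \<le> 2" for i j
    using bracket_frame[OF J0 d br that] unfolding val J_def .
  then have "jet 2 (lie_bracket ?X ?Y) (f p) = J *\<^sub>R liouville_jet \<upsilon>'"
    using jet_lie_bracket[OF im fp sp[OF sX] sp[OF sY], of 2 3]
    by (auto simp: fun_eq_iff scaleR_fun_def liouville_jet_def)
  then have push: "jet 2 (push_field U f ?B) (f p) = J *\<^sub>R liouville_jet \<upsilon>'" using jpB by simp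
  have "push_jet 2 U f p (omega \<theta> v w) = jet 2 (push_field U f Z) (f p)"
    unfolding \<theta> omega_eq[OF u(1)] push_jet_def Z_def \<upsilon>_def ..
  also have "\<dots> = wedge v w *\<^sub>R jet 2 (push_field U f ?B) (f p)"
    by (rule jet_push_field_cong[OF f V sZ sB]) (simp add: Z(2) jB)
  also have "\<dots> = (J * wedge v w) *\<^sub>R liouville_jet \<upsilon>'" unfolding push by (simp add: mult.commute)
  also have "\<dots> = omega (lift 2 U f \<theta>) (frechet_derivative f (at p) v) (frechet_derivative f (at p) w)"
    unfolding lift omega_eq[OF nu'] \<upsilon>'_def J_def wedge_Df[OF f V] ..
  finally show "omega (lift 2 U f \<theta>) (frechet_derivative f (at p) v) (frechet_derivative f (at p) w)
           = push_jet 2 U f p (omega \<theta> v w)" ..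
qed

end
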